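(* Let $\mathcal C$ be a non-unital cyclic operad in $k$-vector spaces. Then the composition of $\mathcal C$ induces (1) a $k\mathsf{db}$-module structure on $S_\odot^*(\mathcal C)$, natural in $\mathcal C$, extending its $k\mathsf{FB}$-module structure and such that, for every finite set $X$ and all $u\ne v$ in $X$, the morphism $g_{u,v}\colon X\to X\setminus\{u,v\}$ acts as follows on the class $c_1\cdots c_n$ of $c_1\otimes\dots\otimes c_n$ with $c_i\in\mathcal C(U_i)$, $X=U_1\amalg\dots\amalg U_n$: the image is $0$ if $u,v$ lie in the same $U_i$, and if $u\in U_i$, $v\in U_j$ with $i\neq j$ then it is obtained by replacing the two factors $c_i,c_j$ by the single factor $\iota_{u,v}(c_i\otimes c_j)$; (2) a $(k\mathsf{db})_{(-;-)}$-module structure on $\Lambda_\odot^*(\mathcal C)$, natural in $\mathcal C$, extending its $k\mathsf{FB}$-module structure and such that $g_{u,v}$ sends the class $c_1\wedge\dots\wedge c_n$ to $0$ if $u,v$ lie in the same $U_i$, and sends $c_1\wedge\dots\wedge c_n$ with $u\in U_{n-1}$, $v\in U_n$ to $c_1\wedge\dots\wedge c_{n-2}\wedge\iota_{u,v}(c_{n-1}\otimes c_n)$ (the remaining cases being determined by reordering the factors with sign).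
   Context: $k$ is a field of characteristic zero, $\mathbf n=\{1,\dots,n\}$, $S_n$ the symmetric group, $\mathrm{sgn}_n$ its sign representation. For a $k$-linear category $\mathcal A$, an $\mathcal A$-module is a $k$-linear functor from $\mathcal A$ to $k$-vector spaces. $\mathsf{FB}$ is the category of finite sets and bijections, $k\mathsf{FB}$ its $k$-linearization. Twisted Brauer categories. For finite sets $X,Y$ with $|Y|-|X|=2t$, $t\in\mathbb N$, let $D(X,Y)$ be the set of bijections $X\amalg\mathbf{2t}\to Y$; the composite of $f\colon X\amalg\mathbf{2s}\to Y$ and $g\colon Y\amalg\mathbf{2t}\to Z$ is $X\amalg\mathbf{2(s+t)}\cong X\amalg\mathbf{2s}\amalg\mathbf{2t}\to Y\amalg\mathbf{2t}\to Z$ (using the order-preserving identification with $\mathbf{2s}$ first). The group $S_2\wr S_t\subset S_{2t}$ (permutations preserving the partition of $\mathbf{2t}$ into the pairs $\{2i-1,2i\}$) acts on the right on $D(X,Y)$ by precomposition. Its representations $k_{(\epsilon;\delta)}$ are: $k_{(+;+)}$ trivial; $k_{(-;+)}$ the restriction of $\mathrm{sgn}_{2t}$; $k_{(+;-)}$ the pullback of $\mathrm{sgn}_t$ along $S_2\wr S_t\to S_t$; $k_{(-;-)}=k_{(-;+)}\otimes k_{(+;-)}$. The $k$-linear category $(k\mathsf{ub})_{(\epsilon;\delta)}$ has objects finite sets and morphisms $X\to Y$ given by $kD(X,Y)\otimes_{k[S_2\wr S_t]}k_{(\epsilon;\delta)}$ if $|Y|-|X|=2t\ge 0$ and $0$ otherwise,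 with composition induced by that of $D$; such morphisms have degree $t$, and the degree $0$ part is $k\mathsf{FB}$. $(k\mathsf{db})_{(\epsilon;\delta)}$ is the opposite category, and $k\mathsf{db}=(k\mathsf{db})_{(+;+)}$; its degree $0$ part is identified with $k\mathsf{FB}$ by inverting bijections. For an ordered pair $(u,v)$ of distinct elements of $X$, $g_{u,v}\colon X\to X\setminus\{u,v\}$ denotes the morphism of $(k\mathsf{db})_{(\epsilon;\delta)}$ given by the class of the bijection $(X\setminus\{u,v\})\amalg\mathbf 2\to X$ that is the identity on $X\setminus\{u,v\}$ and sends $1\mapsto u$, $2\mapsto v$. Non-unital cyclic operads. A non-unital cyclic operad $\mathcal C$ is a $k\mathsf{FB}$-module with composition maps $\iota_{u,v}\colon\mathcal C(U)\otimes\mathcal C(V)\to\mathcal C((U\setminus\{u\})\amalg(V\setminus\{v\}))$ for disjoint finite sets $U\ni u$, $V\ni v$, natural for bijections of $U$ and $V$, symmetric ($\iota_{u,v}(a\otimes b)=\iota_{v,u}(b\otimes a)$) and associative ($\iota_{v',w}(\iota_{u,v}(a\otimes b)\otimes c)=\iota_{u,v}(a\otimes\iota_{v',w}(b\otimes c))$ for $u\in U$, $v\ne v'\in V$, $w\in W$); no unit is required. Morphisms are the morphisms of $k\mathsf{FB}$-modules compatible with the compositions. Standing assumption: $\mathcal C(\emptyset)=0$. For a $k\mathsf{FB}$-module $F$, $F^{\odot n}(X)=\bigoplus_{X=U_1\amalg\dots\amalg U_n}F(U_1)\otimes\dots\otimes F(U_n)$ (ordered decompositions; for $n=0$ it is $k$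 supported on $\emptyset$), with $S_n$ permuting the factors. $S_\odot^n(F)=F^{\odot n}/S_n$, $\Lambda_\odot^n(F)=(\mathrm{sgn}_n\otimes F^{\odot n})/S_n$ (coinvariants), $S_\odot^*=\bigoplus_nS_\odot^n$, $\Lambda_\odot^*=\bigoplus_n\Lambda_\odot^n$. *)

theory Defs
  imports
    "HOL-Algebra.Module"
    "HOL-Algebra.AbelCoset"
    "HOL-Combinatorics.Permutations"
    "HOL-Library.Infinite_Typeclass"
begin

section \<open>Vector spaces\<close>

text \<open>
  Vector spaces over a field \<open>K\<close> are modules over \<open>K\<close> in the sense of the locale
  \<^locale>\<open>Module.module\<close>. The record of a module also has the fields \<open>mult\<close> and \<open>one\<close>, which
  that locale does not constrain; they are left undefined below.
\<close>

definition char_zero :: "('k, 'x) ring_scheme \<Rightarrow> bool" where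
  "char_zero K \<longleftrightarrow> (\<forall>n::nat. n > 0 \<longrightarrow> add_pow K n \<one>\<^bsub>K\<^esub> \<noteq> \<zero>\<^bsub>K\<^esub>)"

definition lin_maps :: "'k ring \<Rightarrow> ('k, 'v) module \<Rightarrow> ('k, 'w) module \<Rightarrow> ('v \<Rightarrow> 'w) set" where
  "lin_maps K V W =
     {T \<in> carrier V \<rightarrow> carrier W.
        (\<forall>x\<in>carrier V. \<forall>y\<in>carrier V. T (x \<oplus>\<^bsub>V\<^esub> y) = T x \<oplus>\<^bsub>W\<^esub> T y) \<and>
        (\<forall>a\<in>carrier K. \<forall>x\<in>carrier V. T (a \<odot>\<^bsub>V\<^esub> x) = a \<odot>\<^bsub>W\<^esub> T x)}"

text \<open>
  The linear map \<open>V \<rightarrow> W\<close> that sends \<open>e i\<close> to \<open>w i\<close> for all \<open>i \<in> I\<close>. This is only used for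
  families \<open>e\<close> that span \<open>V\<close>, so there is at most one such map.
\<close>

definition lin_map_of ::
    "'k ring \<Rightarrow> ('k, 'v) module \<Rightarrow> ('k, 'w) module \<Rightarrow> 'i set \<Rightarrow> ('i \<Rightarrow> 'v) \<Rightarrow> ('i \<Rightarrow> 'w) \<Rightarrow> 'v \<Rightarrow> 'w" where
  "lin_map_of K V W I e w x = (THE y. \<exists>T\<in>lin_maps K V W. (\<forall>i\<in>I. T (e i) = w i) \<and> y = T x)"

definition lin_span :: "'k ring \<Rightarrow> ('k, 'v) module \<Rightarrow> 'v set \<Rightarrow> 'v set" where
  "lin_span K V S = \<Inter>{N. submodule N K V \<and> S \<subseteq> N}"

definition quot_space :: "('k, 'v) module \<Rightarrow> 'v set \<Rightarrow> ('k, 'v set) module" where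
  "quot_space V N =
     \<lparr>carrier = a_rcosets\<^bsub>V\<^esub> N, monoid.mult = undefined, one = undefined,
      zero = N, add = set_add V, smult = (\<lambda>a A. \<Union>x\<in>A. N +>\<^bsub>V\<^esub> (a \<odot>\<^bsub>V\<^esub> x))\<rparr>"

definition dsum :: "'i set \<Rightarrow> ('i \<Rightarrow> ('k, 'v) module) \<Rightarrow> ('k, 'i \<Rightarrow> 'v) module" where
  "dsum I V =
     \<lparr>carrier = {x \<in> (\<Pi>\<^sub>E i\<in>I. carrier (V i)). finite {i \<in> I. x i \<noteq> \<zero>\<^bsub>V i\<^esub>}},
      monoid.mult = undefined, one = undefined,
      zero = (\<lambda>i\<in>I. \<zero>\<^bsub>V i\<^esub>), add = (\<lambda>x y. \<lambda>i\<in>I. x i \<oplus>\<^bsub>V i\<^esub> y i),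
      smult = (\<lambda>a x. \<lambda>i\<in>I. a \<odot>\<^bsub>V i\<^esub> x i)\<rparr>"

definition dsum_in :: "'i set \<Rightarrow> ('i \<Rightarrow> ('k, 'v) module) \<Rightarrow> 'i \<Rightarrow> 'v \<Rightarrow> 'i \<Rightarrow> 'v" where
  "dsum_in I V i v = (\<lambda>j\<in>I. if j = i then v else \<zero>\<^bsub>V j\<^esub>)"

definition base_space :: "'k ring \<Rightarrow> ('k, 'k) module" where
  "base_space K =
     \<lparr>carrier = carrier K, monoid.mult = (\<otimes>\<^bsub>K\<^esub>), one = \<one>\<^bsub>K\<^esub>, zero = \<zero>\<^bsub>K\<^esub>, add = (\<oplus>\<^bsub>K\<^esub>),
      smult = (\<otimes>\<^bsub>K\<^esub>)\<rparr>"

definition free_space :: "'k ring \<Rightarrow> 'b set \<Rightarrow> ('k, 'b \<Rightarrow> 'k) module" where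
  "free_space K B = dsum B (\<lambda>_. base_space K)"

definition free_gen :: "'k ring \<Rightarrow> 'b set \<Rightarrow> 'b \<Rightarrow> 'b \<Rightarrow> 'k" where
  "free_gen K B b = dsum_in B (\<lambda>_. base_space K) b \<one>\<^bsub>K\<^esub>"

definition free_supp :: "'k ring \<Rightarrow> 'b set \<Rightarrow> ('b \<Rightarrow> 'k) \<Rightarrow> 'b set" where
  "free_supp K B x = {b \<in> B. x b \<noteq> \<zero>\<^bsub>K\<^esub>}"

text \<open>
  The tensor product of a list of vector spaces: the free vector space on the tuples of vectors,
  modulo the relations of multilinearity. It is one-dimensional for the empty list.
\<close>

definition tuples :: "('k, 'v) module list \<Rightarrow> 'v list set" where
  "tuples Vs = {vs. list_all2 (\<lambda>v V. v \<in> carrier V) vs Vs}"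

definition tensor_rels :: "'k ring \<Rightarrow> ('k, 'v) module list \<Rightarrow> ('v list \<Rightarrow> 'k) set" where
  "tensor_rels K Vs =
     (let F = free_space K (tuples Vs); \<delta> = free_gen K (tuples Vs) in
       {\<delta> (vs[i := x \<oplus>\<^bsub>Vs ! i\<^esub> y]) \<ominus>\<^bsub>F\<^esub> (\<delta> (vs[i := x]) \<oplus>\<^bsub>F\<^esub> \<delta> (vs[i := y])) | vs i x y.
          vs \<in> tuples Vs \<and> i < length Vs \<and> x \<in> carrier (Vs ! i) \<and> y \<in> carrier (Vs ! i)} \<union>
       {\<delta> (vs[i := a \<odot>\<^bsub>Vs ! i\<^esub> x]) \<ominus>\<^bsub>F\<^esub> a \<odot>\<^bsub>F\<^esub> \<delta> (vs[i := x]) | vs i a x.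
          vs \<in> tuples Vs \<and> i < length Vs \<and> a \<in> carrier K \<and> x \<in> carrier (Vs ! i)})"

definition tensor_null :: "'k ring \<Rightarrow> ('k, 'v) module list \<Rightarrow> ('v list \<Rightarrow> 'k) set" where
  "tensor_null K Vs = lin_span K (free_space K (tuples Vs)) (tensor_rels K Vs)"

definition tensor :: "'k ring \<Rightarrow> ('k, 'v) module list \<Rightarrow> ('k, ('v list \<Rightarrow> 'k) set) module" where
  "tensor K Vs = quot_space (free_space K (tuples Vs)) (tensor_null K Vs)"

definition pure_tensor :: "'k ring \<Rightarrow> ('k, 'v) module list \<Rightarrow> 'v list \<Rightarrow> ('v list \<Rightarrow> 'k) set" where
  "pure_tensor K Vs vs =
     tensor_null K Vs +>\<^bsub>free_space K (tuples Vs)\<^esub> free_gen K (tuples Vs) vs"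


section \<open>Linear categories and their modules\<close>

text \<open>In both records, \<open>cmp X Y Z g f\<close> is the composite of \<open>f : X \<rightarrow> Y\<close> and \<open>g : Y \<rightarrow> Z\<close>.\<close>

record ('o, 'm) cat =
  ob :: "'o set"
  arr :: "'o \<Rightarrow> 'o \<Rightarrow> 'm set"
  ident :: "'o \<Rightarrow> 'm"
  cmp :: "'o \<Rightarrow> 'o \<Rightarrow> 'o \<Rightarrow> 'm \<Rightarrow> 'm \<Rightarrow> 'm"

record ('o, 'k, 'm) lincat =
  lob :: "'o set"
  lhom :: "'o \<Rightarrow> 'o \<Rightarrow> ('k, 'm) module"
  lident :: "'o \<Rightarrow> 'm"
  lcomp :: "'o \<Rightarrow> 'o \<Rightarrow> 'o \<Rightarrow> 'm \<Rightarrow> 'm \<Rightarrow> 'm"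

definition linearization :: "'k ring \<Rightarrow> ('o, 'm) cat \<Rightarrow> ('o, 'k, 'm \<Rightarrow> 'k) lincat" where
  "linearization K D =
     \<lparr>lob = ob D,
      lhom = (\<lambda>X Y. free_space K (arr D X Y)),
      lident = (\<lambda>X. free_gen K (arr D X X) (ident D X)),
      lcomp = (\<lambda>X Y Z b a.
        let F = free_space K (arr D X Z) in
          \<Oplus>\<^bsub>F\<^esub>g\<in>free_supp K (arr D Y Z) b. \<Oplus>\<^bsub>F\<^esub>f\<in>free_supp K (arr D X Y) a.
            (b g \<otimes>\<^bsub>K\<^esub> a f) \<odot>\<^bsub>F\<^esub> free_gen K (arr D X Z) (cmp D X Y Z g f))\<rparr>"

definition opposite :: "('o, 'k, 'm) lincat \<Rightarrow> ('o, 'k, 'm) lincat" where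
  "opposite A =
     \<lparr>lob = lob A, lhom = (\<lambda>X Y. lhom A Y X), lident = lident A,
      lcomp = (\<lambda>X Y Z g f. lcomp A Z Y X f g)\<rparr>"

record ('o, 'm, 'k, 'v) functor_data =
  space :: "'o \<Rightarrow> ('k, 'v) module"
  act :: "'o \<Rightarrow> 'o \<Rightarrow> 'm \<Rightarrow> 'v \<Rightarrow> 'v"

text \<open>Modules over a linear category: linear functors to vector spaces.\<close>

locale cat_module =
  fixes K :: "'k ring"
    and A :: "('o, 'k, 'm) lincat"
    and M :: "('o, 'm, 'k, 'v, 'z) functor_data_scheme"
  assumes space_module: "X \<in> lob A \<Longrightarrow> Module.module K (space M X)"
    and act_closed: "\<lbrakk>X \<in> lob A; Y \<in> lob A; h \<in> carrier (lhom A X Y)\<rbrakk>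
      \<Longrightarrow> act M X Y h \<in> lin_maps K (space M X) (space M Y)"
    and act_add: "\<lbrakk>X \<in> lob A; Y \<in> lob A; h \<in> carrier (lhom A X Y); h' \<in> carrier (lhom A X Y);
        x \<in> carrier (space M X)\<rbrakk>
      \<Longrightarrow> act M X Y (h \<oplus>\<^bsub>lhom A X Y\<^esub> h') x = act M X Y h x \<oplus>\<^bsub>space M Y\<^esub> act M X Y h' x"
    and act_smult: "\<lbrakk>X \<in> lob A; Y \<in> lob A; a \<in> carrier K; h \<in> carrier (lhom A X Y);
        x \<in> carrier (space M X)\<rbrakk>
      \<Longrightarrow> act M X Y (a \<odot>\<^bsub>lhom A X Y\<^esub> h) x = a \<odot>\<^bsub>space M Y\<^esub> act M X Y h x"
    and act_ident: "\<lbrakk>X \<in> lob A; x \<in> carrier (space M X)\<rbrakk> \<Longrightarrow> act M X X (lident A X) x = x"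
    and act_comp: "\<lbrakk>X \<in> lob A; Y \<in> lob A; Z \<in> lob A; f \<in> carrier (lhom A X Y);
        g \<in> carrier (lhom A Y Z); x \<in> carrier (space M X)\<rbrakk>
      \<Longrightarrow> act M X Z (lcomp A X Y Z g f) x = act M Y Z g (act M X Y f x)"

definition cat_module_hom ::
    "'k ring \<Rightarrow> ('o, 'k, 'm) lincat \<Rightarrow> ('o, 'm, 'k, 'v, 'z) functor_data_scheme \<Rightarrow>
     ('o, 'm, 'k, 'w, 'y) functor_data_scheme \<Rightarrow> ('o \<Rightarrow> 'v \<Rightarrow> 'w) \<Rightarrow> bool" where
  "cat_module_hom K A M M' T \<longleftrightarrow>
     (\<forall>X\<in>lob A. T X \<in> lin_maps K (space M X) (space M' X)) \<and>
     (\<forall>X\<in>lob A. \<forall>Y\<in>lob A. \<forall>h\<in>carrier (lhom A X Y). \<forall>x\<in>carrier (space M X).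
        T Y (act M X Y h x) = act M' X Y h (T X x))"


section \<open>Twisted Brauer categories\<close>

text \<open>
  The finite sets are the finite subsets of an arbitrary type \<open>'a\<close>. Bijections with domain \<open>A\<close>
  are represented by functions that are undefined outside \<open>A\<close>.
\<close>

abbreviation coprod :: "'a set \<Rightarrow> 'b set \<Rightarrow> ('a + 'b) set" (infixr "\<amalg>" 65) where
  "A \<amalg> B \<equiv> Sum_Type.Plus A B"

definition FB :: "('a set, 'a \<Rightarrow> 'a) cat" where
  "FB = \<lparr>ob = {X. finite X},
         arr = (\<lambda>X Y. {f \<in> extensional X. bij_betw f X Y}),
         ident = (\<lambda>X. \<lambda>x\<in>X. x),
         cmp = (\<lambda>X Y Z g f. compose X g f)\<rparr>"

definition kFB :: "'k ring \<Rightarrow> ('a set, 'k, ('a \<Rightarrow> 'a) \<Rightarrow> 'k) lincat" where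
  "kFB K = linearization K FB"

abbreviation kFB_gen :: "'k ring \<Rightarrow> 'a set \<Rightarrow> 'a set \<Rightarrow> ('a \<Rightarrow> 'a) \<Rightarrow> ('a \<Rightarrow> 'a) \<Rightarrow> 'k" where
  "kFB_gen K X Y f \<equiv> free_gen K (arr FB X Y) f"

definition half_diff :: "'a set \<Rightarrow> 'a set \<Rightarrow> nat" where
  "half_diff X Y = (card Y - card X) div 2"

definition brauer :: "('a set, 'a + nat \<Rightarrow> 'a) cat" where
  "brauer =
     \<lparr>ob = {X. finite X},
      arr = (\<lambda>X Y. {f. \<exists>t. card Y = card X + 2 * t \<and>
               f \<in> extensional (X \<amalg> {1..2 * t}) \<and> bij_betw f (X \<amalg> {1..2 * t}) Y}),
      ident = (\<lambda>X. \<lambda>z\<in>X \<amalg> {}. case z of Inl x \<Rightarrow> x | Inr i \<Rightarrow> undefined),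
      cmp = (\<lambda>X Y Z g f. let s = half_diff X Y; t = half_diff Y Z in
        (\<lambda>z\<in>X \<amalg> {1..2 * (s + t)}.
          (case z of
             Inl x \<Rightarrow> g (Inl (f (Inl x)))
           | Inr i \<Rightarrow> if i \<le> 2 * s then g (Inl (f (Inr i))) else g (Inr (i - 2 * s)))))\<rparr>"

definition pairs :: "nat \<Rightarrow> nat set set" where
  "pairs t = {{2 * i - 1, 2 * i} | i. i \<in> {1..t}}"

definition wreath :: "nat \<Rightarrow> (nat \<Rightarrow> nat) set" where
  "wreath t = {p. p permutes {1..2 * t} \<and> (\<forall>P\<in>pairs t. p ` P \<in> pairs t)}"

text \<open>
  The projection of the wreath product to the permutations of the pairs: both \<open>2 * j - 1\<close> and
  \<open>2 * j\<close> lie in the \<open>j\<close>-th pair, and \<open>(2 * j - 1 + 1) div 2 = (2 * j + 1) div 2 = j\<close>.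
\<close>

definition pair_perm :: "(nat \<Rightarrow> nat) \<Rightarrow> nat \<Rightarrow> nat" where
  "pair_perm p i = (p (2 * i) + 1) div 2"

datatype parity = Pos | Neg

definition sgn_char :: "'k ring \<Rightarrow> parity \<Rightarrow> (nat \<Rightarrow> nat) \<Rightarrow> 'k" where
  "sgn_char K \<epsilon> p = (if \<epsilon> = Pos \<or> evenperm p then \<one>\<^bsub>K\<^esub> else \<ominus>\<^bsub>K\<^esub> \<one>\<^bsub>K\<^esub>)"

definition wreath_char :: "'k ring \<Rightarrow> parity \<Rightarrow> parity \<Rightarrow> (nat \<Rightarrow> nat) \<Rightarrow> 'k" where
  "wreath_char K \<epsilon> \<delta> p = sgn_char K \<epsilon> p \<otimes>\<^bsub>K\<^esub> sgn_char K \<delta> (pair_perm p)"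

definition wreath_act :: "'a set \<Rightarrow> 'a set \<Rightarrow> ('a + nat \<Rightarrow> 'a) \<Rightarrow> (nat \<Rightarrow> nat) \<Rightarrow> 'a + nat \<Rightarrow> 'a" where
  "wreath_act X Y f p = (\<lambda>z\<in>X \<amalg> {1..2 * half_diff X Y}. f (map_sum id p z))"

text \<open>
  Since the representation with character \<open>\<chi>\<close> is one-dimensional, tensoring over the group
  algebra with it is the quotient by \<open>f \<cdot> p = \<chi> p f\<close>, for \<open>f\<close> in the basis of bijections.
\<close>

definition kub_rels :: "'k ring \<Rightarrow> parity \<Rightarrow> parity \<Rightarrow> 'a set \<Rightarrow> 'a set \<Rightarrow> (('a + nat \<Rightarrow> 'a) \<Rightarrow> 'k) set" where
  "kub_rels K \<epsilon> \<delta> X Y =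
     (let F = free_space K (arr brauer X Y); \<delta>\<^sub>f = free_gen K (arr brauer X Y) in
       {\<delta>\<^sub>f (wreath_act X Y f p) \<ominus>\<^bsub>F\<^esub> wreath_char K \<epsilon> \<delta> p \<odot>\<^bsub>F\<^esub> \<delta>\<^sub>f f | f p.
          f \<in> arr brauer X Y \<and> p \<in> wreath (half_diff X Y)})"

definition kub_null :: "'k ring \<Rightarrow> parity \<Rightarrow> parity \<Rightarrow> 'a set \<Rightarrow> 'a set \<Rightarrow> (('a + nat \<Rightarrow> 'a) \<Rightarrow> 'k) set" where
  "kub_null K \<epsilon> \<delta> X Y = lin_span K (free_space K (arr brauer X Y)) (kub_rels K \<epsilon> \<delta> X Y)"

definition kub_class ::
    "'k ring \<Rightarrow> parity \<Rightarrow> parity \<Rightarrow> 'a set \<Rightarrow> 'a set \<Rightarrow> (('a + nat \<Rightarrow> 'a) \<Rightarrow> 'k) \<Rightarrow>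
     (('a + nat \<Rightarrow> 'a) \<Rightarrow> 'k) set" where
  "kub_class K \<epsilon> \<delta> X Y a = kub_null K \<epsilon> \<delta> X Y +>\<^bsub>free_space K (arr brauer X Y)\<^esub> a"

definition kub ::
    "'k ring \<Rightarrow> parity \<Rightarrow> parity \<Rightarrow> ('a set, 'k, (('a + nat \<Rightarrow> 'a) \<Rightarrow> 'k) set) lincat" where
  "kub K \<epsilon> \<delta> =
     (let D = linearization K brauer in
       \<lparr>lob = lob D,
        lhom = (\<lambda>X Y. quot_space (lhom D X Y) (kub_null K \<epsilon> \<delta> X Y)),
        lident = (\<lambda>X. kub_class K \<epsilon> \<delta> X X (lident D X)),
        lcomp = (\<lambda>X Y Z B A. \<Union>b\<in>B. \<Union>a\<in>A. kub_class K \<epsilon> \<delta> X Z (lcomp D X Y Z b a))\<rparr>)"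

definition kdb ::
    "'k ring \<Rightarrow> parity \<Rightarrow> parity \<Rightarrow> ('a set, 'k, (('a + nat \<Rightarrow> 'a) \<Rightarrow> 'k) set) lincat" where
  "kdb K \<epsilon> \<delta> = opposite (kub K \<epsilon> \<delta>)"

text \<open>The morphism \<open>X \<rightarrow> Y\<close> of \<open>kdb\<close> given by the class of a bijection \<open>Y \<amalg> {1..2t} \<rightarrow> X\<close>.\<close>

definition kdb_gen ::
    "'k ring \<Rightarrow> parity \<Rightarrow> parity \<Rightarrow> 'a set \<Rightarrow> 'a set \<Rightarrow> ('a + nat \<Rightarrow> 'a) \<Rightarrow>
     (('a + nat \<Rightarrow> 'a) \<Rightarrow> 'k) set" where
  "kdb_gen K \<epsilon> \<delta> X Y f = kub_class K \<epsilon> \<delta> Y X (free_gen K (arr brauer Y X) f)"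

definition kdb_g ::
    "'k ring \<Rightarrow> parity \<Rightarrow> parity \<Rightarrow> 'a set \<Rightarrow> 'a \<Rightarrow> 'a \<Rightarrow> (('a + nat \<Rightarrow> 'a) \<Rightarrow> 'k) set" where
  "kdb_g K \<epsilon> \<delta> X u v = kdb_gen K \<epsilon> \<delta> X (X - {u, v})
     (\<lambda>z\<in>(X - {u, v}) \<amalg> {1..2}. case z of Inl x \<Rightarrow> x | Inr i \<Rightarrow> if i = 1 then u else v)"

text \<open>The degree \<open>0\<close> morphism of \<open>kdb\<close> that is identified with the bijection \<open>f : X \<rightarrow> Y\<close>.\<close>

definition kdb_bij ::
    "'k ring \<Rightarrow> parity \<Rightarrow> parity \<Rightarrow> 'a set \<Rightarrow> 'a set \<Rightarrow> ('a \<Rightarrow> 'a) \<Rightarrow> (('a + nat \<Rightarrow> 'a) \<Rightarrow> 'k) set" where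
  "kdb_bij K \<epsilon> \<delta> X Y f = kdb_gen K \<epsilon> \<delta> X Y
     (\<lambda>z\<in>Y \<amalg> {}. case z of Inl y \<Rightarrow> inv_into X f y | Inr i \<Rightarrow> undefined)"


section \<open>Symmetric and exterior powers for the convolution product\<close>

text \<open>Ordered decompositions into \<open>n\<close> possibly empty parts.\<close>

definition decomps :: "nat \<Rightarrow> 'a set \<Rightarrow> 'a set list set" where
  "decomps n X = {Us. length Us = n \<and> \<Union>(set Us) = X \<and>
     (\<forall>i<n. \<forall>j<n. i \<noteq> j \<longrightarrow> Us ! i \<inter> Us ! j = {})}"

definition decorations :: "('a set, 'm, 'k, 'v, 'z) functor_data_scheme \<Rightarrow> 'a set list \<Rightarrow> 'v list set" where
  "decorations F Us = tuples (map (space F) Us)"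

definition conv_pow ::
    "'k ring \<Rightarrow> ('a set, 'm, 'k, 'v, 'z) functor_data_scheme \<Rightarrow> nat \<Rightarrow> 'a set \<Rightarrow>
     ('k, 'a set list \<Rightarrow> ('v list \<Rightarrow> 'k) set) module" where
  "conv_pow K F n X = dsum (decomps n X) (\<lambda>Us. tensor K (map (space F) Us))"

definition conv_pure ::
    "'k ring \<Rightarrow> ('a set, 'm, 'k, 'v, 'z) functor_data_scheme \<Rightarrow> nat \<Rightarrow> 'a set \<Rightarrow> 'a set list \<Rightarrow>
     'v list \<Rightarrow> 'a set list \<Rightarrow> ('v list \<Rightarrow> 'k) set" where
  "conv_pure K F n X Us cs =
     dsum_in (decomps n X) (\<lambda>Us. tensor K (map (space F) Us)) Us (pure_tensor K (map (space F) Us) cs)"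

text \<open>
  The coinvariants of the symmetric group on \<open>F\<^sup>\<odot>\<^sup>n\<close>, for \<open>\<epsilon> = Neg\<close> twisted by the sign
  representation. A permutation \<open>p\<close> moves the \<open>i\<close>-th factor of \<open>c\<^sub>1 \<otimes> \<dots> \<otimes> c\<^sub>n\<close> to position
  \<open>p i\<close>. It suffices to impose the relations on the pure tensors, which span.
\<close>

definition coinv_rels ::
    "'k ring \<Rightarrow> parity \<Rightarrow> ('a set, 'm, 'k, 'v, 'z) functor_data_scheme \<Rightarrow> nat \<Rightarrow> 'a set \<Rightarrow>
     ('a set list \<Rightarrow> ('v list \<Rightarrow> 'k) set) set" where
  "coinv_rels K \<epsilon> F n X =
     {sgn_char K \<epsilon> p \<odot>\<^bsub>conv_pow K F n X\<^esub>
        conv_pure K F n X (permute_list (inv_into UNIV p) Us) (permute_list (inv_into UNIV p) cs)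
      \<ominus>\<^bsub>conv_pow K F n X\<^esub> conv_pure K F n X Us cs | p Us cs.
        p permutes {..<n} \<and> Us \<in> decomps n X \<and> cs \<in> decorations F Us}"

definition coinv_null ::
    "'k ring \<Rightarrow> parity \<Rightarrow> ('a set, 'm, 'k, 'v, 'z) functor_data_scheme \<Rightarrow> nat \<Rightarrow> 'a set \<Rightarrow>
     ('a set list \<Rightarrow> ('v list \<Rightarrow> 'k) set) set" where
  "coinv_null K \<epsilon> F n X = lin_span K (conv_pow K F n X) (coinv_rels K \<epsilon> F n X)"

definition coinv_pow ::
    "'k ring \<Rightarrow> parity \<Rightarrow> ('a set, 'm, 'k, 'v, 'z) functor_data_scheme \<Rightarrow> nat \<Rightarrow> 'a set \<Rightarrow>
     ('k, ('a set list \<Rightarrow> ('v list \<Rightarrow> 'k) set) set) module" where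
  "coinv_pow K \<epsilon> F n X = quot_space (conv_pow K F n X) (coinv_null K \<epsilon> F n X)"

type_synonym ('a, 'k, 'v) powers = "nat \<Rightarrow> ('a set list \<Rightarrow> ('v list \<Rightarrow> 'k) set) set"

definition powers_space ::
    "'k ring \<Rightarrow> parity \<Rightarrow> ('a set, 'm, 'k, 'v, 'z) functor_data_scheme \<Rightarrow> 'a set \<Rightarrow>
     ('k, ('a, 'k, 'v) powers) module" where
  "powers_space K \<epsilon> F X = dsum UNIV (\<lambda>n. coinv_pow K \<epsilon> F n X)"

text \<open>The class \<open>c\<^sub>1 \<cdots> c\<^sub>n\<close>, or \<open>c\<^sub>1 \<and> \<cdots> \<and> c\<^sub>n\<close>, of \<open>c\<^sub>1 \<otimes> \<dots> \<otimes> c\<^sub>n\<close>.\<close>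

definition powers_class ::
    "'k ring \<Rightarrow> parity \<Rightarrow> ('a set, 'm, 'k, 'v, 'z) functor_data_scheme \<Rightarrow> 'a set \<Rightarrow> 'a set list \<Rightarrow>
     'v list \<Rightarrow> ('a, 'k, 'v) powers" where
  "powers_class K \<epsilon> F X Us cs =
     (let n = length Us in
       dsum_in UNIV (\<lambda>n. coinv_pow K \<epsilon> F n X) n
         (coinv_null K \<epsilon> F n X +>\<^bsub>conv_pow K F n X\<^esub> conv_pure K F n X Us cs))"

definition powers_index ::
    "('a set, 'm, 'k, 'v, 'z) functor_data_scheme \<Rightarrow> 'a set \<Rightarrow> ('a set list \<times> 'v list) set" where
  "powers_index F X = {(Us, cs). Us \<in> decomps (length Us) X \<and> cs \<in> decorations F Us}"

text \<open>
  The \<open>kFB\<close>-module structure: a bijection \<open>f\<close> sends the class of the \<open>c\<^sub>i \<in> F(U\<^sub>i)\<close> to the class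
  of their images in the \<open>F(f(U\<^sub>i))\<close>.
\<close>

definition powers_FB_map ::
    "'k ring \<Rightarrow> parity \<Rightarrow> ('a set, ('a \<Rightarrow> 'a) \<Rightarrow> 'k, 'k, 'v, 'z) functor_data_scheme \<Rightarrow>
     'a set \<Rightarrow> 'a set \<Rightarrow> ('a \<Rightarrow> 'a) \<Rightarrow> ('a, 'k, 'v) powers \<Rightarrow> ('a, 'k, 'v) powers" where
  "powers_FB_map K \<epsilon> F X Y f =
     lin_map_of K (powers_space K \<epsilon> F X) (powers_space K \<epsilon> F Y) (powers_index F X)
       (\<lambda>(Us, cs). powers_class K \<epsilon> F X Us cs)
       (\<lambda>(Us, cs). powers_class K \<epsilon> F Y (map (image f) Us)
          (map2 (\<lambda>U. act F U (f ` U) (kFB_gen K U (f ` U) (restrict f U))) Us cs))"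

definition powers ::
    "'k ring \<Rightarrow> parity \<Rightarrow> ('a set, ('a \<Rightarrow> 'a) \<Rightarrow> 'k, 'k, 'v, 'z) functor_data_scheme \<Rightarrow>
     ('a set, ('a \<Rightarrow> 'a) \<Rightarrow> 'k, 'k, ('a, 'k, 'v) powers) functor_data" where
  "powers K \<epsilon> F =
     \<lparr>space = powers_space K \<epsilon> F,
      act = (\<lambda>X Y h x.
        \<Oplus>\<^bsub>powers_space K \<epsilon> F Y\<^esub> f \<in> free_supp K (arr FB X Y) h.
          h f \<odot>\<^bsub>powers_space K \<epsilon> F Y\<^esub> powers_FB_map K \<epsilon> F X Y f x)\<rparr>"

abbreviation Sym_conv ("S\<^sub>\<odot>") where "S\<^sub>\<odot> K F \<equiv> powers K Pos F"
abbreviation Alt_conv ("\<Lambda>\<^sub>\<odot>") where "\<Lambda>\<^sub>\<odot> K F \<equiv> powers K Neg F"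

text \<open>The map induced by a morphism \<open>\<phi>\<close> of \<open>kFB\<close>-modules.\<close>

definition powers_map ::
    "'k ring \<Rightarrow> parity \<Rightarrow> ('a set, ('a \<Rightarrow> 'a) \<Rightarrow> 'k, 'k, 'v, 'z) functor_data_scheme \<Rightarrow>
     ('a set, ('a \<Rightarrow> 'a) \<Rightarrow> 'k, 'k, 'w, 'y) functor_data_scheme \<Rightarrow> ('a set \<Rightarrow> 'v \<Rightarrow> 'w) \<Rightarrow>
     'a set \<Rightarrow> ('a, 'k, 'v) powers \<Rightarrow> ('a, 'k, 'w) powers" where
  "powers_map K \<epsilon> F F' \<phi> X =
     lin_map_of K (powers_space K \<epsilon> F X) (powers_space K \<epsilon> F' X) (powers_index F X)
       (\<lambda>(Us, cs). powers_class K \<epsilon> F X Us cs)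
       (\<lambda>(Us, cs). powers_class K \<epsilon> F' X Us (map2 \<phi> Us cs))"


section \<open>Non-unital cyclic operads\<close>

text \<open>
  \<open>compo C U u V v\<close> is the composition \<open>\<iota>\<^bsub>u,v\<^esub>\<close> for \<open>u \<in> U\<close> and \<open>v \<in> V\<close>, with \<open>U\<close> and \<open>V\<close>
  disjoint; the coproduct of \<open>U - {u}\<close> and \<open>V - {v}\<close> is then their union.
\<close>

record ('a, 'k, 'v) cyclic_operad =
  "('a set, ('a \<Rightarrow> 'a) \<Rightarrow> 'k, 'k, 'v) functor_data" +
  compo :: "'a set \<Rightarrow> 'a \<Rightarrow> 'a set \<Rightarrow> 'a \<Rightarrow> ('v list \<Rightarrow> 'k) set \<Rightarrow> 'v"

definition compo_pure ::
    "'k ring \<Rightarrow> ('a, 'k, 'v) cyclic_operad \<Rightarrow> 'a set \<Rightarrow> 'a \<Rightarrow> 'a set \<Rightarrow> 'a \<Rightarrow> 'v \<Rightarrow> 'v \<Rightarrow> 'v" where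
  "compo_pure K C U u V v a b = compo C U u V v (pure_tensor K [space C U, space C V] [a, b])"

locale nonunital_cyclic_operad = cat_module K "kFB K" C
  for K :: "'k ring" and C :: "('a, 'k, 'v) cyclic_operad" +
  assumes compo_lin: "\<lbrakk>finite U; finite V; U \<inter> V = {}; u \<in> U; v \<in> V\<rbrakk>
      \<Longrightarrow> compo C U u V v \<in>
            lin_maps K (tensor K [space C U, space C V]) (space C ((U - {u}) \<union> (V - {v})))"
    and compo_nat: "\<lbrakk>finite U; finite V; U \<inter> V = {}; u \<in> U; v \<in> V;
        finite U'; finite V'; U' \<inter> V' = {}; f \<in> arr FB U U'; g \<in> arr FB V V';
        a \<in> carrier (space C U); b \<in> carrier (space C V)\<rbrakk>
      \<Longrightarrow> compo_pure K C U' (f u) V' (g v)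
             (act C U U' (kFB_gen K U U' f) a) (act C V V' (kFB_gen K V V' g) b) =
          (let W = (U - {u}) \<union> (V - {v}); W' = (U' - {f u}) \<union> (V' - {g v}) in
             act C W W' (kFB_gen K W W' (\<lambda>x\<in>W. if x \<in> U then f x else g x))
               (compo_pure K C U u V v a b))"
    and compo_sym: "\<lbrakk>finite U; finite V; U \<inter> V = {}; u \<in> U; v \<in> V;
        a \<in> carrier (space C U); b \<in> carrier (space C V)\<rbrakk>
      \<Longrightarrow> compo_pure K C U u V v a b = compo_pure K C V v U u b a"
    and compo_assoc: "\<lbrakk>finite U; finite V; finite W; U \<inter> V = {}; U \<inter> W = {}; V \<inter> W = {};
        u \<in> U; v \<in> V; v' \<in> V; v \<noteq> v'; w \<in> W;
        a \<in> carrier (space C U); b \<in> carrier (space C V); c \<in> carrier (space C W)\<rbrakk>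
      \<Longrightarrow> compo_pure K C ((U - {u}) \<union> (V - {v})) v' W w (compo_pure K C U u V v a b) c =
          compo_pure K C U u ((V - {v'}) \<union> (W - {w})) v a (compo_pure K C V v' W w b c)"

definition cyclic_operad_hom ::
    "'k ring \<Rightarrow> ('a, 'k, 'v) cyclic_operad \<Rightarrow> ('a, 'k, 'w) cyclic_operad \<Rightarrow>
     ('a set \<Rightarrow> 'v \<Rightarrow> 'w) \<Rightarrow> bool" where
  "cyclic_operad_hom K C C' \<phi> \<longleftrightarrow>
     cat_module_hom K (kFB K) C C' \<phi> \<and>
     (\<forall>U V u v a b. finite U \<and> finite V \<and> U \<inter> V = {} \<and> u \<in> U \<and> v \<in> V \<and>
        a \<in> carrier (space C U) \<and> b \<in> carrier (space C V) \<longrightarrow>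
        \<phi> ((U - {u}) \<union> (V - {v})) (compo_pure K C U u V v a b) =
        compo_pure K C' U u V v (\<phi> U a) (\<phi> V b))"

definition vanishes_on_empty :: "('a set, 'm, 'k, 'v, 'z) functor_data_scheme \<Rightarrow> bool" where
  "vanishes_on_empty C \<longleftrightarrow> carrier (space C {}) = {\<zero>\<^bsub>space C {}\<^esub>}"


section \<open>Module structures over the Brauer categories\<close>

text \<open>
  The \<open>kdb\<close>-module \<open>M\<close> extends the \<open>kFB\<close>-module \<open>F\<close>. By linearity it suffices to compare the
  two actions of the bijections.
\<close>

definition extends_FB ::
    "'k ring \<Rightarrow> parity \<Rightarrow> parity \<Rightarrow>
     ('a set, (('a + nat \<Rightarrow> 'a) \<Rightarrow> 'k) set, 'k, 'v, 'z) functor_data_scheme \<Rightarrow>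
     ('a set, ('a \<Rightarrow> 'a) \<Rightarrow> 'k, 'k, 'v, 'y) functor_data_scheme \<Rightarrow> bool" where
  "extends_FB K \<epsilon> \<delta> M F \<longleftrightarrow>
     (\<forall>X. finite X \<longrightarrow> space M X = space F X) \<and>
     (\<forall>X Y. finite X \<and> finite Y \<longrightarrow>
        (\<forall>f\<in>arr FB X Y. \<forall>x\<in>carrier (space F X).
           act M X Y (kdb_bij K \<epsilon> \<delta> X Y f) x = act F X Y (kFB_gen K X Y f) x))"

end

theory Submission
  imports Defs
begin

text \<open>
  A morphism \<open>X \<rightarrow> Y\<close> of degree \<open>t\<close> in the downward Brauer category is given by a bijection
  \<open>Y \<amalg> {1..2t} \<rightarrow> X\<close>. It factors into \<open>t\<close> morphisms \<open>g\<^sub>u\<^sub>,\<^sub>v\<close>, one for each pair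
  \<open>{2i - 1, 2i}\<close>, followed by a bijection. A module over the category with the twist \<open>(\<epsilon>; \<delta>)\<close> thus
  amounts to a \<open>kFB\<close>-module with contraction operators \<open>g\<^sub>u\<^sub>,\<^sub>v\<close> that are natural in the label
  set, change by the sign \<open>\<epsilon>\<close> when \<open>u\<close> and \<open>v\<close> are exchanged, and commute up to the sign \<open>\<delta>\<close> for
  disjoint pairs of labels. These two signs are all that has to be checked because
  \<open>S\<^sub>2 \<wr> S\<^sub>t\<close> is generated by the swaps within one pair and the exchanges of two adjacent pairs
  (\<open>wreath_induct\<close>, \<open>ct_pairs_wreath\<close>). The passage from such a system of contractions to a module is
  \<open>cat_module_kdb\<close>.

  For the powers of a cyclic operad, \<open>g\<^sub>u\<^sub>,\<^sub>v\<close> moves the factors that carry \<open>u\<close> and \<open>v\<close> to the last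
  two positions, with the sign of this reordering, and composes them along \<open>u\<close> and \<open>v\<close>; it is zero
  if a single factor carries both labels. Linear maps out of the powers are the families that are
  multilinear and symmetric up to sign (\<open>powers_lift\<close>), so that this defines an operator.
  Exchanging \<open>u\<close> and \<open>v\<close> exchanges the last two factors, and the composition is symmetric: this
  gives the sign \<open>\<epsilon>\<close> (\<open>contract_flip\<close>). For the commutation of \<open>g\<^sub>u\<^sub>,\<^sub>v\<close> and \<open>g\<^sub>w\<^sub>,\<^sub>z\<close>, regard the
  factors as vertices and the pairs \<open>{u, v}\<close> and \<open>{w, z}\<close> as edges of a graph (\<open>contract_commute\<close>).
  If one edge is a loop or the two edges are parallel, then both orders give zero, since one of the
  two contractions meets a factor with both of its labels. If the edges form a path, the two results agree
  by associativity, and if they are disjoint, the same two compositions are carried out; in both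
  cases the factors end up in orders that differ by a transposition, which is again the sign \<open>\<epsilon>\<close>.
  Hence \<open>\<delta> = \<epsilon>\<close>, which explains why the symmetric powers belong to the twist \<open>(+; +)\<close> and the
  exterior powers to \<open>(-; -)\<close>.
\<close>

section \<open>Linear algebra\<close>

locale scalars = field K for K :: "'k ring"
begin

abbreviation vspace :: "('k, 'v) module \<Rightarrow> bool" where
  "vspace V \<equiv> Module.module K V"

lemma lin_mapsD:
  assumes "T \<in> lin_maps K V W"
  shows lin_closed: "x \<in> carrier V \<Longrightarrow> T x \<in> carrier W"
    and lin_add: "x \<in> carrier V \<Longrightarrow> y \<in> carrier V \<Longrightarrow> T (x \<oplus>\<^bsub>V\<^esub> y) = T x \<oplus>\<^bsub>W\<^esub> T y"
    and lin_smult: "a \<in> carrier K \<Longrightarrow> x \<in> carrier V \<Longrightarrow> T (a \<odot>\<^bsub>V\<^esub> x) = a \<odot>\<^bsub>W\<^esub> T x"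
  using assms unfolding lin_maps_def by auto

lemma lin_mapsI:
  assumes "\<And>x. x \<in> carrier V \<Longrightarrow> T x \<in> carrier W"
    and "\<And>x y. x \<in> carrier V \<Longrightarrow> y \<in> carrier V \<Longrightarrow> T (x \<oplus>\<^bsub>V\<^esub> y) = T x \<oplus>\<^bsub>W\<^esub> T y"
    and "\<And>a x. a \<in> carrier K \<Longrightarrow> x \<in> carrier V \<Longrightarrow> T (a \<odot>\<^bsub>V\<^esub> x) = a \<odot>\<^bsub>W\<^esub> T x"
  shows "T \<in> lin_maps K V W"
  using assms unfolding lin_maps_def by auto

lemma lin_zero:
  assumes "vspace V" "vspace W" "T \<in> lin_maps K V W"
  shows "T \<zero>\<^bsub>V\<^esub> = \<zero>\<^bsub>W\<^esub>"
proof -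
  interpret V: Module.module K V by fact
  interpret W: Module.module K W by fact
  have "T \<zero>\<^bsub>V\<^esub> = T (\<zero>\<^bsub>K\<^esub> \<odot>\<^bsub>V\<^esub> \<zero>\<^bsub>V\<^esub>)" by simp
  also have "\<dots> = \<zero>\<^bsub>K\<^esub> \<odot>\<^bsub>W\<^esub> T \<zero>\<^bsub>V\<^esub>" using lin_smult[OF assms(3)] by blast
  also have "\<dots> = \<zero>\<^bsub>W\<^esub>" using lin_closed[OF assms(3), of "\<zero>\<^bsub>V\<^esub>"] by simp
  finally show ?thesis .
qed

lemma vspace_minus:
  assumes "vspace V" "x \<in> carrier V"
  shows "\<ominus>\<^bsub>V\<^esub> x = (\<ominus>\<^bsub>K\<^esub> \<one>\<^bsub>K\<^esub>) \<odot>\<^bsub>V\<^esub> x"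
proof -
  interpret V: Module.module K V by fact
  show ?thesis using assms(2) V.smult_l_minus[of "\<one>\<^bsub>K\<^esub>" x] by simp
qed

lemma lin_minus:
  assumes "vspace V" "vspace W" "T \<in> lin_maps K V W" "x \<in> carrier V"
  shows "T (\<ominus>\<^bsub>V\<^esub> x) = \<ominus>\<^bsub>W\<^esub> T x"
  using lin_smult[OF assms(3), of "\<ominus>\<^bsub>K\<^esub> \<one>\<^bsub>K\<^esub>" x] assms
  by (simp add: vspace_minus lin_closed[OF assms(3)])

lemma lin_diff:
  assumes "vspace V" "vspace W" "T \<in> lin_maps K V W" "x \<in> carrier V" "y \<in> carrier V"
  shows "T (x \<ominus>\<^bsub>V\<^esub> y) = T x \<ominus>\<^bsub>W\<^esub> T y"
proof -
  interpret V: Module.module K V by fact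
  show ?thesis using assms by (simp add: a_minus_def lin_add[OF assms(3)] lin_minus)
qed

lemma vspace_diff_eq_zero:
  assumes "vspace V" "x \<in> carrier V" "y \<in> carrier V"
  shows "x \<ominus>\<^bsub>V\<^esub> y = \<zero>\<^bsub>V\<^esub> \<longleftrightarrow> x = y"
proof -
  interpret V: Module.module K V by fact
  have "x = y" if "x \<ominus>\<^bsub>V\<^esub> y = \<zero>\<^bsub>V\<^esub>"
    using that assms V.minus_equality[of x "\<ominus>\<^bsub>V\<^esub> y"] by (simp add: a_minus_def)
  then show ?thesis using assms by (auto simp: a_minus_def V.r_neg)
qed

lemma lin_comp:
  assumes "S \<in> lin_maps K U V" "T \<in> lin_maps K V W"
  shows "(\<lambda>x. T (S x)) \<in> lin_maps K U W"
  using lin_mapsD[OF assms(1)] lin_mapsD[OF assms(2)] by (intro lin_mapsI) auto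

lemma lin_ident: "(\<lambda>x. x) \<in> lin_maps K V V"
  by (auto intro: lin_mapsI)

lemma lin_smult_map:
  assumes "vspace W" "T \<in> lin_maps K V W" "c \<in> carrier K"
  shows "(\<lambda>x. c \<odot>\<^bsub>W\<^esub> T x) \<in> lin_maps K V W"
proof -
  interpret W: Module.module K W by fact
  show ?thesis
  proof (intro lin_mapsI)
    fix a x assume "a \<in> carrier K" "x \<in> carrier V"
    then show "c \<odot>\<^bsub>W\<^esub> T (a \<odot>\<^bsub>V\<^esub> x) = a \<odot>\<^bsub>W\<^esub> (c \<odot>\<^bsub>W\<^esub> T x)"
      using lin_mapsD[OF assms(2)] assms(3)
      by (simp add: W.smult_assoc1[symmetric] m_comm)
  qed (use lin_mapsD[OF assms(2)] assms(3) in \<open>auto simp: W.smult_r_distr\<close>)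
qed

lemma lin_maps_cong:
  assumes "vspace V" "T \<in> lin_maps K V W" "\<And>x. x \<in> carrier V \<Longrightarrow> S x = T x"
  shows "S \<in> lin_maps K V W"
proof -
  interpret V: Module.module K V by fact
  show ?thesis using assms(2,3) by (auto simp: lin_maps_def)
qed

lemma lin_finsum:
  assumes "vspace V" "vspace W" "T \<in> lin_maps K V W" "finite I" "\<And>i. i \<in> I \<Longrightarrow> v i \<in> carrier V"
  shows "T (\<Oplus>\<^bsub>V\<^esub>i\<in>I. v i) = (\<Oplus>\<^bsub>W\<^esub>i\<in>I. T (v i))"
proof -
  interpret V: Module.module K V by fact
  interpret W: Module.module K W by fact
  show ?thesis using assms(4,5)
  proof (induction I rule: finite_induct)
    case empty
    then show ?case using lin_zero[OF assms(1-3)] by simp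
  next
    case (insert i I)
    then show ?case
      using lin_mapsD[OF assms(3)] by (simp add: Pi_def)
  qed
qed

subsection \<open>Quotients\<close>

lemma lin_span_submodule:
  assumes "vspace V" "S \<subseteq> carrier V"
  shows "submodule (lin_span K V S) K V"
proof -
  interpret V: Module.module K V by fact
  have *: "submodule (carrier V) K V" by (rule V.carrier_is_submodule)
  show ?thesis
  proof (rule V.submoduleI)
    show "lin_span K V S \<subseteq> carrier V" using * assms(2) by (auto simp: lin_span_def)
    show "\<zero>\<^bsub>V\<^esub> \<in> lin_span K V S"
      by (auto simp: lin_span_def submodule_def subgroup_def)
  next
    fix a assume "a \<in> lin_span K V S"
    then show "\<ominus>\<^bsub>V\<^esub> a \<in> lin_span K V S"
      using V.submoduleE(3) by (auto simp: lin_span_def)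
  next
    fix a b assume "a \<in> lin_span K V S" "b \<in> lin_span K V S"
    then show "a \<oplus>\<^bsub>V\<^esub> b \<in> lin_span K V S"
      using V.submoduleE(5) by (auto simp: lin_span_def)
  next
    fix a b assume "a \<in> carrier K" "b \<in> lin_span K V S"
    then show "a \<odot>\<^bsub>V\<^esub> b \<in> lin_span K V S"
      using V.submoduleE(4) by (auto simp: lin_span_def)
  qed
qed

lemma lin_span_superset: "S \<subseteq> lin_span K V S"
  by (auto simp: lin_span_def)

lemma vimage_submodule:
  assumes "vspace V" "vspace W" "T \<in> lin_maps K V W" "submodule N K W"
  shows "submodule {x \<in> carrier V. T x \<in> N} K V"
proof -
  interpret V: Module.module K V by fact
  interpret W: Module.module K W by fact
  show ?thesis
  proof (rule V.submoduleI)
    show "\<zero>\<^bsub>V\<^esub> \<in> {x \<in> carrier V. T x \<in> N}"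
      using lin_zero[OF assms(1-3)] assms(4) by (simp add: submodule_def subgroup_def)
  qed (use lin_mapsD[OF assms(3)] W.submoduleE[OF assms(4)] lin_minus[OF assms(1-3)] in auto)
qed

lemma lin_span_image:
  assumes "vspace V" "vspace W" "T \<in> lin_maps K V W" "submodule N K W" "S \<subseteq> carrier V"
    and "\<And>x. x \<in> S \<Longrightarrow> T x \<in> N" and "x \<in> lin_span K V S"
  shows "T x \<in> N"
proof -
  have "S \<subseteq> {x \<in> carrier V. T x \<in> N}" using assms(5,6) by auto
  then have "lin_span K V S \<subseteq> {x \<in> carrier V. T x \<in> N}"
    using vimage_submodule[OF assms(1-4)] by (auto simp: lin_span_def)
  then show ?thesis using assms(7) by auto
qed

lemma zero_submodule:
  assumes "vspace V"
  shows "submodule {\<zero>\<^bsub>V\<^esub>} K V"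
proof -
  interpret V: Module.module K V by fact
  show ?thesis by (rule V.submoduleI) auto
qed

lemma lin_span_kernel:
  assumes "vspace V" "vspace W" "T \<in> lin_maps K V W" "S \<subseteq> carrier V"
    and "\<And>x. x \<in> S \<Longrightarrow> T x = \<zero>\<^bsub>W\<^esub>" and "x \<in> lin_span K V S"
  shows "T x = \<zero>\<^bsub>W\<^esub>"
  using lin_span_image[OF assms(1-3) zero_submodule[OF assms(2)] assms(4)] assms(5,6) by auto

end

locale quotient = scalars + 
  fixes V :: "('a, 'b) module" and N :: "'b set"
  assumes vspace_V: "Module.module K V" and submod: "submodule N K V"
begin

sublocale V: Module.module K V by (rule vspace_V)

lemma sub_G: "N \<subseteq> carrier V" using V.submoduleE(1)[OF submod] .

lemma abel_sub: "abelian_subgroup N V"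
  by (rule abelian_subgroupI3)
    (use submod V.abelian_group_axioms in \<open>auto intro: additive_subgroupI simp: submodule_def\<close>)

sublocale Q: abelian_subgroup N V by (rule abel_sub)

lemma coset_eq_iff:
  assumes "x \<in> carrier V" "y \<in> carrier V"
  shows "N +>\<^bsub>V\<^esub> x = N +>\<^bsub>V\<^esub> y \<longleftrightarrow> x \<ominus>\<^bsub>V\<^esub> y \<in> N"
proof
  assume "N +>\<^bsub>V\<^esub> x = N +>\<^bsub>V\<^esub> y"
  then have "x \<in> N +>\<^bsub>V\<^esub> y" using Q.a_rcos_self assms by blast
  then obtain h where "h \<in> N" "x = h \<oplus>\<^bsub>V\<^esub> y" by (auto simp: a_r_coset_def')
  then show "x \<ominus>\<^bsub>V\<^esub> y \<in> N"
    using assms sub_G by (auto simp: a_minus_def V.a_assoc V.r_neg)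
next
  assume "x \<ominus>\<^bsub>V\<^esub> y \<in> N"
  moreover have "x = (x \<ominus>\<^bsub>V\<^esub> y) \<oplus>\<^bsub>V\<^esub> y"
    using assms by (simp add: a_minus_def V.a_assoc V.l_neg)
  ultimately have "x \<in> N +>\<^bsub>V\<^esub> y" by (auto simp: a_r_coset_def')
  then show "N +>\<^bsub>V\<^esub> x = N +>\<^bsub>V\<^esub> y"
    using V.a_repr_independence[OF _ assms(2)] submod by (simp add: submodule_def)
qed

lemma quot_carrier: "carrier (quot_space V N) = (\<lambda>x. N +>\<^bsub>V\<^esub> x) ` carrier V"
  by (auto simp: quot_space_def A_RCOSETS_def')

lemma quot_zero: "\<zero>\<^bsub>quot_space V N\<^esub> = N +>\<^bsub>V\<^esub> \<zero>\<^bsub>V\<^esub>"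
  using sub_G by (simp add: quot_space_def)

lemma quot_add:
  assumes "x \<in> carrier V" "y \<in> carrier V"
  shows "(N +>\<^bsub>V\<^esub> x) \<oplus>\<^bsub>quot_space V N\<^esub> (N +>\<^bsub>V\<^esub> y) = N +>\<^bsub>V\<^esub> (x \<oplus>\<^bsub>V\<^esub> y)"
  using assms by (simp add: quot_space_def Q.a_rcos_sum)

text \<open>The union in the definition of the scalar multiplication is over equal cosets.\<close>

lemma quot_smult:
  assumes "a \<in> carrier K" "x \<in> carrier V"
  shows "a \<odot>\<^bsub>quot_space V N\<^esub> (N +>\<^bsub>V\<^esub> x) = N +>\<^bsub>V\<^esub> (a \<odot>\<^bsub>V\<^esub> x)"
proof -
  have "N +>\<^bsub>V\<^esub> (a \<odot>\<^bsub>V\<^esub> y) = N +>\<^bsub>V\<^esub> (a \<odot>\<^bsub>V\<^esub> x)" if y: "y \<in> N +>\<^bsub>V\<^esub> x" for y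
  proof -
    obtain h where h: "h \<in> N" "y = h \<oplus>\<^bsub>V\<^esub> x" using y by (auto simp: a_r_coset_def')
    then have hV: "h \<in> carrier V" using sub_G by auto
    have "a \<odot>\<^bsub>V\<^esub> y \<ominus>\<^bsub>V\<^esub> a \<odot>\<^bsub>V\<^esub> x = a \<odot>\<^bsub>V\<^esub> h"
      using h hV assms by (simp add: V.smult_r_distr a_minus_def V.a_assoc V.r_neg)
    also have "\<dots> \<in> N" using h assms V.submoduleE(4)[OF submod] by auto
    finally show ?thesis using h hV assms by (intro coset_eq_iff[THEN iffD2]) auto
  qed
  moreover have "x \<in> N +>\<^bsub>V\<^esub> x" using Q.a_rcos_self assms by blast
  ultimately have "(\<Union>y\<in>N +>\<^bsub>V\<^esub> x. N +>\<^bsub>V\<^esub> (a \<odot>\<^bsub>V\<^esub> y)) = N +>\<^bsub>V\<^esub> (a \<odot>\<^bsub>V\<^esub> x)"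
    by blast
  then show ?thesis by (simp add: quot_space_def)
qed

lemma coset_lin: "(\<lambda>x. N +>\<^bsub>V\<^esub> x) \<in> lin_maps K V (quot_space V N)"
  by (intro lin_mapsI) (auto simp: quot_carrier quot_add quot_smult)

lemma vspace_quot: "Module.module K (quot_space V N)"
proof (rule moduleI)
  show "cring K" by (rule is_cring)
  show "abelian_group (quot_space V N)"
  proof (rule abelian_groupI)
    fix x assume "x \<in> carrier (quot_space V N)"
    then obtain v where v: "v \<in> carrier V" "x = N +>\<^bsub>V\<^esub> v" by (auto simp: quot_carrier)
    show "\<exists>y\<in>carrier (quot_space V N). y \<oplus>\<^bsub>quot_space V N\<^esub> x = \<zero>\<^bsub>quot_space V N\<^esub>"
      using v by (auto simp: quot_carrier quot_add quot_zero V.l_neg intro!: bexI[of _ "\<ominus>\<^bsub>V\<^esub> v"])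
  qed (auto simp: quot_carrier quot_add quot_zero V.a_ac)
qed (auto simp: quot_carrier quot_add quot_smult V.smult_l_distr V.smult_r_distr V.smult_assoc1)

text \<open>The universal property of the quotient.\<close>

lemma quot_lift:
  assumes W: "Module.module K W" and T: "T \<in> lin_maps K V W"
    and ker: "\<And>x. x \<in> N \<Longrightarrow> T x = \<zero>\<^bsub>W\<^esub>"
  shows "\<exists>S\<in>lin_maps K (quot_space V N) W. \<forall>x\<in>carrier V. S (N +>\<^bsub>V\<^esub> x) = T x"
proof -
  interpret W: Module.module K W by (rule W)
  define S where "S A = T (SOME x. x \<in> carrier V \<and> A = N +>\<^bsub>V\<^esub> x)" for A
  have S: "S (N +>\<^bsub>V\<^esub> x) = T x" if x: "x \<in> carrier V" for x
  proof -
    define y where "y = (SOME y. y \<in> carrier V \<and> N +>\<^bsub>V\<^esub> x = N +>\<^bsub>V\<^esub> y)"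
    have y: "y \<in> carrier V \<and> N +>\<^bsub>V\<^esub> x = N +>\<^bsub>V\<^esub> y"
      unfolding y_def by (rule someI[of _ x]) (use x in auto)
    then have "T (x \<ominus>\<^bsub>V\<^esub> y) = \<zero>\<^bsub>W\<^esub>" using x by (intro ker coset_eq_iff[THEN iffD1]) auto
    then have "T x \<ominus>\<^bsub>W\<^esub> T y = \<zero>\<^bsub>W\<^esub>" using lin_diff[OF vspace_V W T x] y by auto
    then have "T x = T y" using x y lin_closed[OF T] by (simp add: vspace_diff_eq_zero[OF W])
    then show ?thesis by (simp add: S_def y_def)
  qed
  have "S \<in> lin_maps K (quot_space V N) W"
    by (intro lin_mapsI)
      (auto simp: quot_carrier quot_add quot_smult S lin_mapsD[OF T])
  then show ?thesis using S by auto
qed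

end

context scalars begin

subsection \<open>Direct sums\<close>

lemma dsum_simps:
  "carrier (dsum I V) = {x \<in> (\<Pi>\<^sub>E i\<in>I. carrier (V i)). finite {i \<in> I. x i \<noteq> \<zero>\<^bsub>V i\<^esub>}}"
  "\<zero>\<^bsub>dsum I V\<^esub> = (\<lambda>i\<in>I. \<zero>\<^bsub>V i\<^esub>)"
  "x \<oplus>\<^bsub>dsum I V\<^esub> y = (\<lambda>i\<in>I. x i \<oplus>\<^bsub>V i\<^esub> y i)"
  "a \<odot>\<^bsub>dsum I V\<^esub> x = (\<lambda>i\<in>I. a \<odot>\<^bsub>V i\<^esub> x i)"
  by (simp_all add: dsum_def)

lemma vspace_dsum:
  assumes V: "\<And>i. i \<in> I \<Longrightarrow> vspace (V i)"
  shows "vspace (dsum I V)"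
proof -
  note m = Module.module.axioms(2)[OF V]
  note ag = abelian_group.axioms(1)[OF m]
  have supp: "finite {i \<in> I. h i \<noteq> \<zero>\<^bsub>V i\<^esub>}"
    if "finite {i \<in> I. x i \<noteq> \<zero>\<^bsub>V i\<^esub>}" "finite {i \<in> I. y i \<noteq> \<zero>\<^bsub>V i\<^esub>}"
      "\<And>i. i \<in> I \<Longrightarrow> x i = \<zero>\<^bsub>V i\<^esub> \<Longrightarrow> y i = \<zero>\<^bsub>V i\<^esub> \<Longrightarrow> h i = \<zero>\<^bsub>V i\<^esub>" for x y h
    by (rule finite_subset[OF _ finite_UnI[OF that(1,2)]]) (use that(3) in auto)
  have add: "x \<oplus>\<^bsub>dsum I V\<^esub> y \<in> carrier (dsum I V)"
    if "x \<in> carrier (dsum I V)" "y \<in> carrier (dsum I V)" for x y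
  proof -
    have "finite {i \<in> I. (x \<oplus>\<^bsub>dsum I V\<^esub> y) i \<noteq> \<zero>\<^bsub>V i\<^esub>}"
      by (rule supp[of x y])
        (use that in \<open>auto simp: dsum_simps abelian_monoid.l_zero[OF ag] abelian_monoid.zero_closed[OF ag]\<close>)
    then show ?thesis
      using that by (auto simp: dsum_simps PiE_iff abelian_monoid.a_closed[OF ag])
  qed
  have smult: "a \<odot>\<^bsub>dsum I V\<^esub> x \<in> carrier (dsum I V)"
    if "a \<in> carrier K" "x \<in> carrier (dsum I V)" for a x
  proof -
    have "finite {i \<in> I. (a \<odot>\<^bsub>dsum I V\<^esub> x) i \<noteq> \<zero>\<^bsub>V i\<^esub>}"
      by (rule supp[of x x]) (use that in \<open>auto simp: dsum_simps module.smult_r_null[OF V]\<close>)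
    then show ?thesis
      using that by (auto simp: dsum_simps PiE_iff module.smult_closed[OF V])
  qed
  show ?thesis
  proof (rule moduleI)
    show "cring K" by (rule is_cring)
    show "abelian_group (dsum I V)"
    proof (rule abelian_groupI)
      show "\<zero>\<^bsub>dsum I V\<^esub> \<in> carrier (dsum I V)"
        by (auto simp: dsum_simps abelian_monoid.zero_closed[OF ag])
      fix x assume x: "x \<in> carrier (dsum I V)"
      show "\<exists>y\<in>carrier (dsum I V). y \<oplus>\<^bsub>dsum I V\<^esub> x = \<zero>\<^bsub>dsum I V\<^esub>"
      proof (rule bexI[OF _ smult[OF _ x]])
        show "(\<ominus>\<^bsub>K\<^esub> \<one>\<^bsub>K\<^esub>) \<odot>\<^bsub>dsum I V\<^esub> x \<oplus>\<^bsub>dsum I V\<^esub> x = \<zero>\<^bsub>dsum I V\<^esub>"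
          using x
          by (auto simp: dsum_simps PiE_iff vspace_minus[OF V, symmetric] abelian_group.l_neg[OF m]
              cong: restrict_cong)
      qed simp
    qed (use add in \<open>auto simp: dsum_simps PiE_iff extensional_def fun_eq_iff 
          abelian_monoid.a_ac[OF ag] abelian_monoid.l_zero[OF ag]\<close>)
  qed (use smult in \<open>auto simp: dsum_simps PiE_iff extensional_def fun_eq_iff module.smult_l_distr[OF V]
        module.smult_r_distr[OF V] module.smult_assoc1[OF V] module.smult_one[OF V]\<close>)
qed

lemma dsum_in_lin:
  assumes V: "\<And>i. i \<in> I \<Longrightarrow> vspace (V i)" and i: "i \<in> I"
  shows "dsum_in I V i \<in> lin_maps K (V i) (dsum I V)"
proof -
  note m = Module.module.axioms(2)[OF V]
  note ag = abelian_group.axioms(1)[OF m]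
  have fin: "finite {j \<in> I. dsum_in I V i v j \<noteq> \<zero>\<^bsub>V j\<^esub>}" for v
    by (rule finite_subset[of _ "{i}"]) (auto simp: dsum_in_def)
  show ?thesis
  proof (rule lin_mapsI)
    fix v assume "v \<in> carrier (V i)"
    then show "dsum_in I V i v \<in> carrier (dsum I V)"
      using fin[of v] by (auto simp: dsum_simps dsum_in_def abelian_monoid.zero_closed[OF ag])
  qed (auto simp: dsum_simps dsum_in_def fun_eq_iff abelian_monoid.l_zero[OF ag]
        abelian_monoid.zero_closed[OF ag] module.smult_r_null[OF V])
qed

lemma dsum_in_closed:
  assumes "\<And>i. i \<in> I \<Longrightarrow> vspace (V i)" "i \<in> I" "v \<in> carrier (V i)"
  shows "dsum_in I V i v \<in> carrier (dsum I V)"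
  using lin_closed[OF dsum_in_lin[where I = I and V = V, OF assms(1,2)] assms(3)] .

lemma dsum_induct [consumes 1, case_names vspace zero dsum_in add]:
  assumes x: "x \<in> carrier (dsum I V)"
    and V: "\<And>i. i \<in> I \<Longrightarrow> vspace (V i)"
    and zero: "P \<zero>\<^bsub>dsum I V\<^esub>"
    and dsum_in: "\<And>i v. i \<in> I \<Longrightarrow> v \<in> carrier (V i) \<Longrightarrow> P (dsum_in I V i v)"
    and add: "\<And>x y. x \<in> carrier (dsum I V) \<Longrightarrow> y \<in> carrier (dsum I V) \<Longrightarrow> P x \<Longrightarrow> P y
      \<Longrightarrow> P (x \<oplus>\<^bsub>dsum I V\<^esub> y)"
  shows "P x"
proof -
  note m = Module.module.axioms(2)[OF V]
  note ag = abelian_group.axioms(1)[OF m]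
  have "finite {i \<in> I. x i \<noteq> \<zero>\<^bsub>V i\<^esub>}" using x by (simp add: dsum_simps)
  then show ?thesis using x
  proof (induction "{i \<in> I. x i \<noteq> \<zero>\<^bsub>V i\<^esub>}" arbitrary: x rule: finite_induct)
    case empty
    then have "x = \<zero>\<^bsub>dsum I V\<^esub>"
      by (auto simp: dsum_simps PiE_iff extensional_def fun_eq_iff)
    then show ?case using zero by simp
  next
    case (insert i S)
    have i: "i \<in> I" and xi: "x i \<in> carrier (V i)" and ext: "x \<in> extensional I"
      using insert.hyps(4) insert.prems by (auto simp: dsum_simps PiE_iff)
    define y where "y = x(i := \<zero>\<^bsub>V i\<^esub>)"
    have S: "S = {j \<in> I. y j \<noteq> \<zero>\<^bsub>V j\<^esub>}"
      using insert.hyps(2,4) by (auto simp: y_def)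
    have y: "y \<in> carrier (dsum I V)"
      using insert.prems i insert.hyps(1) S
      by (auto simp: dsum_simps y_def PiE_iff extensional_def abelian_monoid.zero_closed[OF ag])
    have "x = dsum_in I V i (x i) \<oplus>\<^bsub>dsum I V\<^esub> y"
      using insert.prems i xi ext
      by (auto simp: dsum_simps dsum_in_def y_def fun_eq_iff extensional_def PiE_iff
          abelian_monoid.l_zero[OF ag] abelian_monoid.r_zero[OF ag])
    moreover have "P y" using insert.hyps(3)[OF S y] .
    ultimately show ?case
      using add[OF dsum_in_closed[where I = I and V = V, OF V i xi] y dsum_in[OF i xi]] by simp
  qed
qed

text \<open>The universal property of the direct sum.\<close>

lemma
  assumes V: "\<And>i. i \<in> I \<Longrightarrow> vspace (V i)" and W: "vspace W"
    and T: "\<And>i. i \<in> I \<Longrightarrow> T i \<in> lin_maps K (V i) W"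
  shows dsum_lift_lin:
      "(\<lambda>x. \<Oplus>\<^bsub>W\<^esub>i\<in>{i \<in> I. x i \<noteq> \<zero>\<^bsub>V i\<^esub>}. T i (x i)) \<in> lin_maps K (dsum I V) W"
    and dsum_lift: "\<exists>S\<in>lin_maps K (dsum I V) W. \<forall>i\<in>I. \<forall>v\<in>carrier (V i). S (dsum_in I V i v) = T i v"
proof -
  interpret W: Module.module K W by (rule W)
  note m = Module.module.axioms(2)[OF V]
  note ag = abelian_group.axioms(1)[OF m]
  interpret D: Module.module K "dsum I V" by (rule vspace_dsum[OF V])
  define sp where "sp x = {i \<in> I. x i \<noteq> \<zero>\<^bsub>V i\<^esub>}" for x
  define S where "S x = (\<Oplus>\<^bsub>W\<^esub>i\<in>sp x. T i (x i))" for x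
  have fin: "finite (sp x)" if "x \<in> carrier (dsum I V)" for x
    using that by (simp add: dsum_simps sp_def)
  have Tx: "T i (x i) \<in> carrier W" if "x \<in> carrier (dsum I V)" "i \<in> I" for x i
    using that lin_closed[OF T[of i]] by (auto simp: dsum_simps PiE_iff)
  \<comment> \<open>the support may be enlarged, which makes the sums over different supports comparable\<close>
  have S_eq: "S x = (\<Oplus>\<^bsub>W\<^esub>i\<in>J. T i (x i))"
    if "x \<in> carrier (dsum I V)" "finite J" "sp x \<subseteq> J" "J \<subseteq> I" for x J
    unfolding S_def
  proof (rule W.add.finprod_mono_neutral_cong_left)
    fix i assume "i \<in> J - sp x"
    then show "T i (x i) = \<zero>\<^bsub>W\<^esub>" using lin_zero[OF V W T, of i] that by (auto simp: sp_def)
  qed (use that Tx in auto)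
  have lin: "S \<in> lin_maps K (dsum I V) W"
  proof (rule lin_mapsI)
    fix x assume x: "x \<in> carrier (dsum I V)"
    show "S x \<in> carrier W" unfolding S_def
      using x Tx by (intro W.finsum_closed) (auto simp: sp_def)
  next
    fix x y assume x: "x \<in> carrier (dsum I V)" and y: "y \<in> carrier (dsum I V)"
    let ?z = "x \<oplus>\<^bsub>dsum I V\<^esub> y"
    have z: "?z \<in> carrier (dsum I V)" using x y by simp
    define J where "J = sp x \<union> sp y \<union> sp ?z"
    have J: "finite J" "J \<subseteq> I" "sp x \<subseteq> J" "sp y \<subseteq> J" "sp ?z \<subseteq> J"
      using fin[OF x] fin[OF y] fin[OF z] by (auto simp: J_def sp_def)
    have "T i (?z i) = T i (x i) \<oplus>\<^bsub>W\<^esub> T i (y i)" if "i \<in> I" for i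
      using lin_add[OF T[OF that], of "x i" "y i"] x y that by (auto simp: dsum_simps PiE_iff)
    then have "S ?z = (\<Oplus>\<^bsub>W\<^esub>i\<in>J. T i (x i) \<oplus>\<^bsub>W\<^esub> T i (y i))"
      using S_eq[OF z J(1,5,2)] J(2) Tx x y
      by (auto intro!: W.finsum_cong' simp del: W.finsum_addf)
    also have "\<dots> = S x \<oplus>\<^bsub>W\<^esub> S y"
      using S_eq[OF x J(1,3,2)] S_eq[OF y J(1,4,2)] Tx x y J(2)
      by (auto intro!: W.finsum_addf)
    finally show "S ?z = S x \<oplus>\<^bsub>W\<^esub> S y" .
  next
    fix a x assume a: "a \<in> carrier K" and x: "x \<in> carrier (dsum I V)"
    let ?z = "a \<odot>\<^bsub>dsum I V\<^esub> x"
    have z: "?z \<in> carrier (dsum I V)" using x a by simp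
    have spz: "sp ?z \<subseteq> sp x"
      using a by (auto simp: sp_def dsum_simps module.smult_r_null[OF V])
    have "T i (?z i) = a \<odot>\<^bsub>W\<^esub> T i (x i)" if "i \<in> I" for i
      using lin_smult[OF T[OF that] a, of "x i"] x that by (auto simp: dsum_simps PiE_iff)
    moreover have spI: "sp x \<subseteq> I" by (auto simp: sp_def)
    ultimately have "S ?z = (\<Oplus>\<^bsub>W\<^esub>i\<in>sp x. a \<odot>\<^bsub>W\<^esub> T i (x i))"
      using S_eq[OF z fin[OF x] spz] Tx x a
      by (auto intro!: W.finsum_cong')
    also have "\<dots> = a \<odot>\<^bsub>W\<^esub> S x"
      unfolding S_def using fin[OF x] Tx x a spI by (intro W.finsum_smult_ldistr[symmetric]) auto
    finally show "S ?z = a \<odot>\<^bsub>W\<^esub> S x" .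
  qed
  moreover have "S (dsum_in I V i v) = T i v" if i: "i \<in> I" and v: "v \<in> carrier (V i)" for i v
  proof -
    have "S (dsum_in I V i v) = (\<Oplus>\<^bsub>W\<^esub>j\<in>{i}. T j (dsum_in I V i v j))"
      by (rule S_eq) (use i dsum_in_closed[where I = I and V = V, OF V i v] in \<open>auto simp: sp_def dsum_in_def\<close>)
    then show ?thesis using i v lin_closed[OF T[OF i]] by (simp add: dsum_in_def)
  qed
  ultimately show "\<exists>S\<in>lin_maps K (dsum I V) W. \<forall>i\<in>I. \<forall>v\<in>carrier (V i). S (dsum_in I V i v) = T i v"
    by blast
  show "(\<lambda>x. \<Oplus>\<^bsub>W\<^esub>i\<in>{i \<in> I. x i \<noteq> \<zero>\<^bsub>V i\<^esub>}. T i (x i)) \<in> lin_maps K (dsum I V) W"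
    using lin by (simp add: S_def[abs_def] sp_def)
qed

subsection \<open>Free vector spaces\<close>

lemma vspace_base: "vspace (base_space K)"
proof (rule moduleI)
  show "cring K" by (rule is_cring)
  show "abelian_group (base_space K)"
  proof (rule abelian_groupI)
    fix x assume "x \<in> carrier (base_space K)"
    then show "\<exists>y\<in>carrier (base_space K). y \<oplus>\<^bsub>base_space K\<^esub> x = \<zero>\<^bsub>base_space K\<^esub>"
      by (auto simp: base_space_def l_neg intro!: bexI[of _ "\<ominus>\<^bsub>K\<^esub> x"])
  qed (auto simp: base_space_def a_ac)
qed (auto simp: base_space_def l_distr r_distr m_ac)

lemma base_simps [simp]:
  "carrier (base_space K) = carrier K" "\<zero>\<^bsub>base_space K\<^esub> = \<zero>\<^bsub>K\<^esub>"
  "x \<oplus>\<^bsub>base_space K\<^esub> y = x \<oplus>\<^bsub>K\<^esub> y" "a \<odot>\<^bsub>base_space K\<^esub> x = a \<otimes>\<^bsub>K\<^esub> x"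
  by (simp_all add: base_space_def)

lemma vspace_free: "vspace (free_space K B)"
  unfolding free_space_def by (intro vspace_dsum vspace_base)

lemma free_gen_closed: "b \<in> B \<Longrightarrow> free_gen K B b \<in> carrier (free_space K B)"
  unfolding free_gen_def free_space_def
  using dsum_in_closed[where I = B and V = "\<lambda>_. base_space K" and i = b and v = "\<one>\<^bsub>K\<^esub>"] vspace_base by simp

lemma free_dsum_in:
  assumes "b \<in> B" "c \<in> carrier K"
  shows "dsum_in B (\<lambda>_. base_space K) b c = c \<odot>\<^bsub>free_space K B\<^esub> free_gen K B b"
  using assms by (auto simp: free_gen_def free_space_def dsum_simps dsum_in_def)

lemma free_induct [consumes 1, case_names zero gen add smult]:
  assumes x: "x \<in> carrier (free_space K B)"
    and zero: "P \<zero>\<^bsub>free_space K B\<^esub>"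
    and gen: "\<And>b. b \<in> B \<Longrightarrow> P (free_gen K B b)"
    and add: "\<And>x y. x \<in> carrier (free_space K B) \<Longrightarrow> y \<in> carrier (free_space K B) \<Longrightarrow> P x \<Longrightarrow> P y
      \<Longrightarrow> P (x \<oplus>\<^bsub>free_space K B\<^esub> y)"
    and smult: "\<And>a x. a \<in> carrier K \<Longrightarrow> x \<in> carrier (free_space K B) \<Longrightarrow> P x
      \<Longrightarrow> P (a \<odot>\<^bsub>free_space K B\<^esub> x)"
  shows "P x"
  using x[unfolded free_space_def] vspace_base zero[unfolded free_space_def] _ add[unfolded free_space_def]
proof (rule dsum_induct)
  fix b c assume "b \<in> B" "c \<in> carrier (base_space K)"
  then show "P (dsum_in B (\<lambda>_. base_space K) b c)"
    using free_dsum_in[of b B c] smult[OF _ free_gen_closed gen, of c b] by simp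
qed

text \<open>
  The linear extension of a map on the basis, in the form in which \<open>linearization\<close> and \<open>powers\<close>
  write it.
\<close>

definition free_ext :: "('k, 'w) module \<Rightarrow> 'b set \<Rightarrow> ('b \<Rightarrow> 'w) \<Rightarrow> ('b \<Rightarrow> 'k) \<Rightarrow> 'w" where
  "free_ext W B w x = (\<Oplus>\<^bsub>W\<^esub>b\<in>free_supp K B x. x b \<odot>\<^bsub>W\<^esub> w b)"

lemma free_carrierD:
  assumes "x \<in> carrier (free_space K B)"
  shows "finite (free_supp K B x)" "\<And>b. b \<in> B \<Longrightarrow> x b \<in> carrier K"
  using assms by (auto simp: free_supp_def free_space_def dsum_simps)

lemma free_gen_apply:
  "b \<in> B \<Longrightarrow> free_gen K B b c = (if c \<in> B then if c = b then \<one>\<^bsub>K\<^esub> else \<zero>\<^bsub>K\<^esub> else undefined)"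
  by (simp add: free_gen_def dsum_in_def)

lemma free_supp_gen: "b \<in> B \<Longrightarrow> free_supp K B (free_gen K B b) = {b}"
  by (auto simp: free_supp_def free_gen_def dsum_in_def split: if_splits)

lemma free_ext_gen:
  assumes "vspace W" "\<And>b. b \<in> B \<Longrightarrow> w b \<in> carrier W" "b \<in> B"
  shows "free_ext W B w (free_gen K B b) = w b"
proof -
  interpret W: Module.module K W by fact
  show ?thesis using assms(2,3) by (simp add: free_ext_def free_supp_gen free_gen_apply)
qed

lemma free_ext_lin:
  assumes W: "vspace W" and w: "\<And>b. b \<in> B \<Longrightarrow> w b \<in> carrier W"
  shows "free_ext W B w \<in> lin_maps K (free_space K B) W"
proof -
  interpret W: Module.module K W by fact
  have "(\<lambda>c. c \<odot>\<^bsub>W\<^esub> w b) \<in> lin_maps K (base_space K) W" if "b \<in> B" for b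
    using w[OF that] by (intro lin_mapsI) (auto simp: W.smult_l_distr W.smult_assoc1)
  from dsum_lift_lin[OF vspace_base W this]
  show ?thesis by (simp add: free_ext_def[abs_def] free_space_def free_supp_def)
qed

lemma free_lin_eqI:
  assumes "vspace W" "S \<in> lin_maps K (free_space K B) W" "T \<in> lin_maps K (free_space K B) W"
    and "\<And>b. b \<in> B \<Longrightarrow> S (free_gen K B b) = T (free_gen K B b)" "x \<in> carrier (free_space K B)"
  shows "S x = T x"
  using assms(5)
proof (induction rule: free_induct)
  case zero
  then show ?case using lin_zero[OF vspace_free assms(1)] assms(2,3) by metis
qed (use assms(4) lin_mapsD[OF assms(2)] lin_mapsD[OF assms(3)] in auto)

subsection \<open>Tensor products\<close>

definition multilin :: "('k, 'v) module list \<Rightarrow> ('k, 'w) module \<Rightarrow> ('v list \<Rightarrow> 'w) \<Rightarrow> bool" where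
  "multilin Vs W \<phi> \<longleftrightarrow>
     (\<forall>vs\<in>tuples Vs. \<phi> vs \<in> carrier W) \<and>
     (\<forall>vs\<in>tuples Vs. \<forall>i<length Vs. \<forall>x\<in>carrier (Vs ! i). \<forall>y\<in>carrier (Vs ! i).
        \<phi> (vs[i := x \<oplus>\<^bsub>Vs ! i\<^esub> y]) = \<phi> (vs[i := x]) \<oplus>\<^bsub>W\<^esub> \<phi> (vs[i := y])) \<and>
     (\<forall>vs\<in>tuples Vs. \<forall>i<length Vs. \<forall>a\<in>carrier K. \<forall>x\<in>carrier (Vs ! i).
        \<phi> (vs[i := a \<odot>\<^bsub>Vs ! i\<^esub> x]) = a \<odot>\<^bsub>W\<^esub> \<phi> (vs[i := x]))"

lemma multilinI:
  assumes "\<And>vs. vs \<in> tuples Vs \<Longrightarrow> \<phi> vs \<in> carrier W"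
    and "\<And>vs i x y. vs \<in> tuples Vs \<Longrightarrow> i < length Vs \<Longrightarrow> x \<in> carrier (Vs ! i) \<Longrightarrow> y \<in> carrier (Vs ! i)
      \<Longrightarrow> \<phi> (vs[i := x \<oplus>\<^bsub>Vs ! i\<^esub> y]) = \<phi> (vs[i := x]) \<oplus>\<^bsub>W\<^esub> \<phi> (vs[i := y])"
    and "\<And>vs i a x. vs \<in> tuples Vs \<Longrightarrow> i < length Vs \<Longrightarrow> a \<in> carrier K \<Longrightarrow> x \<in> carrier (Vs ! i)
      \<Longrightarrow> \<phi> (vs[i := a \<odot>\<^bsub>Vs ! i\<^esub> x]) = a \<odot>\<^bsub>W\<^esub> \<phi> (vs[i := x])"
  shows "multilin Vs W \<phi>"
  using assms unfolding multilin_def by blast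

lemma multilinD:
  assumes "multilin Vs W \<phi>" "vs \<in> tuples Vs"
  shows "\<phi> vs \<in> carrier W"
    and "i < length Vs \<Longrightarrow> x \<in> carrier (Vs ! i) \<Longrightarrow> y \<in> carrier (Vs ! i)
      \<Longrightarrow> \<phi> (vs[i := x \<oplus>\<^bsub>Vs ! i\<^esub> y]) = \<phi> (vs[i := x]) \<oplus>\<^bsub>W\<^esub> \<phi> (vs[i := y])"
    and "i < length Vs \<Longrightarrow> a \<in> carrier K \<Longrightarrow> x \<in> carrier (Vs ! i)
      \<Longrightarrow> \<phi> (vs[i := a \<odot>\<^bsub>Vs ! i\<^esub> x]) = a \<odot>\<^bsub>W\<^esub> \<phi> (vs[i := x])"
  using assms unfolding multilin_def by blast+

lemma tuples_update:
  assumes "vs \<in> tuples Vs" "x \<in> carrier (Vs ! i)"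
  shows "vs[i := x] \<in> tuples Vs"
  using assms by (auto simp: tuples_def list_all2_conv_all_nth) (metis nth_list_update_eq nth_list_update_neq)

lemma multilin_lin:
  assumes "multilin Vs W \<phi>" "T \<in> lin_maps K W W'"
    and "\<And>V. V \<in> set Vs \<Longrightarrow> vspace V"
  shows "multilin Vs W' (\<lambda>vs. T (\<phi> vs))"
proof -
  have up: "\<phi> (vs[i := x]) \<in> carrier W" if "vs \<in> tuples Vs" "x \<in> carrier (Vs ! i)" for vs i x
    using multilinD(1)[OF assms(1)] tuples_update[OF that] by blast
  show ?thesis
    using multilinD[OF assms(1)] lin_mapsD[OF assms(2)] up by (intro multilinI) auto
qed

lemma quotient_span:
  assumes "vspace V" "S \<subseteq> carrier V"
  shows "quotient K V (lin_span K V S)"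
  using assms lin_span_submodule by (intro quotient.intro scalars_axioms quotient_axioms.intro)

lemma tensor_rels_subset:
  assumes V: "\<And>V. V \<in> set Vs \<Longrightarrow> vspace V"
  shows "tensor_rels K Vs \<subseteq> carrier (free_space K (tuples Vs))"
proof -
  interpret F: Module.module K "free_space K (tuples Vs)" by (rule vspace_free)
  have gen: "free_gen K (tuples Vs) (vs[i := x]) \<in> carrier (free_space K (tuples Vs))"
    if "vs \<in> tuples Vs" "x \<in> carrier (Vs ! i)" for vs i x
    by (intro free_gen_closed tuples_update that)
  show ?thesis
  proof
    fix r assume "r \<in> tensor_rels K Vs"
    then consider
      (add) vs i x y where "vs \<in> tuples Vs" "i < length Vs" "x \<in> carrier (Vs ! i)" "y \<in> carrier (Vs ! i)"
        "r = free_gen K (tuples Vs) (vs[i := x \<oplus>\<^bsub>Vs ! i\<^esub> y]) \<ominus>\<^bsub>free_space K (tuples Vs)\<^esub>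
          (free_gen K (tuples Vs) (vs[i := x]) \<oplus>\<^bsub>free_space K (tuples Vs)\<^esub> free_gen K (tuples Vs) (vs[i := y]))"
    | (smult) vs i a x where "vs \<in> tuples Vs" "i < length Vs" "a \<in> carrier K" "x \<in> carrier (Vs ! i)"
        "r = free_gen K (tuples Vs) (vs[i := a \<odot>\<^bsub>Vs ! i\<^esub> x]) \<ominus>\<^bsub>free_space K (tuples Vs)\<^esub>
          (a \<odot>\<^bsub>free_space K (tuples Vs)\<^esub> free_gen K (tuples Vs) (vs[i := x]))"
      unfolding tensor_rels_def Let_def by blast
    then show "r \<in> carrier (free_space K (tuples Vs))"
    proof cases
      case add
      interpret V: Module.module K "Vs ! i" using V add(2) by auto
      show ?thesis
        unfolding add(5) by (intro F.minus_closed F.a_closed gen[OF add(1)] V.a_closed add(3,4))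
    next
      case smult
      interpret V: Module.module K "Vs ! i" using V smult(2) by auto
      show ?thesis
        unfolding smult(5)
        by (intro F.minus_closed F.smult_closed gen[OF smult(1)] V.smult_closed smult(3,4))
    qed
  qed
qed

lemma quotient_tensor:
  assumes V: "\<And>V. V \<in> set Vs \<Longrightarrow> vspace V"
  shows "quotient K (free_space K (tuples Vs)) (tensor_null K Vs)"
  unfolding tensor_null_def by (intro quotient_span vspace_free tensor_rels_subset V)

lemma vspace_tensor:
  assumes V: "\<And>V. V \<in> set Vs \<Longrightarrow> vspace V"
  shows "vspace (tensor K Vs)"
  unfolding tensor_def by (rule quotient.vspace_quot[OF quotient_tensor[OF V]])

lemma multilin_pure_tensor:
  assumes V: "\<And>V. V \<in> set Vs \<Longrightarrow> vspace V"
  shows "multilin Vs (tensor K Vs) (pure_tensor K Vs)"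
proof -
  interpret F: Module.module K "free_space K (tuples Vs)" by (rule vspace_free)
  interpret Q: quotient K "free_space K (tuples Vs)" "tensor_null K Vs" by (rule quotient_tensor[OF V])
  have gen: "free_gen K (tuples Vs) (vs[i := x]) \<in> carrier (free_space K (tuples Vs))"
    if "vs \<in> tuples Vs" "x \<in> carrier (Vs ! i)" for vs i x
    by (intro free_gen_closed tuples_update that)
  have null: "tensor_rels K Vs \<subseteq> tensor_null K Vs"
    unfolding tensor_null_def by (rule lin_span_superset)
  show ?thesis
  proof (rule multilinI)
    fix vs assume "vs \<in> tuples Vs"
    then show "pure_tensor K Vs vs \<in> carrier (tensor K Vs)"
      by (auto simp: pure_tensor_def tensor_def Q.quot_carrier free_gen_closed)
  next
    fix vs i x y
    assume *: "vs \<in> tuples Vs" "i < length Vs" "x \<in> carrier (Vs ! i)" "y \<in> carrier (Vs ! i)"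
    interpret V: Module.module K "Vs ! i" using V * by auto
    have "free_gen K (tuples Vs) (vs[i := x \<oplus>\<^bsub>Vs ! i\<^esub> y]) \<ominus>\<^bsub>free_space K (tuples Vs)\<^esub>
        (free_gen K (tuples Vs) (vs[i := x]) \<oplus>\<^bsub>free_space K (tuples Vs)\<^esub> free_gen K (tuples Vs) (vs[i := y]))
        \<in> tensor_null K Vs"
      using * by (intro subsetD[OF null]) (unfold tensor_rels_def Let_def, blast)
    then show "pure_tensor K Vs (vs[i := x \<oplus>\<^bsub>Vs ! i\<^esub> y]) =
        pure_tensor K Vs (vs[i := x]) \<oplus>\<^bsub>tensor K Vs\<^esub> pure_tensor K Vs (vs[i := y])"
      using * by (simp add: pure_tensor_def tensor_def Q.quot_add gen Q.coset_eq_iff)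
  next
    fix vs i a x
    assume *: "vs \<in> tuples Vs" "i < length Vs" "a \<in> carrier K" "x \<in> carrier (Vs ! i)"
    interpret V: Module.module K "Vs ! i" using V * by auto
    have "free_gen K (tuples Vs) (vs[i := a \<odot>\<^bsub>Vs ! i\<^esub> x]) \<ominus>\<^bsub>free_space K (tuples Vs)\<^esub>
        (a \<odot>\<^bsub>free_space K (tuples Vs)\<^esub> free_gen K (tuples Vs) (vs[i := x])) \<in> tensor_null K Vs"
      using * by (intro subsetD[OF null]) (unfold tensor_rels_def Let_def, blast)
    then show "pure_tensor K Vs (vs[i := a \<odot>\<^bsub>Vs ! i\<^esub> x]) =
        a \<odot>\<^bsub>tensor K Vs\<^esub> pure_tensor K Vs (vs[i := x])"
      using * by (simp add: pure_tensor_def tensor_def Q.quot_smult gen Q.coset_eq_iff)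
  qed
qed

text \<open>The universal property of the tensor product.\<close>

lemma tensor_lift:
  assumes V: "\<And>V. V \<in> set Vs \<Longrightarrow> vspace V" and W: "vspace W" and \<phi>: "multilin Vs W \<phi>"
  shows "\<exists>S\<in>lin_maps K (tensor K Vs) W. \<forall>vs\<in>tuples Vs. S (pure_tensor K Vs vs) = \<phi> vs"
proof -
  interpret W: Module.module K W by (rule W)
  interpret F: Module.module K "free_space K (tuples Vs)" by (rule vspace_free)
  interpret Q: quotient K "free_space K (tuples Vs)" "tensor_null K Vs" by (rule quotient_tensor[OF V])
  let ?T = "free_ext W (tuples Vs) \<phi>"
  have T: "?T \<in> lin_maps K (free_space K (tuples Vs)) W"
    by (intro free_ext_lin W multilinD(1)[OF \<phi>])
  have Tgen: "?T (free_gen K (tuples Vs) vs) = \<phi> vs" if "vs \<in> tuples Vs" for vs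
    using that by (intro free_ext_gen W multilinD(1)[OF \<phi>])
  have gen: "free_gen K (tuples Vs) vs \<in> carrier (free_space K (tuples Vs))" if "vs \<in> tuples Vs" for vs
    by (intro free_gen_closed that)
  have "?T r = \<zero>\<^bsub>W\<^esub>" if r: "r \<in> tensor_rels K Vs" for r
  proof -
    from r consider
      (add) vs i x y where "vs \<in> tuples Vs" "i < length Vs" "x \<in> carrier (Vs ! i)" "y \<in> carrier (Vs ! i)"
        "r = free_gen K (tuples Vs) (vs[i := x \<oplus>\<^bsub>Vs ! i\<^esub> y]) \<ominus>\<^bsub>free_space K (tuples Vs)\<^esub>
          (free_gen K (tuples Vs) (vs[i := x]) \<oplus>\<^bsub>free_space K (tuples Vs)\<^esub> free_gen K (tuples Vs) (vs[i := y]))"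
    | (smult) vs i a x where "vs \<in> tuples Vs" "i < length Vs" "a \<in> carrier K" "x \<in> carrier (Vs ! i)"
        "r = free_gen K (tuples Vs) (vs[i := a \<odot>\<^bsub>Vs ! i\<^esub> x]) \<ominus>\<^bsub>free_space K (tuples Vs)\<^esub>
          (a \<odot>\<^bsub>free_space K (tuples Vs)\<^esub> free_gen K (tuples Vs) (vs[i := x]))"
      unfolding tensor_rels_def Let_def by blast
    then show ?thesis
    proof cases
      case add
      interpret V: Module.module K "Vs ! i" using V add by auto
      have t: "vs[i := x \<oplus>\<^bsub>Vs ! i\<^esub> y] \<in> tuples Vs" "vs[i := x] \<in> tuples Vs" "vs[i := y] \<in> tuples Vs"
        using add(1-4) by (auto intro: tuples_update)
      then show ?thesis
        using add multilinD[OF \<phi>]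
        by (simp add: lin_diff[OF vspace_free W T] gen lin_add[OF T] Tgen vspace_diff_eq_zero[OF W])
    next
      case smult
      interpret V: Module.module K "Vs ! i" using V smult by auto
      have t: "vs[i := a \<odot>\<^bsub>Vs ! i\<^esub> x] \<in> tuples Vs" "vs[i := x] \<in> tuples Vs"
        using smult(1-4) by (auto intro: tuples_update)
      then show ?thesis
        using smult multilinD[OF \<phi>]
        by (simp add: lin_diff[OF vspace_free W T] gen lin_smult[OF T] Tgen vspace_diff_eq_zero[OF W])
    qed
  qed
  then have "?T z = \<zero>\<^bsub>W\<^esub>" if "z \<in> tensor_null K Vs" for z
    using that lin_span_kernel[OF vspace_free W T tensor_rels_subset[OF V]]
    unfolding tensor_null_def by blast
  from Q.quot_lift[OF W T this]
  obtain S where S: "S \<in> lin_maps K (tensor K Vs) W"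
    "\<And>x. x \<in> carrier (free_space K (tuples Vs)) \<Longrightarrow>
      S (tensor_null K Vs +>\<^bsub>free_space K (tuples Vs)\<^esub> x) = ?T x"
    unfolding tensor_def by blast
  then show ?thesis by (intro bexI[of _ S]) (auto simp: pure_tensor_def gen Tgen)
qed

lemma tensor_induct [consumes 1, case_names vspace zero pure add smult]:
  assumes x: "x \<in> carrier (tensor K Vs)"
    and V: "\<And>V. V \<in> set Vs \<Longrightarrow> vspace V"
    and zero: "P \<zero>\<^bsub>tensor K Vs\<^esub>"
    and pure: "\<And>vs. vs \<in> tuples Vs \<Longrightarrow> P (pure_tensor K Vs vs)"
    and add: "\<And>x y. x \<in> carrier (tensor K Vs) \<Longrightarrow> y \<in> carrier (tensor K Vs) \<Longrightarrow> P x \<Longrightarrow> P y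
      \<Longrightarrow> P (x \<oplus>\<^bsub>tensor K Vs\<^esub> y)"
    and smult: "\<And>a x. a \<in> carrier K \<Longrightarrow> x \<in> carrier (tensor K Vs) \<Longrightarrow> P x
      \<Longrightarrow> P (a \<odot>\<^bsub>tensor K Vs\<^esub> x)"
  shows "P x"
proof -
  interpret Q: quotient K "free_space K (tuples Vs)" "tensor_null K Vs" by (rule quotient_tensor[OF V])
  note cl = lin_mapsD[OF Q.coset_lin, folded tensor_def]
  obtain z where z: "z \<in> carrier (free_space K (tuples Vs))"
    "x = tensor_null K Vs +>\<^bsub>free_space K (tuples Vs)\<^esub> z"
    using x by (auto simp: tensor_def Q.quot_carrier)
  from z(1) have "P (tensor_null K Vs +>\<^bsub>free_space K (tuples Vs)\<^esub> z)"
  proof (induction rule: free_induct)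
    case zero
    then show ?case using assms(3) by (simp add: tensor_def Q.quot_zero)
  qed (use pure add smult cl in \<open>auto simp: pure_tensor_def\<close>)
  then show ?thesis using z by simp
qed

end

section \<open>Powers for the convolution product\<close>

lemma decomps_iff:
  "Us \<in> decomps (length Us) X \<longleftrightarrow> \<Union>(set Us) = X \<and> sorted_wrt (\<lambda>A B. A \<inter> B = {}) Us"
proof -
  have "(\<forall>i<length Us. \<forall>j<length Us. i \<noteq> j \<longrightarrow> Us ! i \<inter> Us ! j = {}) \<longleftrightarrow>
      (\<forall>i j. i < j \<longrightarrow> j < length Us \<longrightarrow> Us ! i \<inter> Us ! j = {})"
    (is "?L \<longleftrightarrow> ?R")
  proof
    assume R: ?R
    show ?L
    proof (intro allI impI)
      fix i j assume "i < length Us" "j < length Us" "i \<noteq> j"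
      then show "Us ! i \<inter> Us ! j = {}"
        using R[rule_format, of i j] R[rule_format, of j i] by (cases "i < j") (auto simp: Int_commute)
    qed
  qed auto
  then show ?thesis by (auto simp: decomps_def sorted_wrt_iff_nth_less)
qed

lemma decomps_length: "Us \<in> decomps n X \<Longrightarrow> length Us = n"
  by (simp add: decomps_def)

lemma decomps_permute:
  assumes "Us \<in> decomps n X" "q permutes {..<n}"
  shows "permute_list q Us \<in> decomps n X"
proof -
  have q: "q permutes {..<length Us}" using assms by (simp add: decomps_def)
  have "q i < n" if "i < n" for i using permutes_in_image[OF assms(2)] that by auto
  moreover have "q i \<noteq> q j" if "i \<noteq> j" for i j using permutes_inj[OF assms(2)] that by (auto simp: inj_def)
  ultimately show ?thesis
    using assms(1) q by (auto simp: decomps_def permute_list_nth)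
qed

lemma decorations_permute:
  assumes "cs \<in> decorations F Us" "q permutes {..<length Us}"
  shows "permute_list q cs \<in> decorations F (permute_list q Us)"
proof -
  have "length cs = length Us"
    using assms(1) by (auto simp: decorations_def tuples_def dest: list_all2_lengthD)
  then show ?thesis
    using assms by (simp add: decorations_def tuples_def permute_list_map[symmetric] list_all2_permute_list_iff)
qed

lemma powers_index_iff:
  "(Us, cs) \<in> powers_index F X \<longleftrightarrow>
     \<Union>(set Us) = X \<and> sorted_wrt (\<lambda>A B. A \<inter> B = {}) Us \<and>
     list_all2 (\<lambda>c U. c \<in> carrier (space F U)) cs Us"
  by (simp add: powers_index_def decomps_iff decorations_def tuples_def list_all2_map2)

lemma powers_index_length: "(Us, cs) \<in> powers_index F X \<Longrightarrow> length cs = length Us"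
  by (auto simp: powers_index_iff dest: list_all2_lengthD)

lemma powers_index_permute:
  assumes "(Us, cs) \<in> powers_index F X" "q permutes {..<length Us}"
  shows "(permute_list q Us, permute_list q cs) \<in> powers_index F X"
  using assms decomps_permute decorations_permute by (auto simp: powers_index_def)

locale spaces = scalars K for K :: "'k ring" +
  fixes F :: "('a set, 'm, 'k, 'v, 'z) functor_data_scheme"
  assumes vspace_space: "finite X \<Longrightarrow> vspace (space F X)"
begin

lemma decomps_vspace:
  assumes "finite X" "Us \<in> decomps n X" "V \<in> set (map (space F) Us)"
  shows "vspace V"
proof -
  obtain U where "U \<in> set Us" "V = space F U" using assms by auto
  moreover have "finite U" using assms(1,2) \<open>U \<in> set Us\<close> by (auto simp: decomps_def intro: finite_subset)
  ultimately show ?thesis by (simp add: vspace_space)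
qed

lemma sgn_char_simps:
  "sgn_char K \<epsilon> q \<in> carrier K" "sgn_char K \<epsilon> q \<otimes>\<^bsub>K\<^esub> sgn_char K \<epsilon> q = \<one>\<^bsub>K\<^esub>"
  by (auto simp: sgn_char_def l_minus r_minus)

context
  fixes X :: "'a set"
  assumes X: "finite X"
begin

lemma vspace_tensor_decomp: "Us \<in> decomps n X \<Longrightarrow> vspace (tensor K (map (space F) Us))"
  by (rule vspace_tensor) (rule decomps_vspace[OF X])

lemma vspace_conv_pow: "vspace (conv_pow K F n X)"
  unfolding conv_pow_def by (rule vspace_dsum) (rule vspace_tensor_decomp)

lemma pure_tensor_closed:
  assumes "Us \<in> decomps n X" "cs \<in> decorations F Us"
  shows "pure_tensor K (map (space F) Us) cs \<in> carrier (tensor K (map (space F) Us))"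
proof (rule multilinD(1)[OF multilin_pure_tensor])
  show "vspace V" if "V \<in> set (map (space F) Us)" for V
    by (rule decomps_vspace[OF X assms(1) that])
qed (use assms(2) in \<open>simp add: decorations_def\<close>)

lemma conv_in_lin:
  assumes "Us \<in> decomps n X"
  shows "dsum_in (decomps n X) (\<lambda>Us. tensor K (map (space F) Us)) Us
    \<in> lin_maps K (tensor K (map (space F) Us)) (conv_pow K F n X)"
  unfolding conv_pow_def
  by (rule dsum_in_lin[where V = "\<lambda>Us. tensor K (map (space F) Us)", OF vspace_tensor_decomp assms])

lemma conv_pure_multilin:
  assumes "Us \<in> decomps n X"
  shows "multilin (map (space F) Us) (conv_pow K F n X) (conv_pure K F n X Us)"
  unfolding conv_pure_def[abs_def]
  by (rule multilin_lin[OF multilin_pure_tensor conv_in_lin[OF assms]])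
    (rule decomps_vspace[OF X assms], assumption)+

lemma conv_pure_closed:
  assumes "Us \<in> decomps n X" "cs \<in> decorations F Us"
  shows "conv_pure K F n X Us cs \<in> carrier (conv_pow K F n X)"
  using multilinD(1)[OF conv_pure_multilin[OF assms(1)]] assms(2) by (simp add: decorations_def)

lemma coinv_rels_subset: "coinv_rels K \<epsilon> F n X \<subseteq> carrier (conv_pow K F n X)"
proof -
  interpret P: Module.module K "conv_pow K F n X" by (rule vspace_conv_pow)
  have "conv_pure K F n X (permute_list (inv_into UNIV p) Us) (permute_list (inv_into UNIV p) cs)
      \<in> carrier (conv_pow K F n X)"
    if "p permutes {..<n}" "Us \<in> decomps n X" "cs \<in> decorations F Us" for p Us cs
    using that permutes_inv[OF that(1)] decomps_length[OF that(2)]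
    by (intro conv_pure_closed decomps_permute decorations_permute) auto
  then show ?thesis
    unfolding coinv_rels_def using sgn_char_simps conv_pure_closed
    by (auto intro!: P.minus_closed P.smult_closed)
qed

lemma quotient_coinv: "quotient K (conv_pow K F n X) (coinv_null K \<epsilon> F n X)"
  unfolding coinv_null_def by (intro quotient_span vspace_conv_pow coinv_rels_subset)

lemma vspace_coinv_pow: "vspace (coinv_pow K \<epsilon> F n X)"
  unfolding coinv_pow_def by (rule quotient.vspace_quot[OF quotient_coinv])

lemma vspace_powers: "vspace (powers_space K \<epsilon> F X)"
  unfolding powers_space_def by (rule vspace_dsum) (rule vspace_coinv_pow)

lemma powers_in_lin:
  "dsum_in UNIV (\<lambda>n. coinv_pow K \<epsilon> F n X) n \<in> lin_maps K (coinv_pow K \<epsilon> F n X) (powers_space K \<epsilon> F X)"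
  unfolding powers_space_def
  by (rule dsum_in_lin[where V = "\<lambda>n. coinv_pow K \<epsilon> F n X", OF vspace_coinv_pow UNIV_I])

text \<open>
  The projection from the \<open>n\<close>-th convolution power to its coinvariants, inside the sum over all \<open>n\<close>.
\<close>

definition pow_in :: "parity \<Rightarrow> nat \<Rightarrow> ('a set list \<Rightarrow> ('v list \<Rightarrow> 'k) set) \<Rightarrow> ('a, 'k, 'v) powers" where
  "pow_in \<epsilon> n z = dsum_in UNIV (\<lambda>n. coinv_pow K \<epsilon> F n X) n
     (coinv_null K \<epsilon> F n X +>\<^bsub>conv_pow K F n X\<^esub> z)"

lemma pow_in_lin: "pow_in \<epsilon> n \<in> lin_maps K (conv_pow K F n X) (powers_space K \<epsilon> F X)"
proof -
  interpret Q: quotient K "conv_pow K F n X" "coinv_null K \<epsilon> F n X" by (rule quotient_coinv)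
  show ?thesis
    using lin_comp[OF Q.coset_lin[folded coinv_pow_def] powers_in_lin]
    by (simp add: pow_in_def[abs_def])
qed

lemma powers_class_eq: "powers_class K \<epsilon> F X Us cs = pow_in \<epsilon> (length Us) (conv_pure K F (length Us) X Us cs)"
  by (simp add: powers_class_def pow_in_def Let_def)

lemma powers_class_multilin:
  assumes "Us \<in> decomps (length Us) X"
  shows "multilin (map (space F) Us) (powers_space K \<epsilon> F X) (powers_class K \<epsilon> F X Us)"
  unfolding powers_class_eq[abs_def]
  by (rule multilin_lin[OF conv_pure_multilin[OF assms] pow_in_lin])
    (rule decomps_vspace[OF X assms])

lemma powers_class_closed:
  assumes "(Us, cs) \<in> powers_index F X"
  shows "powers_class K \<epsilon> F X Us cs \<in> carrier (powers_space K \<epsilon> F X)"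
  using multilinD(1)[OF powers_class_multilin] assms by (auto simp: powers_index_def decorations_def)

lemma powers_class_permute:
  assumes "(Us, cs) \<in> powers_index F X" "q permutes {..<length Us}"
  shows "powers_class K \<epsilon> F X (permute_list q Us) (permute_list q cs) =
    sgn_char K \<epsilon> q \<odot>\<^bsub>powers_space K \<epsilon> F X\<^esub> powers_class K \<epsilon> F X Us cs"
proof -
  let ?n = "length Us" and ?s = "sgn_char K \<epsilon> q"
  let ?C = "conv_pow K F ?n X"
  let ?c = "conv_pure K F ?n X Us cs"
  let ?c' = "conv_pure K F ?n X (permute_list q Us) (permute_list q cs)"
  interpret C: Module.module K ?C by (rule vspace_conv_pow)
  interpret P: Module.module K "powers_space K \<epsilon> F X" by (rule vspace_powers)
  interpret Q: quotient K ?C "coinv_null K \<epsilon> F ?n X" by (rule quotient_coinv)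
  have U: "Us \<in> decomps ?n X" "cs \<in> decorations F Us" using assms by (auto simp: powers_index_def)
  have c: "?c \<in> carrier ?C" using U by (rule conv_pure_closed)
  have c': "?c' \<in> carrier ?C"
    using powers_index_permute[OF assms] by (intro conv_pure_closed) (auto simp: powers_index_def)
  have "bij q" using assms(2) by (rule permutes_bij)
  then have inv: "inv_into UNIV (inv_into UNIV q) = q" by (rule inv_inv_eq)
  have "permutation q" using assms(2) by (auto simp: permutation_permutes)
  then have sinv: "sgn_char K \<epsilon> (inv_into UNIV q) = ?s" by (simp add: sgn_char_def evenperm_inv)
  have "?s \<odot>\<^bsub>?C\<^esub> ?c' \<ominus>\<^bsub>?C\<^esub> ?c \<in> coinv_rels K \<epsilon> F ?n X"
    unfolding coinv_rels_def
    using U permutes_inv[OF assms(2)] inv sinv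
    by (intro CollectI exI[of _ "inv_into UNIV q"] exI[of _ Us] exI[of _ cs]) simp
  then have "?s \<odot>\<^bsub>?C\<^esub> ?c' \<ominus>\<^bsub>?C\<^esub> ?c \<in> coinv_null K \<epsilon> F ?n X"
    unfolding coinv_null_def by (rule subsetD[OF lin_span_superset])
  then have "pow_in \<epsilon> ?n (?s \<odot>\<^bsub>?C\<^esub> ?c') = pow_in \<epsilon> ?n ?c"
    using Q.coset_eq_iff[of "?s \<odot>\<^bsub>?C\<^esub> ?c'" ?c] c c' sgn_char_simps by (simp add: pow_in_def)
  then have "?s \<odot>\<^bsub>powers_space K \<epsilon> F X\<^esub> pow_in \<epsilon> ?n ?c' = pow_in \<epsilon> ?n ?c"
    using lin_smult[OF pow_in_lin] c' sgn_char_simps by simp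
  then have "?s \<odot>\<^bsub>powers_space K \<epsilon> F X\<^esub> pow_in \<epsilon> ?n ?c = (?s \<otimes>\<^bsub>K\<^esub> ?s) \<odot>\<^bsub>powers_space K \<epsilon> F X\<^esub> pow_in \<epsilon> ?n ?c'"
    using P.smult_assoc1 sgn_char_simps(1) lin_closed[OF pow_in_lin c'] by metis
  then show ?thesis
    using lin_closed[OF pow_in_lin c'] by (simp add: powers_class_eq sgn_char_simps)
qed

lemma powers_induct [consumes 1, case_names zero cls add smult]:
  assumes x: "x \<in> carrier (powers_space K \<epsilon> F X)"
    and zero: "P \<zero>\<^bsub>powers_space K \<epsilon> F X\<^esub>"
    and cls: "\<And>Us cs. (Us, cs) \<in> powers_index F X \<Longrightarrow> P (powers_class K \<epsilon> F X Us cs)"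
    and add: "\<And>x y. x \<in> carrier (powers_space K \<epsilon> F X) \<Longrightarrow> y \<in> carrier (powers_space K \<epsilon> F X)
      \<Longrightarrow> P x \<Longrightarrow> P y \<Longrightarrow> P (x \<oplus>\<^bsub>powers_space K \<epsilon> F X\<^esub> y)"
    and smult: "\<And>a x. a \<in> carrier K \<Longrightarrow> x \<in> carrier (powers_space K \<epsilon> F X) \<Longrightarrow> P x
      \<Longrightarrow> P (a \<odot>\<^bsub>powers_space K \<epsilon> F X\<^esub> x)"
  shows "P x"
proof -
  have pure: "P (pow_in \<epsilon> n (dsum_in (decomps n X) (\<lambda>Us. tensor K (map (space F) Us)) Us t))"
    if Us: "Us \<in> decomps n X" and t: "t \<in> carrier (tensor K (map (space F) Us))" for n Us t
  proof -
    let ?E = "\<lambda>t. pow_in \<epsilon> n (dsum_in (decomps n X) (\<lambda>Us. tensor K (map (space F) Us)) Us t)"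
    have E: "?E \<in> lin_maps K (tensor K (map (space F) Us)) (powers_space K \<epsilon> F X)"
      by (rule lin_comp[OF conv_in_lin[OF Us] pow_in_lin])
    have V: "\<And>V. V \<in> set (map (space F) Us) \<Longrightarrow> vspace V" by (rule decomps_vspace[OF X Us])
    from t show ?thesis
    proof (induction rule: tensor_induct)
      case (vspace V)
      then show ?case by (rule V)
    next
      case zero
      then show ?case
        using assms(2) lin_zero[OF vspace_tensor_decomp[OF Us] vspace_powers E] by simp
    next
      case (pure vs)
      then show ?case
        using cls[of Us vs] Us decomps_length[OF Us]
        by (simp add: powers_class_eq conv_pure_def powers_index_def decorations_def)
    qed (use add smult lin_mapsD[OF E] in auto)
  qed
  have conv: "P (pow_in \<epsilon> n z)" if z: "z \<in> carrier (conv_pow K F n X)" for n z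
    using z[unfolded conv_pow_def]
  proof (induction rule: dsum_induct)
    case (vspace Us)
    then show ?case by (rule vspace_tensor_decomp)
  next
    case zero
    then show ?case
      using assms(2) lin_zero[OF vspace_conv_pow vspace_powers pow_in_lin]
      by (simp add: conv_pow_def)
  qed (use pure add lin_mapsD[OF pow_in_lin] in \<open>auto simp: conv_pow_def\<close>)
  show ?thesis
    using x[unfolded powers_space_def]
  proof (induction rule: dsum_induct)
    case (vspace n)
    show ?case by (rule vspace_coinv_pow)
  next
    case zero
    then show ?case using assms(2) by (simp add: powers_space_def)
  next
    case (dsum_in n v)
    interpret Q: quotient K "conv_pow K F n X" "coinv_null K \<epsilon> F n X" by (rule quotient_coinv)
    from dsum_in(2) obtain z where "z \<in> carrier (conv_pow K F n X)"
      "v = coinv_null K \<epsilon> F n X +>\<^bsub>conv_pow K F n X\<^esub> z"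
      by (auto simp: coinv_pow_def Q.quot_carrier)
    then show ?case using conv[of z n] by (simp add: pow_in_def)
  qed (use add in \<open>auto simp: powers_space_def\<close>)
qed

lemma powers_lin_eqI:
  assumes W: "vspace W" and S: "S \<in> lin_maps K (powers_space K \<epsilon> F X) W"
    and T: "T \<in> lin_maps K (powers_space K \<epsilon> F X) W"
    and eq: "\<And>Us cs. (Us, cs) \<in> powers_index F X \<Longrightarrow>
      S (powers_class K \<epsilon> F X Us cs) = T (powers_class K \<epsilon> F X Us cs)"
    and x: "x \<in> carrier (powers_space K \<epsilon> F X)"
  shows "S x = T x"
  using x
proof (induction rule: powers_induct)
  case zero
  then show ?case using lin_zero[OF vspace_powers W] S T by metis
qed (use eq lin_mapsD[OF S] lin_mapsD[OF T] in auto)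

text \<open>The universal property of the powers.\<close>

lemma powers_lift:
  assumes W: "vspace W"
    and lin: "\<And>Us. Us \<in> decomps (length Us) X \<Longrightarrow> multilin (map (space F) Us) W (\<phi> Us)"
    and sym: "\<And>Us cs q. (Us, cs) \<in> powers_index F X \<Longrightarrow> q permutes {..<length Us} \<Longrightarrow>
      \<phi> (permute_list q Us) (permute_list q cs) = sgn_char K \<epsilon> q \<odot>\<^bsub>W\<^esub> \<phi> Us cs"
  shows "\<exists>T\<in>lin_maps K (powers_space K \<epsilon> F X) W.
    \<forall>(Us, cs)\<in>powers_index F X. T (powers_class K \<epsilon> F X Us cs) = \<phi> Us cs"
proof -
  interpret W: Module.module K W by (rule W)
  have "\<exists>S\<in>lin_maps K (coinv_pow K \<epsilon> F n X) W. \<forall>Us\<in>decomps n X. \<forall>cs\<in>decorations F Us.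
      S (coinv_null K \<epsilon> F n X +>\<^bsub>conv_pow K F n X\<^esub> conv_pure K F n X Us cs) = \<phi> Us cs" for n
  proof -
    interpret C: Module.module K "conv_pow K F n X" by (rule vspace_conv_pow)
    interpret Q: quotient K "conv_pow K F n X" "coinv_null K \<epsilon> F n X" by (rule quotient_coinv)
    have "\<exists>S. S \<in> lin_maps K (tensor K (map (space F) Us)) W \<and>
        (\<forall>vs\<in>tuples (map (space F) Us). S (pure_tensor K (map (space F) Us) vs) = \<phi> Us vs)"
      if Us: "Us \<in> decomps n X" for Us
    proof -
      have "multilin (map (space F) Us) W (\<phi> Us)" using lin[of Us] decomps_length[OF Us] Us by simp
      from tensor_lift[OF decomps_vspace[OF X Us] W this] show ?thesis unfolding Bex_def .
    qed
    note ex = this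
    define S where "S Us = (SOME S. S \<in> lin_maps K (tensor K (map (space F) Us)) W \<and>
        (\<forall>vs\<in>tuples (map (space F) Us). S (pure_tensor K (map (space F) Us) vs) = \<phi> Us vs))" for Us
    have S: "S Us \<in> lin_maps K (tensor K (map (space F) Us)) W \<and>
        (\<forall>vs\<in>tuples (map (space F) Us). S Us (pure_tensor K (map (space F) Us) vs) = \<phi> Us vs)"
      if Us: "Us \<in> decomps n X" for Us
      unfolding S_def by (rule someI_ex[OF ex[OF Us]])
    note S = S[THEN conjunct1] S[THEN conjunct2, rule_format]
    obtain T where T: "T \<in> lin_maps K (conv_pow K F n X) W"
      "\<forall>Us\<in>decomps n X. \<forall>t\<in>carrier (tensor K (map (space F) Us)).
        T (dsum_in (decomps n X) (\<lambda>Us. tensor K (map (space F) Us)) Us t) = S Us t"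
      using dsum_lift[where I = "decomps n X" and V = "\<lambda>Us. tensor K (map (space F) Us)" and T = S,
          OF vspace_tensor_decomp W S(1)]
      unfolding conv_pow_def by (rule bexE)
    note T = T(1) T(2)[rule_format]
    have Tp: "T (conv_pure K F n X Us cs) = \<phi> Us cs"
      if "Us \<in> decomps n X" "cs \<in> decorations F Us" for Us cs
      using that pure_tensor_closed[OF that] by (simp add: conv_pure_def T(2) S(2) decorations_def)
    have "T r = \<zero>\<^bsub>W\<^esub>" if "r \<in> coinv_rels K \<epsilon> F n X" for r
    proof -
      obtain p Us cs where p: "p permutes {..<n}" and U: "Us \<in> decomps n X" "cs \<in> decorations F Us"
        and r: "r = sgn_char K \<epsilon> p \<odot>\<^bsub>conv_pow K F n X\<^esub>
            conv_pure K F n X (permute_list (inv_into UNIV p) Us) (permute_list (inv_into UNIV p) cs)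
          \<ominus>\<^bsub>conv_pow K F n X\<^esub> conv_pure K F n X Us cs"
        using \<open>r \<in> coinv_rels K \<epsilon> F n X\<close> unfolding coinv_rels_def by blast
      have p': "inv_into UNIV p permutes {..<length Us}" using permutes_inv[OF p] decomps_length[OF U(1)] by simp
      have U': "permute_list (inv_into UNIV p) Us \<in> decomps n X" "permute_list (inv_into UNIV p) cs \<in> decorations F (permute_list (inv_into UNIV p) Us)"
        using U p' decomps_length[OF U(1)] decomps_permute decorations_permute by auto
      have idx: "(Us, cs) \<in> powers_index F X" using U decomps_length[OF U(1)] by (auto simp: powers_index_def)
      have "permutation p" using p by (auto simp: permutation_permutes)
      then have sinv: "sgn_char K \<epsilon> (inv_into UNIV p) = sgn_char K \<epsilon> p" by (simp add: sgn_char_def evenperm_inv)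
      have \<phi>: "\<phi> Us cs \<in> carrier W"
        using lin[of Us] U decomps_length[OF U(1)] multilinD(1) by (auto simp: decorations_def)
      have "sgn_char K \<epsilon> p \<odot>\<^bsub>W\<^esub> \<phi> (permute_list (inv_into UNIV p) Us) (permute_list (inv_into UNIV p) cs) = \<phi> Us cs"
        using sym[OF idx p'] sinv sgn_char_simps \<phi> by (simp add: W.smult_assoc1[symmetric])
      then show ?thesis
        using conv_pure_closed[OF U] conv_pure_closed[OF U'] sgn_char_simps \<phi>
        by (simp add: r lin_diff[OF vspace_conv_pow W T(1)] lin_smult[OF T(1)] Tp[OF U] Tp[OF U']
            vspace_diff_eq_zero[OF W])
    qed
    then have ker: "T z = \<zero>\<^bsub>W\<^esub>" if "z \<in> coinv_null K \<epsilon> F n X" for z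
      using that lin_span_kernel[OF vspace_conv_pow W T(1) coinv_rels_subset]
      unfolding coinv_null_def by blast
    obtain S where "S \<in> lin_maps K (coinv_pow K \<epsilon> F n X) W"
      and "\<forall>z\<in>carrier (conv_pow K F n X). S (coinv_null K \<epsilon> F n X +>\<^bsub>conv_pow K F n X\<^esub> z) = T z"
      using Q.quot_lift[OF W T(1) ker] unfolding coinv_pow_def by (rule bexE)
    then show ?thesis by (intro bexI[of _ S]) (simp_all add: Tp conv_pure_closed)
  qed
  note ex = this
  define S where "S n = (SOME S. S \<in> lin_maps K (coinv_pow K \<epsilon> F n X) W \<and> (\<forall>Us\<in>decomps n X. \<forall>cs\<in>decorations F Us.
      S (coinv_null K \<epsilon> F n X +>\<^bsub>conv_pow K F n X\<^esub> conv_pure K F n X Us cs) = \<phi> Us cs))" for n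
  have S: "S n \<in> lin_maps K (coinv_pow K \<epsilon> F n X) W \<and> (\<forall>Us\<in>decomps n X. \<forall>cs\<in>decorations F Us.
      S n (coinv_null K \<epsilon> F n X +>\<^bsub>conv_pow K F n X\<^esub> conv_pure K F n X Us cs) = \<phi> Us cs)" for n
    unfolding S_def by (rule someI_ex[OF ex[of n, unfolded Bex_def]])
  note S = S[THEN conjunct1] S[THEN conjunct2, rule_format]
  obtain T where T: "T \<in> lin_maps K (powers_space K \<epsilon> F X) W"
    "\<forall>n\<in>UNIV. \<forall>v\<in>carrier (coinv_pow K \<epsilon> F n X). T (dsum_in UNIV (\<lambda>n. coinv_pow K \<epsilon> F n X) n v) = S n v"
    using dsum_lift[where V = "\<lambda>n. coinv_pow K \<epsilon> F n X" and T = S and I = UNIV, OF vspace_coinv_pow W S(1)]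
    unfolding powers_space_def by (rule bexE)
  note T = T(1) T(2)[rule_format, OF UNIV_I]
  have "T (powers_class K \<epsilon> F X Us cs) = \<phi> Us cs" if "(Us, cs) \<in> powers_index F X" for Us cs
  proof -
    have U: "Us \<in> decomps (length Us) X" "cs \<in> decorations F Us"
      using that by (auto simp: powers_index_def)
    interpret Q: quotient K "conv_pow K F (length Us) X" "coinv_null K \<epsilon> F (length Us) X"
      by (rule quotient_coinv)
    show ?thesis
      using lin_closed[OF Q.coset_lin conv_pure_closed[OF U]] S(2)[OF U]
      by (simp add: powers_class_def Let_def T(2) coinv_pow_def[symmetric])
  qed
  then show ?thesis using T(1) by (intro bexI[of _ T]) auto
qed

text \<open>
  Hence \<open>lin_map_of\<close>, applied to a family that is multilinear and symmetric up to sign, is the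
  linear map with the prescribed values.
\<close>

lemma
  assumes W: "vspace W"
    and lin: "\<And>Us. Us \<in> decomps (length Us) X \<Longrightarrow> multilin (map (space F) Us) W (\<phi> Us)"
    and sym: "\<And>Us cs q. (Us, cs) \<in> powers_index F X \<Longrightarrow> q permutes {..<length Us} \<Longrightarrow>
      \<phi> (permute_list q Us) (permute_list q cs) = sgn_char K \<epsilon> q \<odot>\<^bsub>W\<^esub> \<phi> Us cs"
  defines "T \<equiv> lin_map_of K (powers_space K \<epsilon> F X) W (powers_index F X)
      (\<lambda>(Us, cs). powers_class K \<epsilon> F X Us cs) (\<lambda>(Us, cs). \<phi> Us cs)"
  shows powers_map_of_lin: "T \<in> lin_maps K (powers_space K \<epsilon> F X) W"
    and powers_map_of_class: "\<And>Us cs. (Us, cs) \<in> powers_index F X \<Longrightarrow>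
      T (powers_class K \<epsilon> F X Us cs) = \<phi> Us cs"
proof -
  obtain S where S: "S \<in> lin_maps K (powers_space K \<epsilon> F X) W"
    "\<And>Us cs. (Us, cs) \<in> powers_index F X \<Longrightarrow> S (powers_class K \<epsilon> F X Us cs) = \<phi> Us cs"
    using powers_lift[OF W lin sym] by auto
  have T: "T x = S x" if x: "x \<in> carrier (powers_space K \<epsilon> F X)" for x
    unfolding T_def lin_map_of_def
  proof (rule the_equality)
    fix y
    assume "\<exists>R\<in>lin_maps K (powers_space K \<epsilon> F X) W.
      (\<forall>i\<in>powers_index F X. R (case i of (Us, cs) \<Rightarrow> powers_class K \<epsilon> F X Us cs) =
        (case i of (Us, cs) \<Rightarrow> \<phi> Us cs)) \<and> y = R x"
    then obtain R where R: "R \<in> lin_maps K (powers_space K \<epsilon> F X) W" "y = R x"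
      "\<And>Us cs. (Us, cs) \<in> powers_index F X \<Longrightarrow> R (powers_class K \<epsilon> F X Us cs) = \<phi> Us cs"
      by fastforce
    show "y = S x" unfolding R(2) by (rule powers_lin_eqI[OF W R(1) S(1) _ x]) (simp add: R(3) S(2))
  next
    show "\<exists>R\<in>lin_maps K (powers_space K \<epsilon> F X) W.
      (\<forall>i\<in>powers_index F X. R (case i of (Us, cs) \<Rightarrow> powers_class K \<epsilon> F X Us cs) =
        (case i of (Us, cs) \<Rightarrow> \<phi> Us cs)) \<and> S x = R x"
      using S by (intro bexI[of _ S]) auto
  qed
  show "T \<in> lin_maps K (powers_space K \<epsilon> F X) W"
    using T by (rule lin_maps_cong[OF vspace_powers S(1)])
  show "T (powers_class K \<epsilon> F X Us cs) = \<phi> Us cs" if "(Us, cs) \<in> powers_index F X" for Us cs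
    using S(2)[OF that] T powers_class_closed[OF that] by simp
qed

end

end

lemma permute_list_map2:
  assumes "q permutes {..<length Us}" "length cs = length Us"
  shows "permute_list q (map2 g Us cs) = map2 g (permute_list q Us) (permute_list q cs)"
  using assms by (simp add: permute_list_map permute_list_zip)

lemma map2_update:
  assumes "length cs = length Us" "i < length Us"
  shows "map2 g Us (cs[i := x]) = (map2 g Us cs)[i := g (Us ! i) x]"
  by (rule nth_equalityI) (use assms in \<open>auto simp: nth_list_update\<close>)

lemma permute_list_update:
  assumes "q permutes {..<length cs}" "i < length cs"
  shows "permute_list q (cs[i := x]) = (permute_list q cs)[inv_into UNIV q i := x]"
proof (rule nth_equalityI)
  fix j assume "j < length (permute_list q (cs[i := x]))"
  then have j: "j < length cs" by simp
  have "q j < length cs" using permutes_in_image[OF assms(1), of j] j by simp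
  moreover have "q j = i \<longleftrightarrow> j = inv_into UNIV q i"
    using permutes_inv_eq[OF assms(1), of i j] by auto
  ultimately show "permute_list q (cs[i := x]) ! j = (permute_list q cs)[inv_into UNIV q i := x] ! j"
    using assms j by (auto simp: permute_list_nth nth_list_update)
qed simp

lemma permute_list_append_fixed:
  assumes "q permutes {..<length xs}"
  shows "permute_list q (xs @ ys) = permute_list q xs @ ys"
proof (rule nth_equalityI)
  have q: "q permutes {..<length (xs @ ys)}" using assms by (rule permutes_subset) auto
  fix j assume "j < length (permute_list q (xs @ ys))"
  then have j: "j < length (xs @ ys)" by simp
  show "permute_list q (xs @ ys) ! j = (permute_list q xs @ ys) ! j"
  proof (cases "j < length xs")
    case True
    then have "q j < length xs" using permutes_in_image[OF assms, of j] by simp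
    then show ?thesis using q assms j True by (simp add: permute_list_nth nth_append del: length_append)
  next
    case False
    then have "q j = j" using assms by (auto simp: permutes_def)
    then show ?thesis using q assms j False by (simp add: permute_list_nth nth_append del: length_append)
  qed
qed simp

lemma permute_to_end:
  assumes "distinct Ws" "set Ws \<subseteq> set Us"
  obtains q Rs where "q permutes {..<length Us}" "permute_list q Us = Rs @ Ws"
proof -
  have "mset Ws \<subseteq># mset Us"
  proof (rule mset_subset_eqI)
    fix x
    have "count (mset Ws) x = (if x \<in> set Ws then 1 else 0)"
      using assms(1) distinct_count_atmost_1[of Ws] by simp
    moreover have "count (mset Us) x \<ge> 1" if "x \<in> set Us"
      using that by (simp add: Suc_le_eq)
    ultimately show "count (mset Ws) x \<le> count (mset Us) x" using assms(2) by auto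
  qed
  moreover obtain Rs where "mset Rs = mset Us - mset Ws" using ex_mset by blast
  ultimately have "mset (Rs @ Ws) = mset Us" by simp
  then show ?thesis by (metis mset_eq_permutation that)
qed

context scalars begin

text \<open>
  The sign by which the exchange of two factors acts on the powers.
\<close>

definition psign :: "parity \<Rightarrow> 'k" where
  "psign \<epsilon> = (if \<epsilon> = Pos then \<one>\<^bsub>K\<^esub> else \<ominus>\<^bsub>K\<^esub> \<one>\<^bsub>K\<^esub>)"

lemma psign_simps [simp]:
  "psign \<epsilon> \<in> carrier K" "psign \<epsilon> \<otimes>\<^bsub>K\<^esub> psign \<epsilon> = \<one>\<^bsub>K\<^esub>"
  by (auto simp: psign_def l_minus r_minus)

lemma sgn_char_psign: "sgn_char K \<epsilon> p = (if evenperm p then \<one>\<^bsub>K\<^esub> else psign \<epsilon>)"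
  by (auto simp: sgn_char_def psign_def)

lemma sgn_char_closed [simp]: "sgn_char K \<epsilon> p \<in> carrier K"
  and sgn_char_square [simp]: "sgn_char K \<epsilon> p \<otimes>\<^bsub>K\<^esub> sgn_char K \<epsilon> p = \<one>\<^bsub>K\<^esub>"
  by (auto simp: sgn_char_psign)

lemma sgn_char_comp:
  assumes "permutation p" "permutation q"
  shows "sgn_char K \<epsilon> (p \<circ> q) = sgn_char K \<epsilon> p \<otimes>\<^bsub>K\<^esub> sgn_char K \<epsilon> q"
  using assms by (auto simp: sgn_char_psign evenperm_comp)

lemma psign_smult:
  assumes "vspace V" "x \<in> carrier V"
  shows "psign \<epsilon> \<odot>\<^bsub>V\<^esub> (psign \<epsilon> \<odot>\<^bsub>V\<^esub> x) = x"
proof -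
  interpret V: Module.module K V by fact
  show ?thesis using assms(2) by (simp add: V.smult_assoc1[symmetric])
qed

lemma multilin_map2:
  assumes \<psi>: "multilin (map (space F') (map h Us)) W \<psi>"
    and L: "\<And>U. U \<in> set Us \<Longrightarrow> L U \<in> lin_maps K (space F U) (space F' (h U))"
  shows "multilin (map (space F) Us) W (\<lambda>cs. \<psi> (map2 L Us cs))"
proof -
  have t: "map2 L Us cs \<in> tuples (map (space F') (map h Us))"
    if "cs \<in> tuples (map (space F) Us)" for cs
    using that lin_closed[OF L] by (auto simp: tuples_def list_all2_conv_all_nth)
  have len: "length cs = length Us" if "cs \<in> tuples (map (space F) Us)" for cs
    using that by (auto simp: tuples_def dest: list_all2_lengthD)
  show ?thesis
  proof (rule multilinI)
    fix cs assume "cs \<in> tuples (map (space F) Us)"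
    then show "\<psi> (map2 L Us cs) \<in> carrier W" using multilinD(1)[OF \<psi> t] by blast
  next
    fix cs i x y
    assume *: "cs \<in> tuples (map (space F) Us)" "i < length (map (space F) Us)"
      "x \<in> carrier (map (space F) Us ! i)" "y \<in> carrier (map (space F) Us ! i)"
    then have U: "Us ! i \<in> set Us" by simp
    show "\<psi> (map2 L Us (cs[i := x \<oplus>\<^bsub>map (space F) Us ! i\<^esub> y])) =
        \<psi> (map2 L Us (cs[i := x])) \<oplus>\<^bsub>W\<^esub> \<psi> (map2 L Us (cs[i := y]))"
      using * multilinD(2)[OF \<psi> t[OF *(1)], of i "L (Us ! i) x" "L (Us ! i) y"]
        lin_mapsD[OF L[OF U]] by (simp add: map2_update len)
  next
    fix cs i a x
    assume *: "cs \<in> tuples (map (space F) Us)" "i < length (map (space F) Us)"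
      "a \<in> carrier K" "x \<in> carrier (map (space F) Us ! i)"
    then have U: "Us ! i \<in> set Us" by simp
    show "\<psi> (map2 L Us (cs[i := a \<odot>\<^bsub>map (space F) Us ! i\<^esub> x])) =
        a \<odot>\<^bsub>W\<^esub> \<psi> (map2 L Us (cs[i := x]))"
      using * multilinD(3)[OF \<psi> t[OF *(1)], of i a "L (Us ! i) x"]
        lin_mapsD[OF L[OF U]] by (simp add: map2_update len)
  qed
qed

lemma multilin_permute:
  fixes F :: "('a set, 'm, 'k, 'v, 'z) functor_data_scheme"
  assumes \<psi>: "multilin (map (space F) (permute_list q Us)) W \<psi>"
    and q: "q permutes {..<length Us}"
  shows "multilin (map (space F) Us) W (\<lambda>cs. \<psi> (permute_list q cs))"
proof -
  have len: "length cs = length Us" if "cs \<in> tuples (map (space F) Us)" for cs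
    using that by (auto simp: tuples_def dest: list_all2_lengthD)
  have t: "permute_list q cs \<in> tuples (map (space F) (permute_list q Us))"
    if "cs \<in> tuples (map (space F) Us)" for cs
    using decorations_permute[of cs F Us q] q that by (simp add: decorations_def)
  have i': "inv_into UNIV q i < length Us" "q (inv_into UNIV q i) = i" if "i < length Us" for i
    using that permutes_in_image[OF permutes_inv[OF q], of i] permutes_inverses(1)[OF q] by auto
  show ?thesis
  proof (rule multilinI)
    fix cs assume "cs \<in> tuples (map (space F) Us)"
    then show "\<psi> (permute_list q cs) \<in> carrier W" using multilinD(1)[OF \<psi> t] by blast
  next
    fix cs i x y
    assume *: "cs \<in> tuples (map (space F) Us)" "i < length (map (space F) Us)"
      "x \<in> carrier (map (space F) Us ! i)" "y \<in> carrier (map (space F) Us ! i)"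
    show "\<psi> (permute_list q (cs[i := x \<oplus>\<^bsub>map (space F) Us ! i\<^esub> y])) =
        \<psi> (permute_list q (cs[i := x])) \<oplus>\<^bsub>W\<^esub> \<psi> (permute_list q (cs[i := y]))"
      using * multilinD(2)[OF \<psi> t[OF *(1)], of "inv_into UNIV q i" x y] i'[of i] q
      by (simp add: permute_list_update len permute_list_nth)
  next
    fix cs i a x
    assume *: "cs \<in> tuples (map (space F) Us)" "i < length (map (space F) Us)"
      "a \<in> carrier K" "x \<in> carrier (map (space F) Us ! i)"
    show "\<psi> (permute_list q (cs[i := a \<odot>\<^bsub>map (space F) Us ! i\<^esub> x])) =
        a \<odot>\<^bsub>W\<^esub> \<psi> (permute_list q (cs[i := x]))"
      using * multilinD(3)[OF \<psi> t[OF *(1)], of "inv_into UNIV q i" a x] i'[of i] q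
      by (simp add: permute_list_update len permute_list_nth)
  qed
qed

lemma linearization_comp_gen:
  assumes "g \<in> arr D Y Z" "f \<in> arr D X Y" "cmp D X Y Z g f \<in> arr D X Z"
  shows "lcomp (linearization K D) X Y Z (free_gen K (arr D Y Z) g) (free_gen K (arr D X Y) f) =
    free_gen K (arr D X Z) (cmp D X Y Z g f)"
proof -
  interpret F: Module.module K "free_space K (arr D X Z)" by (rule vspace_free)
  show ?thesis
    using assms by (simp add: linearization_def Let_def free_supp_gen free_gen_apply free_gen_closed)
qed

end

section \<open>Relabelling\<close>

lemma FB_simps:
  "ob FB = {X. finite X}" "arr FB X Y = {f \<in> extensional X. bij_betw f X Y}"
  "ident FB X = (\<lambda>x\<in>X. x)" "cmp FB X Y Z g f = compose X g f"
  by (simp_all add: FB_def)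

lemma restrict_FB: "inj_on f U \<Longrightarrow> restrict f U \<in> arr FB U (f ` U)"
  by (auto simp: FB_simps bij_betw_def inj_on_def)

locale FB_module = spaces K F + cat_module K "kFB K" F
  for K :: "'k ring" and F :: "('a set, ('a \<Rightarrow> 'a) \<Rightarrow> 'k, 'k, 'v, 'z) functor_data_scheme"
begin

text \<open>
  Bijections enter as functions restricted to a set, with the image as target. One function then
  moves all parts of a decomposition at once.
\<close>

definition relabel :: "('a \<Rightarrow> 'a) \<Rightarrow> 'a set \<Rightarrow> 'v \<Rightarrow> 'v" where
  "relabel f U = act F U (f ` U) (kFB_gen K U (f ` U) (restrict f U))"

lemma kFB_simps:
  "lob (kFB K) = {X. finite X}" "lhom (kFB K) X Y = free_space K (arr FB X Y)"
  "lident (kFB K) X = kFB_gen K X X (\<lambda>x\<in>X. x)"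
  by (simp_all add: kFB_def linearization_def FB_simps)

lemma relabel_lin:
  assumes "finite U" "inj_on f U"
  shows "relabel f U \<in> lin_maps K (space F U) (space F (f ` U))"
  unfolding relabel_def
  using assms restrict_FB[OF assms(2)] by (intro act_closed) (auto simp: kFB_simps free_gen_closed)

lemma relabel_cong: "(\<And>x. x \<in> U \<Longrightarrow> f x = g x) \<Longrightarrow> relabel f U = relabel g U"
  unfolding relabel_def by (simp cong: restrict_cong image_cong)

lemma relabel_ident:
  assumes "finite U" "c \<in> carrier (space F U)" "\<And>x. x \<in> U \<Longrightarrow> f x = x"
  shows "relabel f U c = c"
proof -
  have "relabel f U = relabel (\<lambda>x. x) U" by (rule relabel_cong) (rule assms(3))
  then show ?thesis
    using act_ident[of U c] assms(1,2) by (simp add: relabel_def kFB_simps)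
qed

lemma relabel_comp:
  assumes "finite U" "inj_on f U" "inj_on g (f ` U)" "c \<in> carrier (space F U)"
  shows "relabel g (f ` U) (relabel f U c) = relabel (\<lambda>x. g (f x)) U c"
proof -
  let ?V = "f ` U" and ?W = "g ` f ` U"
  let ?f = "restrict f U" and ?g = "restrict g ?V" and ?h = "restrict (\<lambda>x. g (f x)) U"
  have W: "?W = (\<lambda>x. g (f x)) ` U" by auto
  have arr: "?f \<in> arr FB U ?V" "?g \<in> arr FB ?V ?W" "?h \<in> arr FB U ?W"
    using restrict_FB[OF assms(2)] restrict_FB[OF assms(3)] restrict_FB[of "\<lambda>x. g (f x)" U]
      comp_inj_on[OF assms(2,3)] W by (auto simp: comp_def)
  have cmp: "cmp FB U ?V ?W ?g ?f = ?h"
    by (auto simp: FB_simps compose_def fun_eq_iff)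
  have "act F U ?W (lcomp (kFB K) U ?V ?W (kFB_gen K ?V ?W ?g) (kFB_gen K U ?V ?f)) c =
      act F ?V ?W (kFB_gen K ?V ?W ?g) (act F U ?V (kFB_gen K U ?V ?f) c)"
    using assms(1,4) arr by (intro act_comp) (auto simp: kFB_simps free_gen_closed)
  moreover have "lcomp (kFB K) U ?V ?W (kFB_gen K ?V ?W ?g) (kFB_gen K U ?V ?f) = kFB_gen K U ?W ?h"
    unfolding kFB_def using linearization_comp_gen[of ?g FB ?V ?W ?f U] arr cmp by simp
  ultimately show ?thesis by (simp add: relabel_def W)
qed

text \<open>The relabelling of decorated decompositions.\<close>

lemma powers_index_relabel:
  assumes "finite X" "inj_on f X" "(Us, cs) \<in> powers_index F X"
  shows "(map (image f) Us, map2 (relabel f) Us cs) \<in> powers_index F (f ` X)"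
proof -
  have sub: "U \<subseteq> X" if "U \<in> set Us" for U using assms(3) that by (auto simp: powers_index_iff)
  have "sorted_wrt (\<lambda>A B. f ` A \<inter> f ` B = {}) Us"
  proof (rule sorted_wrt_mono_rel)
    show "sorted_wrt (\<lambda>A B. A \<inter> B = {}) Us" using assms(3) by (simp add: powers_index_iff)
    show "f ` A \<inter> f ` B = {}" if "A \<in> set Us" "B \<in> set Us" "A \<inter> B = {}" for A B
      using inj_on_image_Int[OF assms(2) sub[OF that(1)] sub[OF that(2)]] that(3) by simp
  qed
  moreover have "relabel f U c \<in> carrier (space F (f ` U))"
    if "U \<in> set Us" "c \<in> carrier (space F U)" for U c
    using lin_closed[OF relabel_lin that(2)] sub[OF that(1)] assms(1,2)
    by (meson finite_subset inj_on_subset)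
  then have "list_all2 (\<lambda>c U. c \<in> carrier (space F U)) (map2 (relabel f) Us cs) (map (image f) Us)"
    using assms(3) by (auto simp: powers_index_iff list_all2_conv_all_nth)
  ultimately show ?thesis
    using assms(3) by (auto simp: powers_index_iff sorted_wrt_map)
qed

abbreviation FB_map :: "parity \<Rightarrow> 'a set \<Rightarrow> ('a \<Rightarrow> 'a) \<Rightarrow> ('a, 'k, 'v) powers \<Rightarrow> ('a, 'k, 'v) powers" where
  "FB_map \<epsilon> X f \<equiv> powers_FB_map K \<epsilon> F X (f ` X) f"

lemma
  assumes X: "finite X" and f: "inj_on f X"
  shows FB_map_lin: "FB_map \<epsilon> X f \<in> lin_maps K (powers_space K \<epsilon> F X) (powers_space K \<epsilon> F (f ` X))"
    and FB_map_class: "\<And>Us cs. (Us, cs) \<in> powers_index F X \<Longrightarrow>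
      FB_map \<epsilon> X f (powers_class K \<epsilon> F X Us cs) =
      powers_class K \<epsilon> F (f ` X) (map (image f) Us) (map2 (relabel f) Us cs)"
proof -
  let ?\<phi> = "\<lambda>Us cs. powers_class K \<epsilon> F (f ` X) (map (image f) Us) (map2 (relabel f) Us cs)"
  have X': "finite (f ` X)" using X by simp
  have lin: "multilin (map (space F) Us) (powers_space K \<epsilon> F (f ` X)) (?\<phi> Us)"
    if Us: "Us \<in> decomps (length Us) X" for Us
  proof (rule multilin_map2[where h = "image f"])
    have sub: "U \<subseteq> X" if "U \<in> set Us" for U using Us that by (auto simp: decomps_iff)
    have "sorted_wrt (\<lambda>A B. f ` A \<inter> f ` B = {}) Us"
    proof (rule sorted_wrt_mono_rel)
      show "sorted_wrt (\<lambda>A B. A \<inter> B = {}) Us" using Us by (simp add: decomps_iff)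
      show "f ` A \<inter> f ` B = {}" if "A \<in> set Us" "B \<in> set Us" "A \<inter> B = {}" for A B
        using inj_on_image_Int[OF f sub[OF that(1)] sub[OF that(2)]] that(3) by simp
    qed
    then have "map (image f) Us \<in> decomps (length (map (image f) Us)) (f ` X)"
      using Us unfolding decomps_iff by (auto simp: sorted_wrt_map)
    then show "multilin (map (space F) (map (image f) Us)) (powers_space K \<epsilon> F (f ` X))
        (powers_class K \<epsilon> F (f ` X) (map (image f) Us))"
      by (rule powers_class_multilin[OF X'])
    show "relabel f U \<in> lin_maps K (space F U) (space F (f ` U))" if "U \<in> set Us" for U
      using sub[OF that] X f by (intro relabel_lin) (auto intro: finite_subset inj_on_subset)
  qed
  have sym: "?\<phi> (permute_list q Us) (permute_list q cs) =
      sgn_char K \<epsilon> q \<odot>\<^bsub>powers_space K \<epsilon> F (f ` X)\<^esub> ?\<phi> Us cs"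
    if idx: "(Us, cs) \<in> powers_index F X" and q: "q permutes {..<length Us}" for Us cs q
    using powers_class_permute[OF X' powers_index_relabel[OF X f idx], of q] q powers_index_length[OF idx]
    by (simp add: permute_list_map permute_list_map2[symmetric])
  note eq = powers_map_of_lin[OF X vspace_powers[OF X'] lin sym] powers_map_of_class[OF X vspace_powers[OF X'] lin sym]
  have FB: "FB_map \<epsilon> X f = lin_map_of K (powers_space K \<epsilon> F X) (powers_space K \<epsilon> F (f ` X)) (powers_index F X)
      (\<lambda>(Us, cs). powers_class K \<epsilon> F X Us cs) (\<lambda>(Us, cs). ?\<phi> Us cs)"
    by (simp add: powers_FB_map_def relabel_def)
  show "FB_map \<epsilon> X f \<in> lin_maps K (powers_space K \<epsilon> F X) (powers_space K \<epsilon> F (f ` X))"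
    unfolding FB by (rule eq(1))
  show "FB_map \<epsilon> X f (powers_class K \<epsilon> F X Us cs) = ?\<phi> Us cs" if "(Us, cs) \<in> powers_index F X" for Us cs
    unfolding FB by (rule eq(2)) (use that in auto)
qed

lemma FB_map_ident:
  assumes X: "finite X" and f: "\<And>x. x \<in> X \<Longrightarrow> f x = x" and x: "x \<in> carrier (powers_space K \<epsilon> F X)"
  shows "FB_map \<epsilon> X f x = x"
proof -
  have inj: "inj_on f X" and im: "f ` X = X" using f by (auto simp: inj_on_def)
  show ?thesis
    unfolding im
  proof (rule powers_lin_eqI[OF X vspace_powers[OF X] FB_map_lin[OF X inj, unfolded im] lin_ident _ x])
    fix Us cs assume idx: "(Us, cs) \<in> powers_index F X"
    have sub: "U \<subseteq> X" if "U \<in> set Us" for U using idx that by (auto simp: powers_index_iff)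
    have "map (image f) Us = Us"
      by (rule map_idI) (use f sub in force)
    moreover have "map2 (relabel f) Us cs = cs"
    proof (rule nth_equalityI)
      fix i assume "i < length (map2 (relabel f) Us cs)"
      then have i: "i < length Us" "i < length cs" by auto
      then have "cs ! i \<in> carrier (space F (Us ! i))"
        using idx by (auto simp: powers_index_iff list_all2_conv_all_nth)
      then show "map2 (relabel f) Us cs ! i = cs ! i"
        using i sub[of "Us ! i"] X f by (auto intro!: relabel_ident intro: finite_subset)
    qed (use powers_index_length[OF idx] in simp)
    ultimately show "powers_FB_map K \<epsilon> F X X f (powers_class K \<epsilon> F X Us cs) = powers_class K \<epsilon> F X Us cs"
      using FB_map_class[OF X inj idx] im by simp
  qed
qed

lemma FB_map_comp:
  assumes X: "finite X" and f: "inj_on f X" and g: "inj_on g (f ` X)"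
    and x: "x \<in> carrier (powers_space K \<epsilon> F X)"
  shows "FB_map \<epsilon> (f ` X) g (FB_map \<epsilon> X f x) = FB_map \<epsilon> X (\<lambda>x. g (f x)) x"
proof -
  have gf: "inj_on (\<lambda>x. g (f x)) X" using comp_inj_on[OF f g] by (simp add: comp_def)
  have X': "finite (f ` X)" "finite (g ` f ` X)" using X by auto
  have im: "(\<lambda>x. g (f x)) ` X = g ` f ` X" by auto
  show ?thesis
    unfolding im
  proof (rule powers_lin_eqI[OF X vspace_powers[OF X'(2)] lin_comp[OF FB_map_lin[OF X f] FB_map_lin[OF X'(1) g]]
      FB_map_lin[OF X gf, unfolded im] _ x])
    fix Us cs assume idx: "(Us, cs) \<in> powers_index F X"
    have sub: "U \<subseteq> X" if "U \<in> set Us" for U using idx that by (auto simp: powers_index_iff)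
    have "map2 (relabel g) (map (image f) Us) (map2 (relabel f) Us cs) = map2 (relabel (\<lambda>x. g (f x))) Us cs"
    proof (rule nth_equalityI)
      fix i assume "i < length (map2 (relabel g) (map (image f) Us) (map2 (relabel f) Us cs))"
      then have i: "i < length Us" "i < length cs" by auto
      then have "cs ! i \<in> carrier (space F (Us ! i))"
        using idx by (auto simp: powers_index_iff list_all2_conv_all_nth)
      moreover have "finite (Us ! i)" "inj_on f (Us ! i)" "inj_on g (f ` (Us ! i))"
        using i sub[of "Us ! i"] X f g by (auto intro: finite_subset inj_on_subset)
      ultimately show "map2 (relabel g) (map (image f) Us) (map2 (relabel f) Us cs) ! i =
          map2 (relabel (\<lambda>x. g (f x))) Us cs ! i"
        using i relabel_comp by simp
    qed simp
    moreover have "map (image g) (map (image f) Us) = map (image (\<lambda>x. g (f x))) Us"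
      by (simp add: image_image)
    ultimately show "FB_map \<epsilon> (f ` X) g (FB_map \<epsilon> X f (powers_class K \<epsilon> F X Us cs)) =
        powers_FB_map K \<epsilon> F X (g ` f ` X) (\<lambda>x. g (f x)) (powers_class K \<epsilon> F X Us cs)"
      using FB_map_class[OF X gf idx, unfolded im]
      by (simp only: FB_map_class[OF X f idx] FB_map_class[OF X'(1) g powers_index_relabel[OF X f idx]])
  qed
qed

end

section \<open>Contraction of two labels\<close>

lemma permute_list_adjacent:
  "permute_list (transpose (length xs) (Suc (length xs))) (xs @ a # b # ys) = xs @ b # a # ys"
proof (rule nth_equalityI)
  let ?L = "xs @ a # b # ys" and ?p = "transpose (length xs) (Suc (length xs))"
  have p: "?p permutes {..<length ?L}" by (rule permutes_swap_id) auto
  fix i assume "i < length (permute_list ?p ?L)"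
  then have i: "i < length ?L" by simp
  consider "i < length xs" | "i = length xs" | "i = Suc (length xs)" | "i > Suc (length xs)" by linarith
  then show "permute_list ?p ?L ! i = (xs @ b # a # ys) ! i"
    unfolding permute_list_nth[OF p i]
    by cases (auto simp: nth_append nth_Cons' transpose_apply_other)
qed simp

context spaces begin

lemma class_swap:
  assumes "finite X" "(Rs @ U # V # Ts, ds @ a # b # es) \<in> powers_index F X" "length ds = length Rs"
  shows "powers_class K \<epsilon> F X (Rs @ V # U # Ts) (ds @ b # a # es) =
    psign \<epsilon> \<odot>\<^bsub>powers_space K \<epsilon> F X\<^esub> powers_class K \<epsilon> F X (Rs @ U # V # Ts) (ds @ a # b # es)"
proof -
  let ?p = "transpose (length Rs) (Suc (length Rs))"
  have "?p permutes {..<length (Rs @ U # V # Ts)}" by (rule permutes_swap_id) auto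
  from powers_class_permute[OF assms(1,2) this] show ?thesis
    using assms(3) permute_list_adjacent[of Rs U V Ts] permute_list_adjacent[of ds a b es]
    by (simp add: sgn_char_psign evenperm_swap)
qed

lemma index_swap:
  assumes "(Rs @ U # V # Ts, ds @ a # b # es) \<in> powers_index F X" "length ds = length Rs"
  shows "(Rs @ V # U # Ts, ds @ b # a # es) \<in> powers_index F X"
  using assms by (auto simp: powers_index_iff sorted_wrt_append list_all2_append)

lemma index_rotate:
  assumes "(Rs @ U # V # W # Ts, ds @ a # b # c # es) \<in> powers_index F X" "length ds = length Rs"
  shows "(Rs @ V # W # U # Ts, ds @ b # c # a # es) \<in> powers_index F X"
  using index_swap[of "Rs @ [V]" U W Ts "ds @ [b]" a c es X] index_swap[OF assms] assms(2) by simp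

text \<open>A cyclic permutation of three factors is even.\<close>

lemma class_rotate:
  assumes "finite X" "(Rs @ U # V # W # Ts, ds @ a # b # c # es) \<in> powers_index F X" "length ds = length Rs"
  shows "powers_class K \<epsilon> F X (Rs @ V # W # U # Ts) (ds @ b # c # a # es) =
    powers_class K \<epsilon> F X (Rs @ U # V # W # Ts) (ds @ a # b # c # es)"
  using class_swap[OF assms(1), of "Rs @ [V]" U W Ts "ds @ [b]" a c es]
    class_swap[OF assms] index_swap[OF assms(2,3)] assms(3)
    psign_smult[OF vspace_powers[OF assms(1)] powers_class_closed[OF assms(1,2)]]
  by simp

lemma class_normalize:
  assumes X: "finite X" and idx: "(Us, cs) \<in> powers_index F X" and Ws: "distinct Ws" "set Ws \<subseteq> set Us"
  obtains q Rs ds es where "q permutes {..<length Us}" "permute_list q Us = Rs @ Ws"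
    "permute_list q cs = ds @ es" "length ds = length Rs" "length es = length Ws"
    "(Rs @ Ws, ds @ es) \<in> powers_index F X"
    "powers_class K \<epsilon> F X Us cs = sgn_char K \<epsilon> q \<odot>\<^bsub>powers_space K \<epsilon> F X\<^esub> powers_class K \<epsilon> F X (Rs @ Ws) (ds @ es)"
proof -
  interpret P: Module.module K "powers_space K \<epsilon> F X" by (rule vspace_powers[OF X])
  obtain q Rs where q: "q permutes {..<length Us}" "permute_list q Us = Rs @ Ws"
    using permute_to_end[OF Ws] .
  define ds es where "ds = take (length Rs) (permute_list q cs)" and "es = drop (length Rs) (permute_list q cs)"
  have cs: "permute_list q cs = ds @ es" by (simp add: ds_def es_def)
  have "length (permute_list q cs) = length Rs + length Ws"
    using powers_index_length[OF idx] q(2) by (metis length_append length_permute_list)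
  then have len: "length ds = length Rs" "length es = length Ws" by (auto simp: ds_def es_def)
  have idx': "(Rs @ Ws, ds @ es) \<in> powers_index F X"
    using powers_index_permute[OF idx q(1)] by (simp add: q cs)
  have "powers_class K \<epsilon> F X (Rs @ Ws) (ds @ es) =
      sgn_char K \<epsilon> q \<odot>\<^bsub>powers_space K \<epsilon> F X\<^esub> powers_class K \<epsilon> F X Us cs"
    using powers_class_permute[OF X idx q(1)] by (simp add: q cs)
  then have "powers_class K \<epsilon> F X Us cs = sgn_char K \<epsilon> q \<odot>\<^bsub>powers_space K \<epsilon> F X\<^esub> powers_class K \<epsilon> F X (Rs @ Ws) (ds @ es)"
    using powers_class_closed[OF X idx] by (simp add: P.smult_assoc1[symmetric])
  then show ?thesis using that q cs len idx' by blast
qed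

text \<open>
  Reordering the factors changes both sides by the same sign. Hence an identity of linear maps has
  to be checked only where the relevant parts, those selected by \<open>P\<close>, stand at the end.
\<close>

lemma powers_eq_normalizedI:
  assumes X: "finite X" and W: "vspace W" and S: "S \<in> lin_maps K (powers_space K \<epsilon> F X) W"
    and T: "T \<in> lin_maps K (powers_space K \<epsilon> F X) W"
    and Ws: "\<And>Us. \<Union>(set Us) = X \<Longrightarrow> \<exists>Ws. distinct Ws \<and> set Ws \<subseteq> set Us \<and> P Ws"
    and eq: "\<And>Rs Ws ds es. P Ws \<Longrightarrow> (Rs @ Ws, ds @ es) \<in> powers_index F X \<Longrightarrow> length ds = length Rs
      \<Longrightarrow> length es = length Ws \<Longrightarrow> S (powers_class K \<epsilon> F X (Rs @ Ws) (ds @ es)) = T (powers_class K \<epsilon> F X (Rs @ Ws) (ds @ es))"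
    and x: "x \<in> carrier (powers_space K \<epsilon> F X)"
  shows "S x = T x"
proof (rule powers_lin_eqI[OF X W S T _ x])
  fix Us cs assume idx: "(Us, cs) \<in> powers_index F X"
  then have "\<Union>(set Us) = X" by (simp add: powers_index_iff)
  then obtain Ws where Ws': "distinct Ws" "set Ws \<subseteq> set Us" "P Ws" using Ws by blast
  obtain q Rs ds es where n: "length ds = length Rs" "length es = length Ws"
    "(Rs @ Ws, ds @ es) \<in> powers_index F X"
    "powers_class K \<epsilon> F X Us cs = sgn_char K \<epsilon> q \<odot>\<^bsub>powers_space K \<epsilon> F X\<^esub> powers_class K \<epsilon> F X (Rs @ Ws) (ds @ es)"
    by (rule class_normalize[OF X idx Ws'(1,2)])
  show "S (powers_class K \<epsilon> F X Us cs) = T (powers_class K \<epsilon> F X Us cs)"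
    unfolding n(4) using eq[OF Ws'(3) n(3,1,2)] powers_class_closed[OF X n(3)]
    by (simp add: lin_smult[OF S] lin_smult[OF T])
qed

end

locale operad = scalars K + nonunital_cyclic_operad K C
  for K :: "'k ring" and C :: "('a, 'k, 'v) cyclic_operad"
begin

lemma vspace_C: "finite X \<Longrightarrow> vspace (space C X)"
  by (rule space_module) (simp add: kFB_def linearization_def FB_simps)

sublocale FB_module K C
proof (intro FB_module.intro spaces.intro spaces_axioms.intro)
  show "scalars K" by (rule scalars_axioms)
  show "cat_module K (kFB K) C" by (rule cat_module_axioms)
  show "Module.module K (space C X)" if "finite X" for X using that by (rule vspace_C)
qed

abbreviation comp :: "'a set \<Rightarrow> 'a \<Rightarrow> 'a set \<Rightarrow> 'a \<Rightarrow> 'v \<Rightarrow> 'v \<Rightarrow> 'v" where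
  "comp \<equiv> compo_pure K C"

context
  fixes U V :: "'a set" and u v :: 'a
  assumes UV: "finite U" "finite V" "U \<inter> V = {}" "u \<in> U" "v \<in> V"
begin

lemma comp_multilin:
  "multilin [space C U, space C V] (space C ((U - {u}) \<union> (V - {v}))) (\<lambda>vs. comp U u V v (vs ! 0) (vs ! 1))"
proof -
  have V: "vspace W" if "W \<in> set [space C U, space C V]" for W
    using that UV by (auto simp: vspace_C)
  have "multilin [space C U, space C V] (space C ((U - {u}) \<union> (V - {v})))
      (\<lambda>vs. compo C U u V v (pure_tensor K [space C U, space C V] vs))"
    by (rule multilin_lin[OF multilin_pure_tensor[OF V] compo_lin[OF UV] V])
  moreover have "compo C U u V v (pure_tensor K [space C U, space C V] vs) = comp U u V v (vs ! 0) (vs ! 1)"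
    if "length vs = 2" for vs
    using that by (cases vs; cases "tl vs") (auto simp: compo_pure_def)
  moreover have "length vs = 2" if "vs \<in> tuples [space C U, space C V]" for vs
    using that by (auto simp: tuples_def dest: list_all2_lengthD)
  ultimately show ?thesis
    by (auto simp: multilin_def)
qed

lemma comp_closed [simp]:
  assumes "a \<in> carrier (space C U)" "b \<in> carrier (space C V)"
  shows "comp U u V v a b \<in> carrier (space C ((U - {u}) \<union> (V - {v})))"
  using multilinD(1)[OF comp_multilin, of "[a, b]"] assms by (simp add: tuples_def)

lemma comp_lin_left:
  assumes "b \<in> carrier (space C V)"
  shows "(\<lambda>a. comp U u V v a b) \<in> lin_maps K (space C U) (space C ((U - {u}) \<union> (V - {v})))"
proof (rule lin_mapsI)
  fix x y assume *: "x \<in> carrier (space C U)" "y \<in> carrier (space C U)"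
  show "comp U u V v (x \<oplus>\<^bsub>space C U\<^esub> y) b =
      comp U u V v x b \<oplus>\<^bsub>space C ((U - {u}) \<union> (V - {v}))\<^esub> comp U u V v y b"
    using multilinD(2)[OF comp_multilin, of "[x, b]" 0 x y] assms * by (simp add: tuples_def)
next
  fix r x assume *: "r \<in> carrier K" "x \<in> carrier (space C U)"
  show "comp U u V v (r \<odot>\<^bsub>space C U\<^esub> x) b = r \<odot>\<^bsub>space C ((U - {u}) \<union> (V - {v}))\<^esub> comp U u V v x b"
    using multilinD(3)[OF comp_multilin, of "[x, b]" 0 r x] assms * by (simp add: tuples_def)
qed (use assms in simp)

lemma comp_lin_right:
  assumes "a \<in> carrier (space C U)"
  shows "(\<lambda>b. comp U u V v a b) \<in> lin_maps K (space C V) (space C ((U - {u}) \<union> (V - {v})))"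
proof (rule lin_mapsI)
  fix x y assume *: "x \<in> carrier (space C V)" "y \<in> carrier (space C V)"
  show "comp U u V v a (x \<oplus>\<^bsub>space C V\<^esub> y) =
      comp U u V v a x \<oplus>\<^bsub>space C ((U - {u}) \<union> (V - {v}))\<^esub> comp U u V v a y"
    using multilinD(2)[OF comp_multilin, of "[a, x]" 1 x y] assms * by (simp add: tuples_def)
next
  fix r x assume *: "r \<in> carrier K" "x \<in> carrier (space C V)"
  show "comp U u V v a (r \<odot>\<^bsub>space C V\<^esub> x) = r \<odot>\<^bsub>space C ((U - {u}) \<union> (V - {v}))\<^esub> comp U u V v a x"
    using multilinD(3)[OF comp_multilin, of "[a, x]" 1 r x] assms * by (simp add: tuples_def)
qed (use assms in simp)

end

lemma index_glue:
  assumes X: "finite X" and idx: "(Rs @ [U, V], ds @ [a, b]) \<in> powers_index C X"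
    and uv: "u \<in> U" "v \<in> V"
  shows "(Rs @ [(U - {u}) \<union> (V - {v})], ds @ [comp U u V v a b]) \<in> powers_index C (X - {u, v})"
proof -
  have len: "length ds = length Rs" using powers_index_length[OF idx] by simp
  have U: "\<Union>(set Rs) \<union> U \<union> V = X" and dis: "U \<inter> V = {}"
    and ab: "a \<in> carrier (space C U)" "b \<in> carrier (space C V)"
    and R: "sorted_wrt (\<lambda>A B. A \<inter> B = {}) Rs" "\<And>R. R \<in> set Rs \<Longrightarrow> R \<inter> U = {} \<and> R \<inter> V = {}"
    and ds: "list_all2 (\<lambda>c U. c \<in> carrier (space C U)) ds Rs"
    using idx len by (auto simp: powers_index_iff sorted_wrt_append list_all2_append)
  have fin: "finite U" "finite V" using U X by (auto intro: finite_subset)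
  have c: "comp U u V v a b \<in> carrier (space C ((U - {u}) \<union> (V - {v})))"
    by (rule comp_closed[OF fin dis uv ab])
  have un: "\<Union>(set Rs) \<union> ((U - {u}) \<union> (V - {v})) = X - {u, v}"
    using U dis R(2) uv by blast
  show ?thesis
    using c un R ds len by (auto simp: powers_index_iff sorted_wrt_append list_all2_append)
qed

end

context operad begin

text \<open>
  The composition of the last two factors. The labels in the parts decide along which factors a
  contraction composes, so the lists of parts and of decorations are treated separately.
\<close>

definition glue_sets :: "'a \<Rightarrow> 'a \<Rightarrow> 'a set list \<Rightarrow> 'a set list" where
  "glue_sets u v Us = (let n = length Us - 2 in take n Us @ [(Us ! n - {u}) \<union> (Us ! Suc n - {v})])"

definition glue :: "'a \<Rightarrow> 'a \<Rightarrow> 'a set list \<Rightarrow> 'v list \<Rightarrow> 'v list" where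
  "glue u v Us cs =
     (let n = length Us - 2 in take n cs @ [comp (Us ! n) u (Us ! Suc n) v (cs ! n) (cs ! Suc n)])"

lemma glue_simps [simp]:
  "glue_sets u v (Rs @ [U, V]) = Rs @ [(U - {u}) \<union> (V - {v})]"
  "length ds = length Rs \<Longrightarrow> glue u v (Rs @ [U, V]) (ds @ [a, b]) = ds @ [comp U u V v a b]"
  by (simp_all add: glue_sets_def glue_def nth_append)

text \<open>
  A permutation that moves the factors with the labels \<open>u\<close> and \<open>v\<close> to the last two positions.
  Any two of them differ by a permutation that fixes these positions, so the choice does not
  matter for \<open>contract_value\<close>.
\<close>

definition to_end :: "'a \<Rightarrow> 'a \<Rightarrow> 'a set list \<Rightarrow> (nat \<Rightarrow> nat) \<Rightarrow> bool" where
  "to_end u v Us q \<longleftrightarrow> q permutes {..<length Us} \<and>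
     (\<exists>Rs U V. permute_list q Us = Rs @ [U, V] \<and> u \<in> U \<and> v \<in> V)"

definition contract_at :: "parity \<Rightarrow> 'a set \<Rightarrow> 'a \<Rightarrow> 'a \<Rightarrow> (nat \<Rightarrow> nat) \<Rightarrow> 'a set list \<Rightarrow> 'v list \<Rightarrow> ('a, 'k, 'v) powers" where
  "contract_at \<epsilon> X u v q Us cs = sgn_char K \<epsilon> q \<odot>\<^bsub>powers_space K \<epsilon> C (X - {u, v})\<^esub>
     powers_class K \<epsilon> C (X - {u, v}) (glue_sets u v (permute_list q Us)) (glue u v (permute_list q Us) (permute_list q cs))"

definition contract_value :: "parity \<Rightarrow> 'a set \<Rightarrow> 'a \<Rightarrow> 'a \<Rightarrow> 'a set list \<Rightarrow> 'v list \<Rightarrow> ('a, 'k, 'v) powers" where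
  "contract_value \<epsilon> X u v Us cs =
     (if \<exists>U\<in>set Us. u \<in> U \<and> v \<in> U then \<zero>\<^bsub>powers_space K \<epsilon> C (X - {u, v})\<^esub>
      else contract_at \<epsilon> X u v (SOME q. to_end u v Us q) Us cs)"

definition contract :: "parity \<Rightarrow> 'a set \<Rightarrow> 'a \<Rightarrow> 'a \<Rightarrow> ('a, 'k, 'v) powers \<Rightarrow> ('a, 'k, 'v) powers" where
  "contract \<epsilon> X u v =
     lin_map_of K (powers_space K \<epsilon> C X) (powers_space K \<epsilon> C (X - {u, v})) (powers_index C X)
       (\<lambda>(Us, cs). powers_class K \<epsilon> C X Us cs) (\<lambda>(Us, cs). contract_value \<epsilon> X u v Us cs)"

context
  fixes X :: "'a set" and u v :: 'a
  assumes X: "finite X" and u: "u \<in> X" and v: "v \<in> X" and uv: "u \<noteq> v"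
begin

lemma ex_to_end:
  assumes "\<Union>(set Us) = X" "\<not> (\<exists>U\<in>set Us. u \<in> U \<and> v \<in> U)"
  shows "\<exists>q. to_end u v Us q"
proof -
  obtain U V where UV: "U \<in> set Us" "V \<in> set Us" "u \<in> U" "v \<in> V" using assms(1) u v by blast
  then have "U \<noteq> V" using assms(2) by blast
  then obtain q Rs where "q permutes {..<length Us}" "permute_list q Us = Rs @ [U, V]"
    using permute_to_end[of "[U, V]" Us] UV by auto
  then show ?thesis using UV unfolding to_end_def by blast
qed

lemma to_endE:
  assumes "to_end u v Us q" "(Us, cs) \<in> powers_index C X"
  obtains Rs U V ds a b where "permute_list q Us = Rs @ [U, V]" "u \<in> U" "v \<in> V"
    "permute_list q cs = ds @ [a, b]" "length ds = length Rs"
    "(Rs @ [U, V], ds @ [a, b]) \<in> powers_index C X"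
proof -
  obtain Rs U V where q: "q permutes {..<length Us}" "permute_list q Us = Rs @ [U, V]" "u \<in> U" "v \<in> V"
    using assms(1) unfolding to_end_def by blast
  let ?cs = "permute_list q cs"
  have "length ?cs = Suc (Suc (length Rs))"
    using powers_index_length[OF assms(2)] q(2) by (metis length_append length_permute_list add_2_eq_Suc' length_Cons list.size(3) numeral_2_eq_2)
  then obtain ds b where ds: "?cs = ds @ [b]" "length ds = Suc (length Rs)"
    by (cases ?cs rule: rev_cases) auto
  then obtain ds' a where "ds = ds' @ [a]" "length ds' = length Rs"
    by (cases ds rule: rev_cases) auto
  then show ?thesis
    using that[of Rs U V ds' a b] ds q powers_index_permute[OF assms(2) q(1)] by simp
qed

lemma glue_index:
  assumes "to_end u v Us q" "(Us, cs) \<in> powers_index C X"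
  shows "(glue_sets u v (permute_list q Us), glue u v (permute_list q Us) (permute_list q cs)) \<in> powers_index C (X - {u, v})"
  using to_endE[OF assms] by (metis glue_simps index_glue[OF X])

lemma to_end_unique:
  assumes "to_end u v Us q" "to_end u v Us q'" "(Us, cs) \<in> powers_index C X"
  shows "contract_at \<epsilon> X u v q Us cs = contract_at \<epsilon> X u v q' Us cs"
proof -
  have X': "finite (X - {u, v})" using X by simp
  interpret P: Module.module K "powers_space K \<epsilon> C (X - {u, v})" by (rule vspace_powers[OF X'])
  have q: "q permutes {..<length Us}" "q' permutes {..<length Us}"
    using assms(1,2) by (auto simp: to_end_def)
  obtain Rs U V ds a b where e: "permute_list q Us = Rs @ [U, V]" "u \<in> U" "v \<in> V"
    "permute_list q cs = ds @ [a, b]" "length ds = length Rs" "(Rs @ [U, V], ds @ [a, b]) \<in> powers_index C X"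
    by (rule to_endE[OF assms(1,3)])
  obtain Rs' U' V' ds' a' b' where e': "permute_list q' Us = Rs' @ [U', V']" "u \<in> U'" "v \<in> V'"
    "permute_list q' cs = ds' @ [a', b']" "length ds' = length Rs'" "(Rs' @ [U', V'], ds' @ [a', b']) \<in> powers_index C X"
    by (rule to_endE[OF assms(2,3)])
  define n where "n = length Rs"
  have n: "length Us = Suc (Suc n)" "length Rs' = n"
    using arg_cong[OF e(1), of length] arg_cong[OF e'(1), of length] by (auto simp: n_def)
  define r where "r = inv_into UNIV q \<circ> q'"
  have qr: "q' = q \<circ> r" using permutes_inv_o(1)[OF q(1)] by (simp add: r_def o_assoc)
  have r: "r permutes {..<length Us}"
    unfolding r_def by (intro permutes_compose[OF q(2)] permutes_inv[OF q(1)])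
  have dis: "i = j" if "i < length Us" "j < length Us" "x \<in> Us ! i" "x \<in> Us ! j" for i j x
    using assms(3) that by (auto simp: powers_index_def decomps_def)
  have nth: "Us ! q n = U" "Us ! q (Suc n) = V" "Us ! q' n = U'" "Us ! q' (Suc n) = V'"
    using permute_list_nth[OF q(1), of n] permute_list_nth[OF q(1), of "Suc n"]
      permute_list_nth[OF q(2), of n] permute_list_nth[OF q(2), of "Suc n"] n
    by (auto simp: e e' n_def nth_append)
  \<comment> \<open>only one part contains \<open>u\<close> and only one contains \<open>v\<close>, so \<open>r\<close> fixes the last two positions\<close>
  have "q' n = q n" "q' (Suc n) = q (Suc n)"
    using dis[of "q' n" "q n" u] dis[of "q' (Suc n)" "q (Suc n)" v] nth e(2,3) e'(2,3) n
      permutes_in_image[OF q(1), of n] permutes_in_image[OF q(1), of "Suc n"]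
      permutes_in_image[OF q(2), of n] permutes_in_image[OF q(2), of "Suc n"] by auto
  then have "r n = n" "r (Suc n) = Suc n"
    by (simp_all add: r_def permutes_inverses(2)[OF q(1)])
  then have rn: "r permutes {..<n}"
    using n by (intro permutes_superset[OF r]) (auto simp: less_Suc_eq)
  then have rRs: "r permutes {..<length Rs}" by (simp add: n_def)
  have rds: "r permutes {..<length ds}" using rRs e(5) by simp
  have "permute_list q' Us = permute_list r Rs @ [U, V]"
    using permute_list_compose[OF r, of q] permute_list_append_fixed[OF rRs, of "[U, V]"] by (simp add: qr e)
  moreover have "permute_list q' cs = permute_list r ds @ [a, b]"
    using permute_list_compose[of r cs q] permute_list_append_fixed[OF rds, of "[a, b]"] r
      powers_index_length[OF assms(3)] by (simp add: qr e)
  ultimately have eq: "glue_sets u v (permute_list q' Us) = permute_list r (glue_sets u v (permute_list q Us))"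
    "glue u v (permute_list q' Us) (permute_list q' cs) = permute_list r (glue u v (permute_list q Us) (permute_list q cs))"
    using e(5) permute_list_append_fixed[OF rRs] permute_list_append_fixed[OF rds] by (simp_all add: e)
  have "r permutes {..<length (glue_sets u v (permute_list q Us))}"
    by (rule permutes_subset[OF rRs]) (auto simp: e)
  note cls = powers_class_permute[OF X' glue_index[OF assms(1,3)] this, of \<epsilon>]
  have perm: "permutation q" "permutation r" using q(1) r by (auto simp: permutation_permutes)
  show ?thesis
    using powers_class_closed[OF X' glue_index[OF assms(1,3)]] unfolding contract_at_def eq cls
    by (simp add: qr sgn_char_comp[OF perm] P.smult_assoc1[symmetric] m_assoc)
qed

lemma contract_value_eq:
  assumes "to_end u v Us q" "(Us, cs) \<in> powers_index C X" "\<not> (\<exists>U\<in>set Us. u \<in> U \<and> v \<in> U)"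
  shows "contract_value \<epsilon> X u v Us cs = contract_at \<epsilon> X u v q Us cs"
  unfolding contract_value_def
  using to_end_unique[OF someI[of "to_end u v Us", OF assms(1)] assms(1,2)] assms(3) by auto

lemma glue_multilin:
  assumes UV: "finite U" "finite V" "U \<inter> V = {}" "u \<in> U" "v \<in> V"
    and \<psi>: "multilin (map (space C) (Rs @ [(U - {u}) \<union> (V - {v})])) W \<psi>"
  shows "multilin (map (space C) (Rs @ [U, V])) W (\<lambda>cs. \<psi> (glue u v (Rs @ [U, V]) cs))"
proof -
  let ?n = "length Rs" and ?W = "(U - {u}) \<union> (V - {v})"
  let ?Vs = "map (space C) (Rs @ [U, V])" and ?Ws = "map (space C) (Rs @ [?W])"
  have split: "\<exists>ds a b. cs = ds @ [a, b] \<and> length ds = ?n \<and> ds \<in> tuples (map (space C) Rs) \<and>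
      a \<in> carrier (space C U) \<and> b \<in> carrier (space C V)" if "cs \<in> tuples ?Vs" for cs
    using that by (auto simp: tuples_def list_all2_append2 list_all2_Cons2 dest: list_all2_lengthD)
  have t: "ds @ [comp U u V v a b] \<in> tuples ?Ws"
    if "ds \<in> tuples (map (space C) Rs)" "a \<in> carrier (space C U)" "b \<in> carrier (space C V)" for ds a b
    using that comp_closed[OF UV] by (auto simp: tuples_def intro!: list_all2_appendI)
  show ?thesis
  proof (rule multilinI)
    fix cs assume "cs \<in> tuples ?Vs"
    then show "\<psi> (glue u v (Rs @ [U, V]) cs) \<in> carrier W"
      using split[of cs] t multilinD(1)[OF \<psi>] by fastforce
  next
    fix cs i x y
    assume cs: "cs \<in> tuples ?Vs" and i: "i < length ?Vs"
      and x: "x \<in> carrier (?Vs ! i)" and y: "y \<in> carrier (?Vs ! i)"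
    obtain ds a b where ds: "cs = ds @ [a, b]" "length ds = ?n" "ds \<in> tuples (map (space C) Rs)"
      "a \<in> carrier (space C U)" "b \<in> carrier (space C V)" using split[OF cs] by blast
    note t' = t[OF ds(3-5)]
    consider "i < ?n" | "i = ?n" | "i = Suc ?n" using i by fastforce
    then show "\<psi> (glue u v (Rs @ [U, V]) (cs[i := x \<oplus>\<^bsub>?Vs ! i\<^esub> y])) =
        \<psi> (glue u v (Rs @ [U, V]) (cs[i := x])) \<oplus>\<^bsub>W\<^esub> \<psi> (glue u v (Rs @ [U, V]) (cs[i := y]))"
    proof cases
      case 1
      then show ?thesis
        using multilinD(2)[OF \<psi> t', of i x y] x y ds(2) by (simp add: ds(1) list_update_append nth_append)
    next
      case 2
      then show ?thesis
        using multilinD(2)[OF \<psi> t', of i "comp U u V v x b" "comp U u V v y b"] x y ds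
          lin_mapsD[OF comp_lin_left[OF UV, of b]] by (simp add: list_update_append nth_append)
    next
      case 3
      then show ?thesis
        using multilinD(2)[OF \<psi> t', of ?n "comp U u V v a x" "comp U u V v a y"] x y ds
          lin_mapsD[OF comp_lin_right[OF UV, of a]] by (simp add: list_update_append nth_append)
    qed
  next
    fix cs i r x
    assume cs: "cs \<in> tuples ?Vs" and i: "i < length ?Vs" and r: "r \<in> carrier K"
      and x: "x \<in> carrier (?Vs ! i)"
    obtain ds a b where ds: "cs = ds @ [a, b]" "length ds = ?n" "ds \<in> tuples (map (space C) Rs)"
      "a \<in> carrier (space C U)" "b \<in> carrier (space C V)" using split[OF cs] by blast
    note t' = t[OF ds(3-5)]
    consider "i < ?n" | "i = ?n" | "i = Suc ?n" using i by fastforce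
    then show "\<psi> (glue u v (Rs @ [U, V]) (cs[i := r \<odot>\<^bsub>?Vs ! i\<^esub> x])) =
        r \<odot>\<^bsub>W\<^esub> \<psi> (glue u v (Rs @ [U, V]) (cs[i := x]))"
    proof cases
      case 1
      then show ?thesis
        using multilinD(3)[OF \<psi> t', of i r x] r x ds(2) by (simp add: ds(1) list_update_append nth_append)
    next
      case 2
      then show ?thesis
        using multilinD(3)[OF \<psi> t', of i r "comp U u V v x b"] r x ds
          lin_mapsD[OF comp_lin_left[OF UV, of b]] by (simp add: list_update_append nth_append)
    next
      case 3
      then show ?thesis
        using multilinD(3)[OF \<psi> t', of ?n r "comp U u V v a x"] r x ds
          lin_mapsD[OF comp_lin_right[OF UV, of a]] by (simp add: list_update_append nth_append)
    qed
  qed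
qed

lemma contract_at_multilin:
  assumes Us: "Us \<in> decomps (length Us) X" and q: "to_end u v Us q"
  shows "multilin (map (space C) Us) (powers_space K \<epsilon> C (X - {u, v})) (contract_at \<epsilon> X u v q Us)"
proof -
  have X': "finite (X - {u, v})" using X by simp
  obtain Rs U V where q: "q permutes {..<length Us}" "permute_list q Us = Rs @ [U, V]" "u \<in> U" "v \<in> V"
    using q unfolding to_end_def by blast
  let ?P = "powers_space K \<epsilon> C (X - {u, v})"
  let ?W = "(U - {u}) \<union> (V - {v})"
  have "Rs @ [U, V] \<in> decomps (length (Rs @ [U, V])) X"
    using decomps_permute[OF Us q(1)] length_permute_list[of q Us] q(2) by metis
  then have *: "\<Union>(set Rs) \<union> U \<union> V = X" "U \<inter> V = {}"
     "sorted_wrt (\<lambda>A B. A \<inter> B = {}) Rs" "\<And>R. R \<in> set Rs \<Longrightarrow> R \<inter> U = {} \<and> R \<inter> V = {}"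
    unfolding decomps_iff by (auto simp: sorted_wrt_append)
  have fin: "finite U" "finite V" using *(1) X by (auto intro: finite_subset)
  have "\<Union>(set Rs) \<union> ?W = X - {u, v}" using * q by blast
  moreover have "R \<inter> ?W = {}" if "R \<in> set Rs" for R using *(4)[OF that] by blast
  ultimately have dec: "Rs @ [?W] \<in> decomps (length (Rs @ [?W])) (X - {u, v})"
    unfolding decomps_iff using *(3) by (simp add: sorted_wrt_append Un_commute)
  have "multilin (map (space C) (Rs @ [?W])) ?P
      (\<lambda>cs. sgn_char K \<epsilon> q \<odot>\<^bsub>?P\<^esub> powers_class K \<epsilon> C (X - {u, v}) (Rs @ [?W]) cs)"
    by (rule multilin_lin[OF powers_class_multilin[OF X' dec] lin_smult_map[OF vspace_powers[OF X'] lin_ident sgn_char_closed]])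
      (rule decomps_vspace[OF X' dec])
  from glue_multilin[OF fin *(2) q(3,4) this]
  show ?thesis
    unfolding contract_at_def q(2)[symmetric] by (intro multilin_permute q) (simp add: q)
qed

lemma contract_value_multilin:
  assumes Us: "Us \<in> decomps (length Us) X"
  shows "multilin (map (space C) Us) (powers_space K \<epsilon> C (X - {u, v})) (contract_value \<epsilon> X u v Us)"
proof (cases "\<exists>U\<in>set Us. u \<in> U \<and> v \<in> U")
  case True
  have X': "finite (X - {u, v})" using X by simp
  interpret P: Module.module K "powers_space K \<epsilon> C (X - {u, v})" by (rule vspace_powers[OF X'])
  show ?thesis using True by (auto simp: contract_value_def[abs_def] intro!: multilinI)
next
  case False
  have "\<Union>(set Us) = X" using Us by (simp add: decomps_iff)
  from ex_to_end[OF this False] have "to_end u v Us (SOME q. to_end u v Us q)" by (rule someI_ex)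
  note * = contract_at_multilin[OF Us this]
  have "contract_value \<epsilon> X u v Us = contract_at \<epsilon> X u v (SOME q. to_end u v Us q) Us"
    using False by (intro ext) (auto simp: contract_value_def)
  then show ?thesis using * by simp
qed

lemma contract_value_permute:
  assumes idx: "(Us, cs) \<in> powers_index C X" and p: "p permutes {..<length Us}"
  shows "contract_value \<epsilon> X u v (permute_list p Us) (permute_list p cs) =
    sgn_char K \<epsilon> p \<odot>\<^bsub>powers_space K \<epsilon> C (X - {u, v})\<^esub> contract_value \<epsilon> X u v Us cs"
proof -
  have X': "finite (X - {u, v})" using X by simp
  interpret P: Module.module K "powers_space K \<epsilon> C (X - {u, v})" by (rule vspace_powers[OF X'])
  show ?thesis
  proof (cases "\<exists>U\<in>set Us. u \<in> U \<and> v \<in> U")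
    case True
    then show ?thesis using p by (simp add: contract_value_def)
  next
    case False
    let ?Us = "permute_list p Us" and ?cs = "permute_list p cs"
    note idx' = powers_index_permute[OF idx p]
    have F: "\<not> (\<exists>U\<in>set ?Us. u \<in> U \<and> v \<in> U)" using False p by simp
    have "\<Union>(set ?Us) = X" using idx' by (simp add: powers_index_iff)
    from ex_to_end[OF this F] obtain q where q: "to_end u v ?Us q" ..
    then have qp: "q permutes {..<length Us}" by (simp add: to_end_def)
    have comp: "permute_list (p \<circ> q) Us = permute_list q ?Us" "permute_list (p \<circ> q) cs = permute_list q ?cs"
      using permute_list_compose[of q Us p] permute_list_compose[of q cs p] qp powers_index_length[OF idx] by auto
    have pq: "to_end u v Us (p \<circ> q)"
      using q permutes_compose[OF qp p] unfolding to_end_def comp by simp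
    have perm: "permutation p" "permutation q" using p qp by (auto simp: permutation_permutes)
    show ?thesis
      using powers_class_closed[OF X' glue_index[OF q idx']]
      unfolding contract_value_eq[OF q idx' F] contract_value_eq[OF pq idx False] contract_at_def comp
      by (simp add: sgn_char_comp[OF perm] P.smult_assoc1[symmetric] m_assoc[symmetric])
  qed
qed

lemma contract_lin: "contract \<epsilon> X u v \<in> lin_maps K (powers_space K \<epsilon> C X) (powers_space K \<epsilon> C (X - {u, v}))"
  unfolding contract_def
  by (rule powers_map_of_lin[OF X]) (auto intro: X vspace_powers contract_value_multilin contract_value_permute)

lemma contract_class:
  assumes "(Us, cs) \<in> powers_index C X"
  shows "contract \<epsilon> X u v (powers_class K \<epsilon> C X Us cs) = contract_value \<epsilon> X u v Us cs"
  unfolding contract_def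
  by (rule powers_map_of_class[OF X])
    (use assms in \<open>auto intro: X vspace_powers contract_value_multilin contract_value_permute\<close>)

lemma contract_same:
  assumes "(Us, cs) \<in> powers_index C X" "U \<in> set Us" "u \<in> U" "v \<in> U"
  shows "contract \<epsilon> X u v (powers_class K \<epsilon> C X Us cs) = \<zero>\<^bsub>powers_space K \<epsilon> C (X - {u, v})\<^esub>"
  using assms by (auto simp: contract_class contract_value_def)

lemma contract_glue:
  assumes idx: "(Rs @ [U, V], ds @ [a, b]) \<in> powers_index C X" and UV: "u \<in> U" "v \<in> V"
  shows "contract \<epsilon> X u v (powers_class K \<epsilon> C X (Rs @ [U, V]) (ds @ [a, b])) =
    powers_class K \<epsilon> C (X - {u, v}) (Rs @ [(U - {u}) \<union> (V - {v})]) (ds @ [comp U u V v a b])"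
proof -
  have X': "finite (X - {u, v})" using X by simp
  interpret P: Module.module K "powers_space K \<epsilon> C (X - {u, v})" by (rule vspace_powers[OF X'])
  have len: "length ds = length Rs" using powers_index_length[OF idx] by simp
  have id: "to_end u v (Rs @ [U, V]) id" using UV by (auto simp: to_end_def permutes_id)
  have "U \<inter> V = {}" "\<And>R. R \<in> set Rs \<Longrightarrow> R \<inter> U = {} \<and> R \<inter> V = {}"
    using idx by (auto simp: powers_index_iff sorted_wrt_append)
  then have F: "\<not> (\<exists>U\<in>set (Rs @ [U, V]). u \<in> U \<and> v \<in> U)" using UV by auto
  show ?thesis
    using powers_class_closed[OF X' index_glue[OF X idx UV]] len
    by (simp add: contract_class[OF idx] contract_value_eq[OF id idx F] contract_at_def sgn_char_def)
qed

end

end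

section \<open>Relations between contractions\<close>

context operad begin

lemma part_of:
  assumes "(Us, cs) \<in> powers_index C X" "x \<in> X"
  obtains U where "U \<in> set Us" "x \<in> U"
  using assms by (auto simp: powers_index_iff)

lemma part_unique:
  assumes "(Us, cs) \<in> powers_index C X" "U \<in> set Us" "V \<in> set Us" "x \<in> U" "x \<in> V"
  shows "U = V"
proof -
  obtain i j where ij: "i < length Us" "j < length Us" "U = Us ! i" "V = Us ! j"
    using assms(2,3) by (auto simp: in_set_conv_nth)
  then show ?thesis using assms(1,4,5) by (cases "i = j") (auto simp: powers_index_def decomps_def)
qed

text \<open>
  The exchange of \<open>u\<close> and \<open>v\<close> amounts to the exchange of the two factors that are composed; the
  composition itself is symmetric.
\<close>

lemma contract_flip:
  assumes X: "finite X" "u \<in> X" "v \<in> X" "u \<noteq> v" and x: "x \<in> carrier (powers_space K \<epsilon> C X)"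
  shows "contract \<epsilon> X v u x = psign \<epsilon> \<odot>\<^bsub>powers_space K \<epsilon> C (X - {u, v})\<^esub> contract \<epsilon> X u v x"
proof -
  have X': "finite (X - {u, v})" using X by simp
  interpret P: Module.module K "powers_space K \<epsilon> C (X - {u, v})" by (rule vspace_powers[OF X'])
  have com: "X - {v, u} = X - {u, v}" by auto
  define Q where "Q = (\<lambda>Ws. (\<exists>U. Ws = [U] \<and> u \<in> U \<and> v \<in> U) \<or> (\<exists>U V. Ws = [U, V] \<and> u \<in> U \<and> v \<in> V))"
  show ?thesis
  proof (rule powers_eq_normalizedI[where P = Q, OF X(1) vspace_powers[OF X']
        contract_lin[OF X(1,3,2) X(4)[symmetric], unfolded com]
        lin_smult_map[OF vspace_powers[OF X'] contract_lin[OF X] psign_simps(1)] _ _ x])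
    fix Us assume "\<Union>(set Us) = X"
    then obtain U V where "U \<in> set Us" "u \<in> U" "V \<in> set Us" "v \<in> V" using X by blast
    then show "\<exists>Ws. distinct Ws \<and> set Ws \<subseteq> set Us \<and> Q Ws"
      by (cases "U = V") (auto simp: Q_def intro: exI[of _ "[U]"] exI[of _ "[U, V]"])
  next
    fix Rs Ws ds es
    assume *: "Q Ws" "(Rs @ Ws, ds @ es) \<in> powers_index C X" "length ds = length Rs" "length es = length Ws"
    from *(1) consider (same) U where "Ws = [U]" "u \<in> U" "v \<in> U"
      | (diff) U V where "Ws = [U, V]" "u \<in> U" "v \<in> V" by (auto simp: Q_def)
    then show "contract \<epsilon> X v u (powers_class K \<epsilon> C X (Rs @ Ws) (ds @ es)) =
      psign \<epsilon> \<odot>\<^bsub>powers_space K \<epsilon> C (X - {u, v})\<^esub> contract \<epsilon> X u v (powers_class K \<epsilon> C X (Rs @ Ws) (ds @ es))"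
    proof cases
      case same
      then show ?thesis
        using contract_same[OF X *(2), of U] contract_same[OF X(1,3,2) X(4)[symmetric] *(2), of U] com by simp
    next
      case diff
      obtain a b where es: "es = [a, b]" using *(4) diff(1) by (auto simp: length_Suc_conv)
      note idx = *(2)[unfolded diff(1) es]
      note idx' = index_swap[OF idx *(3)]
      have fin: "finite U" "finite V" and dis: "U \<inter> V = {}"
        and ab: "a \<in> carrier (space C U)" "b \<in> carrier (space C V)"
        using idx X(1) *(3) by (auto simp: powers_index_iff sorted_wrt_append list_all2_append intro: finite_subset)
      have "powers_class K \<epsilon> C X (Rs @ [U, V]) (ds @ [a, b]) =
          psign \<epsilon> \<odot>\<^bsub>powers_space K \<epsilon> C X\<^esub> powers_class K \<epsilon> C X (Rs @ [V, U]) (ds @ [b, a])"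
        using class_swap[OF X(1) idx' *(3)] .
      then have "contract \<epsilon> X v u (powers_class K \<epsilon> C X (Rs @ [U, V]) (ds @ [a, b])) =
          psign \<epsilon> \<odot>\<^bsub>powers_space K \<epsilon> C (X - {v, u})\<^esub>
            powers_class K \<epsilon> C (X - {v, u}) (Rs @ [(V - {v}) \<union> (U - {u})]) (ds @ [comp V v U u b a])"
        using lin_smult[OF contract_lin[OF X(1,3,2) X(4)[symmetric]]] powers_class_closed[OF X(1) idx']
          contract_glue[OF X(1,3,2) X(4)[symmetric] idx' diff(3,2)] by simp
      also have "comp V v U u b a = comp U u V v a b"
        using compo_sym[OF fin dis diff(2,3) ab] by simp
      finally show ?thesis
        using contract_glue[OF X idx diff(2,3)] by (simp add: diff(1) es com Un_commute)
    qed
  qed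
qed

text \<open>
  The first contraction merges the factors with the labels \<open>u\<close> and \<open>v\<close>, so that afterwards a
  single factor carries both \<open>w\<close> and \<open>z\<close>.
\<close>

lemma contract_contract_zero:
  assumes X: "finite X" "{u, v, w, z} \<subseteq> X" "distinct [u, v, w, z]" and idx: "(Us, cs) \<in> powers_index C X"
    and parts: "(\<exists>U\<in>set Us. w \<in> U \<and> z \<in> U) \<or> (\<exists>A\<in>set Us. \<exists>B\<in>set Us. u \<in> A \<and> v \<in> B \<and> w \<in> A \<union> B \<and> z \<in> A \<union> B)"
  shows "contract \<epsilon> (X - {u, v}) w z (contract \<epsilon> X u v (powers_class K \<epsilon> C X Us cs)) =
    \<zero>\<^bsub>powers_space K \<epsilon> C (X - {u, v} - {w, z})\<^esub>"
proof -
  have X': "finite (X - {u, v})" "finite (X - {u, v} - {w, z})" using X(1) by auto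
  have uv: "u \<in> X" "v \<in> X" "u \<noteq> v" using X(2,3) by auto
  have wz: "w \<in> X - {u, v}" "z \<in> X - {u, v}" "w \<noteq> z" using X(2,3) by auto
  interpret P: Module.module K "powers_space K \<epsilon> C (X - {u, v} - {w, z})" by (rule vspace_powers[OF X'(2)])
  note lin = contract_lin[OF X'(1) wz]
  obtain A where A: "A \<in> set Us" "u \<in> A" using part_of[OF idx uv(1)] .
  obtain B where B: "B \<in> set Us" "v \<in> B" using part_of[OF idx uv(2)] .
  show ?thesis
  proof (cases "A = B")
    case True
    then show ?thesis
      using contract_same[OF X(1) uv idx A B(2)[folded True]]
        lin_zero[OF vspace_powers[OF X'(1)] vspace_powers[OF X'(2)] lin] by simp
  next
    case False
    have d: "distinct [A, B]" "set [A, B] \<subseteq> set Us" using A B False by auto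
    obtain q Rs ds es where n: "q permutes {..<length Us}" "permute_list q Us = Rs @ [A, B]"
      "length ds = length Rs" "length es = length [A, B]" "(Rs @ [A, B], ds @ es) \<in> powers_index C X"
      "powers_class K \<epsilon> C X Us cs = sgn_char K \<epsilon> q \<odot>\<^bsub>powers_space K \<epsilon> C X\<^esub> powers_class K \<epsilon> C X (Rs @ [A, B]) (ds @ es)"
      by (rule class_normalize[OF X(1) idx d])
    obtain a b where es: "es = [a, b]" using n(4) by (auto simp: length_Suc_conv)
    note idx' = n(5)[unfolded es]
    have set: "set Us = set Rs \<union> {A, B}" using set_permute_list[OF n(1)] n(2) by auto
    let ?W = "(A - {u}) \<union> (B - {v})"
    have W: "x \<in> ?W" if "x \<in> A \<union> B" "x \<in> {w, z}" for x using that wz by auto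
    have "\<exists>U\<in>set (Rs @ [?W]). w \<in> U \<and> z \<in> U"
      using parts
    proof
      assume "\<exists>U\<in>set Us. w \<in> U \<and> z \<in> U"
      then obtain U where U: "U \<in> set Us" "w \<in> U" "z \<in> U" by blast
      show ?thesis
      proof (cases "U \<in> set Rs")
        case True
        then show ?thesis using U by auto
      next
        case False
        then have "w \<in> ?W" "z \<in> ?W" using set U W by blast+
        then show ?thesis by simp
      qed
    next
      assume "\<exists>A\<in>set Us. \<exists>B\<in>set Us. u \<in> A \<and> v \<in> B \<and> w \<in> A \<union> B \<and> z \<in> A \<union> B"
      then obtain A' B' where AB: "A' \<in> set Us" "B' \<in> set Us" "u \<in> A'" "v \<in> B'"
        "w \<in> A' \<union> B'" "z \<in> A' \<union> B'" by blast
      then have "A' = A" "B' = B" using part_unique[OF idx] A B by blast+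
      then have "w \<in> ?W" "z \<in> ?W" using W AB(5,6) by blast+
      then show ?thesis by simp
    qed
    then obtain U where "U \<in> set (Rs @ [?W])" "w \<in> U" "z \<in> U" by blast
    from contract_same[OF X'(1) wz index_glue[OF X(1) idx' A(2) B(2)] this]
    show ?thesis
      using lin_smult[OF contract_lin[OF X(1) uv] sgn_char_closed powers_class_closed[OF X(1) idx']]
        lin_smult[OF lin sgn_char_closed powers_class_closed[OF X'(1) index_glue[OF X(1) idx' A(2) B(2)]]]
      by (simp add: n(6) es contract_glue[OF X(1) uv idx' A(2) B(2)])
  qed
qed

definition contracts_commute :: "parity \<Rightarrow> 'a set \<Rightarrow> 'a \<Rightarrow> 'a \<Rightarrow> 'a \<Rightarrow> 'a \<Rightarrow> ('a, 'k, 'v) powers \<Rightarrow> bool" where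
  "contracts_commute \<epsilon> X u v w z x \<longleftrightarrow>
     contract \<epsilon> (X - {u, v}) w z (contract \<epsilon> X u v x) =
     psign \<epsilon> \<odot>\<^bsub>powers_space K \<epsilon> C (X - {u, v} - {w, z})\<^esub> contract \<epsilon> (X - {w, z}) u v (contract \<epsilon> X w z x)"

context
  fixes X :: "'a set" and u v w z :: 'a
  assumes X: "finite X" "{u, v, w, z} \<subseteq> X" "distinct [u, v, w, z]"
begin

lemma contract2_lin:
  "(\<lambda>x. contract \<epsilon> (X - {u, v}) w z (contract \<epsilon> X u v x)) \<in>
     lin_maps K (powers_space K \<epsilon> C X) (powers_space K \<epsilon> C (X - {u, v} - {w, z}))"
  using X by (intro lin_comp[OF contract_lin contract_lin]) auto

lemma contract2_lin':
  "(\<lambda>x. psign \<epsilon> \<odot>\<^bsub>powers_space K \<epsilon> C (X - {u, v} - {w, z})\<^esub> contract \<epsilon> (X - {w, z}) u v (contract \<epsilon> X w z x)) \<in>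
     lin_maps K (powers_space K \<epsilon> C X) (powers_space K \<epsilon> C (X - {u, v} - {w, z}))"
proof -
  have com: "X - {u, v} - {w, z} = X - {w, z} - {u, v}" by auto
  have "(\<lambda>x. contract \<epsilon> (X - {w, z}) u v (contract \<epsilon> X w z x)) \<in>
     lin_maps K (powers_space K \<epsilon> C X) (powers_space K \<epsilon> C (X - {u, v} - {w, z}))"
    unfolding com using X by (intro lin_comp[OF contract_lin contract_lin]) auto
  then show ?thesis using X by (intro lin_smult_map vspace_powers) auto
qed

lemma contracts_commute_smult:
  assumes "contracts_commute \<epsilon> X u v w z x" "a \<in> carrier K" "x \<in> carrier (powers_space K \<epsilon> C X)"
  shows "contracts_commute \<epsilon> X u v w z (a \<odot>\<^bsub>powers_space K \<epsilon> C X\<^esub> x)"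
  using assms(1) lin_smult[OF contract2_lin assms(2,3)] lin_smult[OF contract2_lin' assms(2,3)]
  unfolding contracts_commute_def by simp

text \<open>
  These symmetries leave, for two pairs with exactly one factor in common, only the case that this
  factor carries \<open>v\<close> and \<open>w\<close>.
\<close>

lemma contracts_commute_flip:
  assumes x: "x \<in> carrier (powers_space K \<epsilon> C X)" and c: "contracts_commute \<epsilon> X u v w z x"
  shows "contracts_commute \<epsilon> X v u w z x" and "contracts_commute \<epsilon> X u v z w x"
    and "contracts_commute \<epsilon> X w z u v x"
proof -
  have com: "X - {w, z} - {u, v} = X - {u, v} - {w, z}" "X - {v, u} = X - {u, v}" "X - {z, w} = X - {w, z}"
    "X - {v, u} - {w, z} = X - {u, v} - {w, z}" "X - {u, v} - {z, w} = X - {u, v} - {w, z}" by auto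
  have fin: "finite (X - {u, v})" "finite (X - {w, z})" "finite (X - {u, v} - {w, z})" using X by auto
  let ?P = "powers_space K \<epsilon> C (X - {u, v} - {w, z})"
  interpret P: Module.module K ?P by (rule vspace_powers[OF fin(3)])
  have d: "u \<in> X" "v \<in> X" "u \<noteq> v" "w \<in> X" "z \<in> X" "w \<noteq> z"
    "u \<in> X - {w, z}" "v \<in> X - {w, z}" "w \<in> X - {u, v}" "z \<in> X - {u, v}" using X by auto
  note lin = contract_lin[OF X(1) d(1-3), of \<epsilon>] contract_lin[OF X(1) d(4-6), of \<epsilon>]
    contract_lin[OF fin(1) d(9,10,6), of \<epsilon>] contract_lin[OF fin(2) d(7,8,3), of \<epsilon>, unfolded com]
  have cl: "contract \<epsilon> X u v x \<in> carrier (powers_space K \<epsilon> C (X - {u, v}))"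
    "contract \<epsilon> X w z x \<in> carrier (powers_space K \<epsilon> C (X - {w, z}))"
    by (rule lin_closed[OF lin(1) x], rule lin_closed[OF lin(2) x])
  note cl2 = lin_closed[OF lin(3) cl(1)] lin_closed[OF lin(4) cl(2)]
  note fl = contract_flip[OF X(1) d(1-3) x] contract_flip[OF X(1) d(4-6) x]
    contract_flip[OF fin(1) d(9,10,6) cl(1)] contract_flip[OF fin(2) d(7,8,3) cl(2), unfolded com]
  note c = c[unfolded contracts_commute_def]
  show "contracts_commute \<epsilon> X v u w z x"
    unfolding contracts_commute_def com fl
    using c lin_smult[OF lin(3) psign_simps(1) cl(1)] cl2 by simp
  show "contracts_commute \<epsilon> X u v z w x"
    unfolding contracts_commute_def com fl
    using c lin_smult[OF lin(4) psign_simps(1) cl(2)] cl2 by simp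
  show "contracts_commute \<epsilon> X w z u v x"
    unfolding contracts_commute_def com c
    using psign_smult[OF vspace_powers[OF fin(3)]] cl2 by simp
qed

text \<open>
  Both orders compose along the path from \<open>A\<close> through \<open>B\<close> to \<open>D\<close>, and associativity identifies the
  results. If \<open>A\<close> and \<open>B\<close> are composed first, then \<open>D\<close> has to be moved past one factor more, which
  is where the sign arises.
\<close>

lemma contracts_commute_path:
  assumes idx: "(Rs @ [A, B, D], ds @ [a, b, d]) \<in> powers_index C X" and len: "length ds = length Rs"
    and el: "u \<in> A" "v \<in> B" "w \<in> B" "z \<in> D"
  shows "contracts_commute \<epsilon> X u v w z (powers_class K \<epsilon> C X (Rs @ [A, B, D]) (ds @ [a, b, d]))"
proof -
  have fin: "finite (X - {u, v})" "finite (X - {w, z})" "finite (X - {u, v} - {w, z})" using X by auto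
  have d: "u \<in> X" "v \<in> X" "u \<noteq> v" "w \<in> X" "z \<in> X" "w \<noteq> z" "w \<noteq> v"
    "u \<in> X - {w, z}" "v \<in> X - {w, z}" "w \<in> X - {u, v}" "z \<in> X - {u, v}" using X by auto
  have dis: "A \<inter> B = {}" "A \<inter> D = {}" "B \<inter> D = {}" and f: "finite A" "finite B" "finite D"
    and abd: "a \<in> carrier (space C A)" "b \<in> carrier (space C B)" "d \<in> carrier (space C D)"
    using idx X(1) len by (auto simp: powers_index_iff sorted_wrt_append list_all2_append intro: finite_subset)
  define AB where "AB = (A - {u}) \<union> (B - {v})"
  define BD where "BD = (B - {w}) \<union> (D - {z})"
  have el': "w \<in> AB" "v \<in> BD" using el d by (auto simp: AB_def BD_def)
  have un: "(AB - {w}) \<union> (D - {z}) = (A - {u}) \<union> (BD - {v})"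
    using dis el by (auto simp: AB_def BD_def)
  have com: "X - {w, z} - {u, v} = X - {u, v} - {w, z}" by auto
  have i1: "(Rs @ [D, A, B], ds @ [d, a, b]) \<in> powers_index C X"
    using index_rotate[OF index_rotate[OF idx len] len] .
  then have i1': "((Rs @ [D]) @ [A, B], (ds @ [d]) @ [a, b]) \<in> powers_index C X" by simp
  have i2: "((Rs @ [A]) @ [B, D], (ds @ [a]) @ [b, d]) \<in> powers_index C X" using idx by simp
  have i3: "(Rs @ [D, AB], ds @ [d, comp A u B v a b]) \<in> powers_index C (X - {u, v})"
    using index_glue[OF X(1) i1' el(1,2)] by (simp add: AB_def)
  have i4: "(Rs @ [AB, D], ds @ [comp A u B v a b, d]) \<in> powers_index C (X - {u, v})"
    using index_swap[OF i3 len] .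
  have i5: "(Rs @ [A, BD], ds @ [a, comp B w D z b d]) \<in> powers_index C (X - {w, z})"
    using index_glue[OF X(1) i2 el(3,4)] by (simp add: BD_def)
  have "contract \<epsilon> X u v (powers_class K \<epsilon> C X (Rs @ [A, B, D]) (ds @ [a, b, d])) =
      contract \<epsilon> X u v (powers_class K \<epsilon> C X ((Rs @ [D]) @ [A, B]) ((ds @ [d]) @ [a, b]))"
    using class_rotate[OF X(1) i1 len] by simp
  also have "\<dots> = powers_class K \<epsilon> C (X - {u, v}) (Rs @ [D, AB]) (ds @ [d, comp A u B v a b])"
    using contract_glue[OF X(1) d(1-3) i1' el(1,2)] by (simp add: AB_def)
  also have "\<dots> = psign \<epsilon> \<odot>\<^bsub>powers_space K \<epsilon> C (X - {u, v})\<^esub>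
      powers_class K \<epsilon> C (X - {u, v}) (Rs @ [AB, D]) (ds @ [comp A u B v a b, d])"
    using class_swap[OF fin(1) i4 len] .
  finally have "contract \<epsilon> (X - {u, v}) w z (contract \<epsilon> X u v (powers_class K \<epsilon> C X (Rs @ [A, B, D]) (ds @ [a, b, d]))) =
      psign \<epsilon> \<odot>\<^bsub>powers_space K \<epsilon> C (X - {u, v} - {w, z})\<^esub> powers_class K \<epsilon> C (X - {u, v} - {w, z})
        (Rs @ [(AB - {w}) \<union> (D - {z})]) (ds @ [comp AB w D z (comp A u B v a b) d])"
    using lin_smult[OF contract_lin[OF fin(1) d(10,11,6)] psign_simps(1) powers_class_closed[OF fin(1) i4]]
      contract_glue[OF fin(1) d(10,11,6) i4 el'(1) el(4)] by simp
  also have "comp AB w D z (comp A u B v a b) d = comp A u BD v a (comp B w D z b d)"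
    unfolding AB_def BD_def using compo_assoc[OF f dis el(1-3) d(7)[symmetric] el(4) abd] .
  also have "powers_class K \<epsilon> C (X - {u, v} - {w, z}) (Rs @ [(AB - {w}) \<union> (D - {z})]) (ds @ [comp A u BD v a (comp B w D z b d)]) =
      contract \<epsilon> (X - {w, z}) u v (powers_class K \<epsilon> C (X - {w, z}) (Rs @ [A, BD]) (ds @ [a, comp B w D z b d]))"
    using contract_glue[OF fin(2) d(8,9,3) i5 el(1) el'(2)] by (simp add: un com)
  also have "powers_class K \<epsilon> C (X - {w, z}) (Rs @ [A, BD]) (ds @ [a, comp B w D z b d]) =
      contract \<epsilon> X w z (powers_class K \<epsilon> C X (Rs @ [A, B, D]) (ds @ [a, b, d]))"
    using contract_glue[OF X(1) d(4-6) i2 el(3,4)] by (simp add: BD_def)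
  finally show ?thesis unfolding contracts_commute_def .
qed

text \<open>
  The two compositions do not interact. The composite that is formed last stands last, so the two
  orders differ by the exchange of two factors.
\<close>

lemma contracts_commute_disjoint:
  assumes idx: "(Rs @ [A, B, E, D], ds @ [a, b, e, d]) \<in> powers_index C X" and len: "length ds = length Rs"
    and el: "u \<in> A" "v \<in> B" "w \<in> E" "z \<in> D"
  shows "contracts_commute \<epsilon> X u v w z (powers_class K \<epsilon> C X (Rs @ [A, B, E, D]) (ds @ [a, b, e, d]))"
proof -
  have fin: "finite (X - {u, v})" "finite (X - {w, z})" "finite (X - {u, v} - {w, z})" using X by auto
  have d: "u \<in> X" "v \<in> X" "u \<noteq> v" "w \<in> X" "z \<in> X" "w \<noteq> z"
    "u \<in> X - {w, z}" "v \<in> X - {w, z}" "w \<in> X - {u, v}" "z \<in> X - {u, v}" using X by auto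
  define AB ab where "AB = (A - {u}) \<union> (B - {v})" and "ab = comp A u B v a b"
  define ED ed where "ED = (E - {w}) \<union> (D - {z})" and "ed = comp E w D z e d"
  have com: "X - {w, z} - {u, v} = X - {u, v} - {w, z}" by auto
  have idx': "((Rs @ [A]) @ [B, E, D], (ds @ [a]) @ [b, e, d]) \<in> powers_index C X"
    and idx'': "((Rs @ [A, B]) @ [E, D], (ds @ [a, b]) @ [e, d]) \<in> powers_index C X" using idx by simp_all
  have i1: "(Rs @ A # E # D # [B], ds @ a # e # d # [b]) \<in> powers_index C X"
    using index_rotate[OF idx'] len by simp
  have i2: "((Rs @ [E, D]) @ [A, B], (ds @ [e, d]) @ [a, b]) \<in> powers_index C X"
    using index_rotate[OF i1 len] by simp
  have i3: "(Rs @ [E, D, AB], ds @ [e, d, ab]) \<in> powers_index C (X - {u, v})"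
    using index_glue[OF X(1) i2 el(1,2)] by (simp add: AB_def ab_def)
  have i4: "(Rs @ [AB, E, D], ds @ [ab, e, d]) \<in> powers_index C (X - {u, v})"
    using index_rotate[OF index_rotate[OF i3 len] len] .
  then have i4': "((Rs @ [AB]) @ [E, D], (ds @ [ab]) @ [e, d]) \<in> powers_index C (X - {u, v})" by simp
  have i5: "(Rs @ [A, B, ED], ds @ [a, b, ed]) \<in> powers_index C (X - {w, z})"
    using index_glue[OF X(1) idx'' el(3,4)] by (simp add: ED_def ed_def)
  have i6: "(Rs @ [ED, A, B], ds @ [ed, a, b]) \<in> powers_index C (X - {w, z})"
    using index_rotate[OF index_rotate[OF i5 len] len] .
  then have i6': "((Rs @ [ED]) @ [A, B], (ds @ [ed]) @ [a, b]) \<in> powers_index C (X - {w, z})" by simp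
  have i7: "(Rs @ [ED, AB], ds @ [ed, ab]) \<in> powers_index C (X - {u, v} - {w, z})"
    using index_glue[OF fin(2) i6' el(1,2)] by (simp add: AB_def ab_def com)
  have "contract \<epsilon> X u v (powers_class K \<epsilon> C X (Rs @ [A, B, E, D]) (ds @ [a, b, e, d])) =
      contract \<epsilon> X u v (powers_class K \<epsilon> C X ((Rs @ [E, D]) @ [A, B]) ((ds @ [e, d]) @ [a, b]))"
    using class_rotate[OF X(1) idx'] class_rotate[OF X(1) i1 len] len by simp
  also have "\<dots> = powers_class K \<epsilon> C (X - {u, v}) (Rs @ [E, D, AB]) (ds @ [e, d, ab])"
    using contract_glue[OF X(1) d(1-3) i2 el(1,2)] by (simp add: AB_def ab_def)
  also have "\<dots> = powers_class K \<epsilon> C (X - {u, v}) ((Rs @ [AB]) @ [E, D]) ((ds @ [ab]) @ [e, d])"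
    using class_rotate[OF fin(1) i4 len] by simp
  finally have "contract \<epsilon> (X - {u, v}) w z (contract \<epsilon> X u v (powers_class K \<epsilon> C X (Rs @ [A, B, E, D]) (ds @ [a, b, e, d]))) =
      powers_class K \<epsilon> C (X - {u, v} - {w, z}) (Rs @ [AB, ED]) (ds @ [ab, ed])"
    using contract_glue[OF fin(1) d(9,10,6) i4' el(3,4)] by (simp add: ED_def ed_def)
  also have "\<dots> = psign \<epsilon> \<odot>\<^bsub>powers_space K \<epsilon> C (X - {u, v} - {w, z})\<^esub>
      powers_class K \<epsilon> C (X - {u, v} - {w, z}) (Rs @ [ED, AB]) (ds @ [ed, ab])"
    using class_swap[OF fin(3) i7 len] .
  also have "powers_class K \<epsilon> C (X - {u, v} - {w, z}) (Rs @ [ED, AB]) (ds @ [ed, ab]) =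
      contract \<epsilon> (X - {w, z}) u v (powers_class K \<epsilon> C (X - {w, z}) (Rs @ [ED, A, B]) (ds @ [ed, a, b]))"
    using contract_glue[OF fin(2) d(7,8,3) i6' el(1,2)] by (simp add: AB_def ab_def com)
  also have "powers_class K \<epsilon> C (X - {w, z}) (Rs @ [ED, A, B]) (ds @ [ed, a, b]) =
      powers_class K \<epsilon> C (X - {w, z}) (Rs @ [A, B, ED]) (ds @ [a, b, ed])"
    using class_rotate[OF fin(2) i6 len] by simp
  also have "\<dots> = contract \<epsilon> X w z (powers_class K \<epsilon> C X (Rs @ [A, B, E, D]) (ds @ [a, b, e, d]))"
    using contract_glue[OF X(1) d(4-6) idx'' el(3,4)] by (simp add: ED_def ed_def)
  finally show ?thesis unfolding contracts_commute_def .
qed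

end

text \<open>
  The cases are the positions of two edges \<open>{u, v}\<close> and \<open>{w, z}\<close> in a graph with the factors as
  vertices: a loop, parallel edges, a path of length two in one of its four orientations, and disjoint
  edges.
\<close>

lemma contracts_commute_class:
  assumes X: "finite X" "{u, v, w, z} \<subseteq> X" "distinct [u, v, w, z]" and idx: "(Us, cs) \<in> powers_index C X"
  shows "contracts_commute \<epsilon> X u v w z (powers_class K \<epsilon> C X Us cs)"
proof -
  note cls = powers_class_closed[OF X(1) idx]
  have path: "contracts_commute \<epsilon> X u v w z (powers_class K \<epsilon> C X Us cs)"
    if d: "{u, v, w, z} \<subseteq> X" "distinct [u, v, w, z]"
      and p: "A \<in> set Us" "B \<in> set Us" "D \<in> set Us" "distinct [A, B, D]" "u \<in> A" "v \<in> B" "w \<in> B" "z \<in> D"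
    for u v w z A B D
  proof -
    have s: "set [A, B, D] \<subseteq> set Us" using p by simp
    obtain q Rs ds es where n: "length ds = length Rs" "length es = length [A, B, D]"
      "(Rs @ [A, B, D], ds @ es) \<in> powers_index C X"
      "powers_class K \<epsilon> C X Us cs = sgn_char K \<epsilon> q \<odot>\<^bsub>powers_space K \<epsilon> C X\<^esub> powers_class K \<epsilon> C X (Rs @ [A, B, D]) (ds @ es)"
      by (rule class_normalize[OF X(1) idx p(4) s])
    obtain a b e where es: "es = [a, b, e]" using n(2) by (auto simp: length_Suc_conv)
    show ?thesis
      using contracts_commute_smult[OF X(1) d contracts_commute_path[OF X(1) d n(3)[unfolded es] n(1) p(5-8)]
          sgn_char_closed powers_class_closed[OF X(1) n(3)[unfolded es]]] by (simp add: n(4) es)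
  qed
  have disj: "contracts_commute \<epsilon> X u v w z (powers_class K \<epsilon> C X Us cs)"
    if p: "A \<in> set Us" "B \<in> set Us" "E \<in> set Us" "D \<in> set Us" "distinct [A, B, E, D]"
      "u \<in> A" "v \<in> B" "w \<in> E" "z \<in> D" for A B E D
  proof -
    have s: "set [A, B, E, D] \<subseteq> set Us" using p by simp
    obtain q Rs ds es where n: "length ds = length Rs" "length es = length [A, B, E, D]"
      "(Rs @ [A, B, E, D], ds @ es) \<in> powers_index C X"
      "powers_class K \<epsilon> C X Us cs = sgn_char K \<epsilon> q \<odot>\<^bsub>powers_space K \<epsilon> C X\<^esub> powers_class K \<epsilon> C X (Rs @ [A, B, E, D]) (ds @ es)"
      by (rule class_normalize[OF X(1) idx p(5) s])
    obtain a b e f where es: "es = [a, b, e, f]" using n(2) by (auto simp: length_Suc_conv)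
    show ?thesis
      using contracts_commute_smult[OF X contracts_commute_disjoint[OF X n(3)[unfolded es] n(1) p(6-9)]
          sgn_char_closed powers_class_closed[OF X(1) n(3)[unfolded es]]] by (simp add: n(4) es)
  qed
  have zero: "contracts_commute \<epsilon> X u v w z (powers_class K \<epsilon> C X Us cs)"
    if "\<exists>A\<in>set Us. \<exists>B\<in>set Us. {u, v, w, z} \<subseteq> A \<union> B \<and> u \<in> A \<and> v \<in> B \<and> (w \<in> A \<and> z \<in> B \<or> z \<in> A \<and> w \<in> B)"
  proof -
    have com: "X - {w, z} - {u, v} = X - {u, v} - {w, z}" by auto
    have "finite (X - {u, v} - {w, z})" using X by simp
    then interpret P: Module.module K "powers_space K \<epsilon> C (X - {u, v} - {w, z})" by (rule vspace_powers)
    have X2: "{w, z, u, v} \<subseteq> X" "distinct [w, z, u, v]" using X by auto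
    have z1: "contract \<epsilon> (X - {u, v}) w z (contract \<epsilon> X u v (powers_class K \<epsilon> C X Us cs)) =
        \<zero>\<^bsub>powers_space K \<epsilon> C (X - {u, v} - {w, z})\<^esub>"
      by (rule contract_contract_zero[OF X idx], rule disjI2) (use that in blast)
    have "contract \<epsilon> (X - {w, z}) u v (contract \<epsilon> X w z (powers_class K \<epsilon> C X Us cs)) =
        \<zero>\<^bsub>powers_space K \<epsilon> C (X - {w, z} - {u, v})\<^esub>"
      by (rule contract_contract_zero[OF X(1) X2 idx], rule disjI2) (use that in blast)
    then show ?thesis using z1 unfolding contracts_commute_def com by simp
  qed
  have same: "contracts_commute \<epsilon> X u v w z (powers_class K \<epsilon> C X Us cs)"
    if d: "{u, v, w, z} \<subseteq> X" "distinct [u, v, w, z]" and U: "U \<in> set Us" "u \<in> U" "v \<in> U" for u v w z U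
  proof -
    have com: "X - {w, z} - {u, v} = X - {u, v} - {w, z}" by auto
    have fin: "finite (X - {u, v})" "finite (X - {u, v} - {w, z})" using X(1) by auto
    interpret P: Module.module K "powers_space K \<epsilon> C (X - {u, v} - {w, z})" by (rule vspace_powers[OF fin(2)])
    have d2: "{w, z, u, v} \<subseteq> X" "distinct [w, z, u, v]" using d by auto
    have e: "u \<in> X" "v \<in> X" "u \<noteq> v" "w \<in> X - {u, v}" "z \<in> X - {u, v}" "w \<noteq> z" using d by auto
    have "contract \<epsilon> (X - {w, z}) u v (contract \<epsilon> X w z (powers_class K \<epsilon> C X Us cs)) =
        \<zero>\<^bsub>powers_space K \<epsilon> C (X - {w, z} - {u, v})\<^esub>"
      by (rule contract_contract_zero[OF X(1) d2 idx], rule disjI1) (use U in blast)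
    moreover have "contract \<epsilon> (X - {u, v}) w z (contract \<epsilon> X u v (powers_class K \<epsilon> C X Us cs)) =
        \<zero>\<^bsub>powers_space K \<epsilon> C (X - {u, v} - {w, z})\<^esub>"
      using contract_same[OF X(1) e(1-3) idx U]
        lin_zero[OF vspace_powers[OF fin(1)] vspace_powers[OF fin(2)] contract_lin[OF fin(1) e(4-6)]] by simp
    ultimately show ?thesis unfolding contracts_commute_def com by simp
  qed
  have mem: "u \<in> X" "v \<in> X" "w \<in> X" "z \<in> X" using X(2) by auto
  have perms: "{v, u, w, z} \<subseteq> X" "distinct [v, u, w, z]" "{u, v, z, w} \<subseteq> X" "distinct [u, v, z, w]"
    "{v, u, z, w} \<subseteq> X" "distinct [v, u, z, w]" "{w, z, u, v} \<subseteq> X" "distinct [w, z, u, v]" using X by auto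
  note flip = contracts_commute_flip[OF X(1) _ _ cls]
  obtain A where A: "A \<in> set Us" "u \<in> A" using part_of[OF idx mem(1)] .
  obtain B where B: "B \<in> set Us" "v \<in> B" using part_of[OF idx mem(2)] .
  obtain E where E: "E \<in> set Us" "w \<in> E" using part_of[OF idx mem(3)] .
  obtain D where D: "D \<in> set Us" "z \<in> D" using part_of[OF idx mem(4)] .
  consider "A = B" | "E = D" | "A \<noteq> B" "E \<noteq> D" by blast
  then show ?thesis
  proof cases
    case 1
    then show ?thesis using same[OF X(2,3)] A B by blast
  next
    case 2
    then show ?thesis using flip(3)[OF perms(7,8) same[OF perms(7,8)]] E D by blast
  next
    case 3
    consider "E \<in> {A, B}" "D \<in> {A, B}" | "B = E" "D \<notin> {A, B}" | "B = D" "E \<notin> {A, B}"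
      | "A = E" "D \<notin> {A, B}" | "A = D" "E \<notin> {A, B}" | "E \<notin> {A, B}" "D \<notin> {A, B}"
      by blast
    then show ?thesis
    proof cases
      case 1
      then have "E = A \<and> D = B \<or> E = B \<and> D = A" using 3 by blast
      then have "{u, v, w, z} \<subseteq> A \<union> B \<and> u \<in> A \<and> v \<in> B \<and> (w \<in> A \<and> z \<in> B \<or> z \<in> A \<and> w \<in> B)"
        using A B E D by blast
      then show ?thesis using zero A B by blast
    next
      case 2
      have "distinct [A, B, D]" "w \<in> B" using 2 3 E by auto
      then show ?thesis using path[OF X(2,3) A(1) B(1) D(1)] A B D by blast
    next
      case 3
      have "distinct [A, B, E]" "z \<in> B" using 3 \<open>A \<noteq> B\<close> D by auto
      then show ?thesis using flip(2)[OF perms(3,4) path[OF perms(3,4) A(1) B(1) E(1)]] A B E by blast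
    next
      case 4
      have "distinct [B, A, D]" "w \<in> A" using 3 4 E by auto
      then show ?thesis using flip(1)[OF perms(1,2) path[OF perms(1,2) B(1) A(1) D(1)]] A B D by blast
    next
      case 5
      have "distinct [B, A, E]" "z \<in> A" using 3 5 D by auto
      then have "contracts_commute \<epsilon> X v u z w (powers_class K \<epsilon> C X Us cs)"
        using path[OF perms(5,6) B(1) A(1) E(1)] A B E by blast
      then show ?thesis using flip(1)[OF perms(1,2) flip(2)[OF perms(5,6)]] by blast
    next
      case 6
      then have "distinct [A, B, E, D]" using 3 by (metis distinct_length_2_or_more distinct_singleton insertCI)
      then show ?thesis using disj[OF A(1) B(1) E(1) D(1)] A B E D by blast
    qed
  qed
qed

lemma contract_commute:
  assumes X: "finite X" "{u, v, w, z} \<subseteq> X" "distinct [u, v, w, z]" and x: "x \<in> carrier (powers_space K \<epsilon> C X)"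
  shows "contract \<epsilon> (X - {u, v}) w z (contract \<epsilon> X u v x) =
     psign \<epsilon> \<odot>\<^bsub>powers_space K \<epsilon> C (X - {u, v} - {w, z})\<^esub> contract \<epsilon> (X - {w, z}) u v (contract \<epsilon> X w z x)"
proof (rule powers_lin_eqI[OF X(1) _ contract2_lin[OF X] contract2_lin'[OF X] _ x])
  show "vspace (powers_space K \<epsilon> C (X - {u, v} - {w, z}))" using X by (intro vspace_powers) simp
qed (use contracts_commute_class[OF X] in \<open>simp add: contracts_commute_def\<close>)

text \<open>
  The naturality of the composition, for the restrictions of one function to both parts.
\<close>

lemma relabel_comp_eq:
  assumes UV: "finite U" "finite V" "U \<inter> V = {}" "u \<in> U" "v \<in> V" and f: "inj_on f (U \<union> V)"
    and ab: "a \<in> carrier (space C U)" "b \<in> carrier (space C V)"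
  shows "f ` ((U - {u}) \<union> (V - {v})) = (f ` U - {f u}) \<union> (f ` V - {f v})"
    and "relabel f ((U - {u}) \<union> (V - {v})) (comp U u V v a b) =
      comp (f ` U) (f u) (f ` V) (f v) (relabel f U a) (relabel f V b)"
proof -
  let ?W = "(U - {u}) \<union> (V - {v})"
  have fU: "inj_on f U" "inj_on f V" using f by (auto intro: inj_on_subset)
  have dis: "f ` U \<inter> f ` V = {}" using inj_on_image_Int[OF f, of U V] UV(3) by auto
  show W: "f ` ?W = (f ` U - {f u}) \<union> (f ` V - {f v})"
    using inj_on_image_set_diff[OF fU(1), of U "{u}"] inj_on_image_set_diff[OF fU(2), of V "{v}"] UV
    by (simp add: image_Un)
  have res: "(\<lambda>x\<in>?W. if x \<in> U then restrict f U x else restrict f V x) = restrict f ?W"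
    by (auto simp: restrict_def)
  show "relabel f ?W (comp U u V v a b) = comp (f ` U) (f u) (f ` V) (f v) (relabel f U a) (relabel f V b)"
    using compo_nat[OF UV finite_imageI[OF UV(1)] finite_imageI[OF UV(2)] dis restrict_FB[OF fU(1)] restrict_FB[OF fU(2)] ab]
    by (simp add: relabel_def Let_def res W UV)
qed

lemma contract_equivariant:
  assumes X: "finite X" "u \<in> X" "v \<in> X" "u \<noteq> v" and f: "inj_on f X" and x: "x \<in> carrier (powers_space K \<epsilon> C X)"
  shows "FB_map \<epsilon> (X - {u, v}) f (contract \<epsilon> X u v x) = contract \<epsilon> (f ` X) (f u) (f v) (FB_map \<epsilon> X f x)"
proof -
  have fX: "finite (f ` X)" "f u \<in> f ` X" "f v \<in> f ` X" "f u \<noteq> f v"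
    using X f by (auto simp: inj_on_def)
  have X': "finite (X - {u, v})" and f': "inj_on f (X - {u, v})" using X f by (auto intro: inj_on_subset)
  have im: "f ` (X - {u, v}) = f ` X - {f u, f v}"
    using inj_on_image_set_diff[OF f, of X "{u, v}"] X by simp
  have fX': "finite (f ` X - {f u, f v})" using X by simp
  note lin = lin_comp[OF contract_lin[OF X] FB_map_lin[OF X' f', unfolded im]]
    lin_comp[OF FB_map_lin[OF X(1) f] contract_lin[OF fX]]
  define Q where "Q = (\<lambda>Ws. (\<exists>U. Ws = [U] \<and> u \<in> U \<and> v \<in> U) \<or> (\<exists>U V. Ws = [U, V] \<and> u \<in> U \<and> v \<in> V))"
  show ?thesis
    unfolding im
  proof (rule powers_eq_normalizedI[where P = Q, OF X(1) vspace_powers[OF fX'] lin _ _ x])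
    fix Us assume "\<Union>(set Us) = X"
    then obtain U V where "U \<in> set Us" "u \<in> U" "V \<in> set Us" "v \<in> V" using X by blast
    then show "\<exists>Ws. distinct Ws \<and> set Ws \<subseteq> set Us \<and> Q Ws"
      by (cases "U = V") (auto simp: Q_def intro: exI[of _ "[U]"] exI[of _ "[U, V]"])
  next
    fix Rs Ws ds es
    assume *: "Q Ws" "(Rs @ Ws, ds @ es) \<in> powers_index C X" "length ds = length Rs" "length es = length Ws"
    from *(1) consider (same) U where "Ws = [U]" "u \<in> U" "v \<in> U"
      | (diff) U V where "Ws = [U, V]" "u \<in> U" "v \<in> V" by (auto simp: Q_def)
    then show "powers_FB_map K \<epsilon> C (X - {u, v}) (f ` X - {f u, f v}) f
        (contract \<epsilon> X u v (powers_class K \<epsilon> C X (Rs @ Ws) (ds @ es))) =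
      contract \<epsilon> (f ` X) (f u) (f v) (FB_map \<epsilon> X f (powers_class K \<epsilon> C X (Rs @ Ws) (ds @ es)))"
    proof cases
      case same
      have "contract \<epsilon> (f ` X) (f u) (f v) (FB_map \<epsilon> X f (powers_class K \<epsilon> C X (Rs @ Ws) (ds @ es))) =
          \<zero>\<^bsub>powers_space K \<epsilon> C (f ` X - {f u, f v})\<^esub>"
        unfolding FB_map_class[OF X(1) f *(2)]
        by (rule contract_same[OF fX powers_index_relabel[OF X(1) f *(2)], of "f ` U"]) (use same in auto)
      then show ?thesis
        using same contract_same[OF X *(2), of U]
          lin_zero[OF vspace_powers[OF X'] vspace_powers[OF fX'] FB_map_lin[OF X' f', unfolded im]] by simp
    next
      case diff
      obtain a b where es: "es = [a, b]" using *(4) diff(1) by (auto simp: length_Suc_conv)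
      note idx = *(2)[unfolded diff(1) es]
      have fin: "finite U" "finite V" and dis: "U \<inter> V = {}" and sub: "U \<union> V \<subseteq> X"
        and ab: "a \<in> carrier (space C U)" "b \<in> carrier (space C V)"
        using idx X(1) *(3) by (auto simp: powers_index_iff sorted_wrt_append list_all2_append intro: finite_subset)
      note rel = relabel_comp_eq[OF fin dis diff(2,3) inj_on_subset[OF f sub] ab]
      note idx' = powers_index_relabel[OF X(1) f idx]
      then have idx': "(map (image f) Rs @ [f ` U, f ` V], map2 (relabel f) Rs ds @ [relabel f U a, relabel f V b])
          \<in> powers_index C (f ` X)" using *(3) by simp
      show ?thesis
        using contract_glue[OF fX idx'] diff(2,3) FB_map_class[OF X(1) f idx] *(3)
          FB_map_class[OF X' f' index_glue[OF X(1) idx diff(2,3)], unfolded im]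
        by (simp add: contract_glue[OF X idx diff(2,3)] diff(1) es rel)
    qed
  qed
qed

end

section \<open>Naturality\<close>

locale operad_hom = S: operad K C + T: operad K C'
  for K :: "'k ring" and C :: "('a, 'k, 'v) cyclic_operad" and C' :: "('a, 'k, 'w) cyclic_operad" +
  fixes \<phi> :: "'a set \<Rightarrow> 'v \<Rightarrow> 'w"
  assumes hom: "cyclic_operad_hom K C C' \<phi>"
begin

lemma \<phi>_lin: "finite X \<Longrightarrow> \<phi> X \<in> lin_maps K (space C X) (space C' X)"
  using hom by (simp add: cyclic_operad_hom_def cat_module_hom_def S.kFB_simps)

lemma \<phi>_relabel:
  assumes "finite U" "inj_on f U" "c \<in> carrier (space C U)"
  shows "\<phi> (f ` U) (S.relabel f U c) = T.relabel f U (\<phi> U c)"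
  using hom assms S.free_gen_closed[OF restrict_FB[OF assms(2)]]
  by (simp add: cyclic_operad_hom_def cat_module_hom_def S.kFB_simps S.relabel_def T.relabel_def)

lemma \<phi>_comp:
  assumes "finite U" "finite V" "U \<inter> V = {}" "u \<in> U" "v \<in> V" "a \<in> carrier (space C U)" "b \<in> carrier (space C V)"
  shows "\<phi> ((U - {u}) \<union> (V - {v})) (S.comp U u V v a b) = T.comp U u V v (\<phi> U a) (\<phi> V b)"
  using hom assms by (simp add: cyclic_operad_hom_def)

abbreviation ind :: "parity \<Rightarrow> 'a set \<Rightarrow> ('a, 'k, 'v) powers \<Rightarrow> ('a, 'k, 'w) powers" where
  "ind \<epsilon> X \<equiv> powers_map K \<epsilon> C C' \<phi> X"

lemma ind_index:
  assumes X: "finite X" and idx: "(Us, cs) \<in> powers_index C X"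
  shows "(Us, map2 \<phi> Us cs) \<in> powers_index C' X"
proof -
  have "\<phi> U c \<in> carrier (space C' U)" if "U \<in> set Us" "c \<in> carrier (space C U)" for U c
    using that idx X by (intro S.lin_closed[OF \<phi>_lin]) (auto simp: powers_index_iff intro: finite_subset)
  then show ?thesis
    using idx by (auto simp: powers_index_iff list_all2_conv_all_nth)
qed

lemma
  assumes X: "finite X"
  shows ind_lin: "ind \<epsilon> X \<in> lin_maps K (powers_space K \<epsilon> C X) (powers_space K \<epsilon> C' X)"
    and ind_class: "\<And>Us cs. (Us, cs) \<in> powers_index C X \<Longrightarrow>
      ind \<epsilon> X (powers_class K \<epsilon> C X Us cs) = powers_class K \<epsilon> C' X Us (map2 \<phi> Us cs)"
proof -
  let ?\<phi> = "\<lambda>Us cs. powers_class K \<epsilon> C' X Us (map2 \<phi> Us cs)"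
  have lin: "S.multilin (map (space C) Us) (powers_space K \<epsilon> C' X) (?\<phi> Us)"
    if Us: "Us \<in> decomps (length Us) X" for Us
  proof (rule S.multilin_map2[where h = "\<lambda>U. U"])
    show "S.multilin (map (space C') (map (\<lambda>U. U) Us)) (powers_space K \<epsilon> C' X) (powers_class K \<epsilon> C' X Us)"
      using T.powers_class_multilin[OF X Us] by simp
    show "\<phi> U \<in> lin_maps K (space C U) (space C' U)" if "U \<in> set Us" for U
      using that Us X by (intro \<phi>_lin) (auto simp: decomps_iff intro: finite_subset)
  qed
  have sym: "?\<phi> (permute_list q Us) (permute_list q cs) =
      sgn_char K \<epsilon> q \<odot>\<^bsub>powers_space K \<epsilon> C' X\<^esub> ?\<phi> Us cs"
    if idx: "(Us, cs) \<in> powers_index C X" and q: "q permutes {..<length Us}" for Us cs q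
    using T.powers_class_permute[OF X ind_index[OF X idx], of q] q powers_index_length[OF idx]
    by (simp add: permute_list_map2[symmetric])
  show "ind \<epsilon> X \<in> lin_maps K (powers_space K \<epsilon> C X) (powers_space K \<epsilon> C' X)"
    unfolding powers_map_def by (rule S.powers_map_of_lin[OF X T.vspace_powers[OF X] lin sym])
  show "ind \<epsilon> X (powers_class K \<epsilon> C X Us cs) = ?\<phi> Us cs" if "(Us, cs) \<in> powers_index C X" for Us cs
    unfolding powers_map_def by (rule S.powers_map_of_class[OF X T.vspace_powers[OF X] lin sym]) (use that in auto)
qed

lemma ind_FB_map:
  assumes X: "finite X" and f: "inj_on f X" and x: "x \<in> carrier (powers_space K \<epsilon> C X)"
  shows "ind \<epsilon> (f ` X) (S.FB_map \<epsilon> X f x) = T.FB_map \<epsilon> X f (ind \<epsilon> X x)"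
proof -
  have X': "finite (f ` X)" using X by simp
  show ?thesis
  proof (rule S.powers_lin_eqI[OF X T.vspace_powers[OF X'] S.lin_comp[OF S.FB_map_lin[OF X f] ind_lin[OF X']]
        S.lin_comp[OF ind_lin[OF X] T.FB_map_lin[OF X f]] _ x])
    fix Us cs assume idx: "(Us, cs) \<in> powers_index C X"
    have "map2 \<phi> (map (image f) Us) (map2 (S.relabel f) Us cs) = map2 (T.relabel f) Us (map2 \<phi> Us cs)"
    proof (rule nth_equalityI)
      fix i assume "i < length (map2 \<phi> (map (image f) Us) (map2 (S.relabel f) Us cs))"
      then have i: "i < length Us" "i < length cs" by auto
      then have c: "cs ! i \<in> carrier (space C (Us ! i))"
        using idx by (auto simp: powers_index_iff list_all2_conv_all_nth)
      have "Us ! i \<subseteq> X" using idx i by (auto simp: powers_index_iff)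
      then have "finite (Us ! i)" "inj_on f (Us ! i)"
        using X f by (auto intro: finite_subset inj_on_subset)
      then show "map2 \<phi> (map (image f) Us) (map2 (S.relabel f) Us cs) ! i = map2 (T.relabel f) Us (map2 \<phi> Us cs) ! i"
        using i c by (simp add: \<phi>_relabel)
    qed simp
    then show "ind \<epsilon> (f ` X) (S.FB_map \<epsilon> X f (powers_class K \<epsilon> C X Us cs)) =
        T.FB_map \<epsilon> X f (ind \<epsilon> X (powers_class K \<epsilon> C X Us cs))"
      by (simp only: S.FB_map_class[OF X f idx] ind_class[OF X idx] T.FB_map_class[OF X f ind_index[OF X idx]]
          ind_class[OF X' S.powers_index_relabel[OF X f idx]])
  qed
qed

lemma ind_contract:
  assumes X: "finite X" "u \<in> X" "v \<in> X" "u \<noteq> v" and x: "x \<in> carrier (powers_space K \<epsilon> C X)"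
  shows "ind \<epsilon> (X - {u, v}) (S.contract \<epsilon> X u v x) = T.contract \<epsilon> X u v (ind \<epsilon> X x)"
proof -
  have X': "finite (X - {u, v})" using X by simp
  define Q where "Q = (\<lambda>Ws. (\<exists>U. Ws = [U] \<and> u \<in> U \<and> v \<in> U) \<or> (\<exists>U V. Ws = [U, V] \<and> u \<in> U \<and> v \<in> V))"
  show ?thesis
  proof (rule S.powers_eq_normalizedI[where P = Q, OF X(1) T.vspace_powers[OF X']
        S.lin_comp[OF S.contract_lin[OF X] ind_lin[OF X']] S.lin_comp[OF ind_lin[OF X(1)] T.contract_lin[OF X]] _ _ x])
    fix Us assume "\<Union>(set Us) = X"
    then obtain U V where "U \<in> set Us" "u \<in> U" "V \<in> set Us" "v \<in> V" using X by blast
    then show "\<exists>Ws. distinct Ws \<and> set Ws \<subseteq> set Us \<and> Q Ws"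
      by (cases "U = V") (auto simp: Q_def intro: exI[of _ "[U]"] exI[of _ "[U, V]"])
  next
    fix Rs Ws ds es
    assume *: "Q Ws" "(Rs @ Ws, ds @ es) \<in> powers_index C X" "length ds = length Rs" "length es = length Ws"
    from *(1) consider (same) U where "Ws = [U]" "u \<in> U" "v \<in> U"
      | (diff) U V where "Ws = [U, V]" "u \<in> U" "v \<in> V" by (auto simp: Q_def)
    then show "ind \<epsilon> (X - {u, v}) (S.contract \<epsilon> X u v (powers_class K \<epsilon> C X (Rs @ Ws) (ds @ es))) =
      T.contract \<epsilon> X u v (ind \<epsilon> X (powers_class K \<epsilon> C X (Rs @ Ws) (ds @ es)))"
    proof cases
      case same
      have "T.contract \<epsilon> X u v (ind \<epsilon> X (powers_class K \<epsilon> C X (Rs @ Ws) (ds @ es))) =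
          \<zero>\<^bsub>powers_space K \<epsilon> C' (X - {u, v})\<^esub>"
        unfolding ind_class[OF X(1) *(2)]
        by (rule T.contract_same[OF X ind_index[OF X(1) *(2)], of U]) (use same in auto)
      then show ?thesis
        using same S.contract_same[OF X *(2), of U]
          S.lin_zero[OF S.vspace_powers[OF X'] T.vspace_powers[OF X'] ind_lin[OF X']] by simp
    next
      case diff
      obtain a b where es: "es = [a, b]" using *(4) diff(1) by (auto simp: length_Suc_conv)
      note idx = *(2)[unfolded diff(1) es]
      have fin: "finite U" "finite V" and dis: "U \<inter> V = {}"
        and ab: "a \<in> carrier (space C U)" "b \<in> carrier (space C V)"
        using idx X(1) *(3) by (auto simp: powers_index_iff sorted_wrt_append list_all2_append intro: finite_subset)
      have idx': "(Rs @ [U, V], map2 \<phi> Rs ds @ [\<phi> U a, \<phi> V b]) \<in> powers_index C' X"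
        using ind_index[OF X(1) idx] *(3) by simp
      show ?thesis
        using T.contract_glue[OF X idx' diff(2,3)] ind_class[OF X(1) idx] *(3)
          ind_class[OF X' S.index_glue[OF X(1) idx diff(2,3)]] \<phi>_comp[OF fin dis diff(2,3) ab]
        by (simp add: S.contract_glue[OF X idx diff(2,3)] diff(1) es)
    qed
  qed
qed

end

section \<open>Permutations of pairs\<close>

lemma pairs_image:
  assumes "p \<in> wreath t" "j \<in> {1..t}"
  shows "pair_perm p j \<in> {1..t}" and "{p (2 * j - 1), p (2 * j)} = {2 * pair_perm p j - 1, 2 * pair_perm p j}"
proof -
  have "{2 * j - 1, 2 * j} \<in> pairs t" using assms(2) unfolding pairs_def by blast
  then have "p ` {2 * j - 1, 2 * j} \<in> pairs t" using assms(1) unfolding wreath_def by blast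
  then obtain i where i: "i \<in> {1..t}" "{p (2 * j - 1), p (2 * j)} = {2 * i - 1, 2 * i}"
    unfolding pairs_def by auto
  then have "p (2 * j) \<in> {2 * i - 1, 2 * i}" by blast
  then have "pair_perm p j = i" using i(1) by (auto simp: pair_perm_def)
  then show "pair_perm p j \<in> {1..t}"
    "{p (2 * j - 1), p (2 * j)} = {2 * pair_perm p j - 1, 2 * pair_perm p j}" using i by auto
qed

lemma wreathI:
  assumes "p permutes {1..2 * t}"
    and "\<And>j. j \<in> {1..t} \<Longrightarrow> \<exists>i\<in>{1..t}. {p (2 * j - 1), p (2 * j)} = {2 * i - 1, 2 * i}"
  shows "p \<in> wreath t"
  unfolding wreath_def pairs_def using assms by fastforce

lemma pair_perm_permutes:
  assumes p: "p \<in> wreath t"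
  shows "pair_perm p permutes {1..t}"
proof -
  have perm: "p permutes {1..2 * t}" using p by (simp add: wreath_def)
  have "inj_on (pair_perm p) {1..t}"
  proof (rule inj_onI)
    fix i j assume ij: "i \<in> {1..t}" "j \<in> {1..t}" "pair_perm p i = pair_perm p j"
    then have "{p (2 * i - 1), p (2 * i)} = {p (2 * j - 1), p (2 * j)}"
      using pairs_image(2)[OF p ij(1)] pairs_image(2)[OF p ij(2)] by simp
    then have "p (2 * i) = p (2 * j - 1) \<or> p (2 * i) = p (2 * j)" by blast
    then have "2 * i = 2 * j - 1 \<or> 2 * i = 2 * j" unfolding inj_eq[OF permutes_inj[OF perm]] .
    moreover have "1 \<le> i" "1 \<le> j" using ij by auto
    ultimately show "i = j" by presburger
  qed
  moreover have "pair_perm p ` {1..t} \<subseteq> {1..t}" using pairs_image(1)[OF p] by blast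
  ultimately have "bij_betw (pair_perm p) {1..t} {1..t}"
    by (simp add: bij_betw_def endo_inj_surj)
  moreover have "pair_perm p j = j" if "j \<notin> {1..t}" for j
  proof -
    have "p (2 * j) = 2 * j" using that by (intro permutes_not_in[OF perm]) auto
    then show ?thesis by (simp add: pair_perm_def)
  qed
  ultimately show ?thesis by (rule bij_imp_permutes)
qed

lemma wreath_comp:
  assumes p: "p \<in> wreath t" and q: "q \<in> wreath t"
  shows "p \<circ> q \<in> wreath t" and "pair_perm (p \<circ> q) = pair_perm p \<circ> pair_perm q"
proof -
  have perm: "p permutes {1..2 * t}" "q permutes {1..2 * t}" using p q by (auto simp: wreath_def)
  have *: "{p (q (2 * j - 1)), p (q (2 * j))} = {2 * pair_perm p (pair_perm q j) - 1, 2 * pair_perm p (pair_perm q j)}"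
    if j: "j \<in> {1..t}" for j
  proof -
    have "{p (q (2 * j - 1)), p (q (2 * j))} = p ` {q (2 * j - 1), q (2 * j)}" by simp
    also have "\<dots> = {p (2 * pair_perm q j - 1), p (2 * pair_perm q j)}"
      unfolding pairs_image(2)[OF q j] by simp
    also have "\<dots> = {2 * pair_perm p (pair_perm q j) - 1, 2 * pair_perm p (pair_perm q j)}"
      by (rule pairs_image(2)[OF p pairs_image(1)[OF q j]])
    finally show ?thesis .
  qed
  show pq: "p \<circ> q \<in> wreath t"
  proof (rule wreathI)
    show "p \<circ> q permutes {1..2 * t}" by (rule permutes_compose[OF perm(2,1)])
    show "\<exists>i\<in>{1..t}. {(p \<circ> q) (2 * j - 1), (p \<circ> q) (2 * j)} = {2 * i - 1, 2 * i}" if j: "j \<in> {1..t}" for j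
      using *[OF j] pairs_image(1)[OF p pairs_image(1)[OF q j]] by auto
  qed
  show "pair_perm (p \<circ> q) = pair_perm p \<circ> pair_perm q"
  proof
    fix j
    show "pair_perm (p \<circ> q) j = (pair_perm p \<circ> pair_perm q) j"
    proof (cases "j \<in> {1..t}")
      case True
      have "p (q (2 * j)) \<in> {2 * pair_perm p (pair_perm q j) - 1, 2 * pair_perm p (pair_perm q j)}"
        using *[OF True] by blast
      then show ?thesis
        using pairs_image(1)[OF p pairs_image(1)[OF q True]] by (auto simp: pair_perm_def[of "p \<circ> q"])
    next
      case False
      then show ?thesis
        using permutes_not_in[OF pair_perm_permutes[OF p] False] permutes_not_in[OF pair_perm_permutes[OF q] False]
          permutes_not_in[OF pair_perm_permutes[OF pq] False] by simp
    qed
  qed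
qed

text \<open>The section of the projection to the permutations of the pairs.\<close>

definition pair_lift :: "(nat \<Rightarrow> nat) \<Rightarrow> nat \<Rightarrow> nat" where
  "pair_lift \<sigma> n = 2 * \<sigma> ((n + 1) div 2) - (if odd n then 1 else 0)"

lemma pair_lift_simps:
  "j > 0 \<Longrightarrow> pair_lift \<sigma> (2 * j - Suc 0) = 2 * \<sigma> j - 1" "pair_lift \<sigma> (2 * j) = 2 * \<sigma> j"
  "pair_lift \<sigma> (Suc (2 * j)) = 2 * \<sigma> (Suc j) - 1"
  by (simp_all add: pair_lift_def)

lemma pair_lift_id: "pair_lift id = id"
  by (rule ext) (auto simp: pair_lift_def elim!: evenE oddE)

lemma pair_lift_comp:
  assumes "\<And>j. j > 0 \<Longrightarrow> \<tau> j > 0"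
  shows "pair_lift (\<sigma> \<circ> \<tau>) = pair_lift \<sigma> \<circ> pair_lift \<tau>"
proof
  fix n
  show "pair_lift (\<sigma> \<circ> \<tau>) n = (pair_lift \<sigma> \<circ> pair_lift \<tau>) n"
  proof (cases "even n")
    case True
    then obtain j where "n = 2 * j" by (rule evenE)
    then show ?thesis by (simp add: pair_lift_simps)
  next
    case False
    then obtain j where j: "n = Suc (2 * j)" by (auto elim: oddE)
    then show ?thesis using assms[of "Suc j"] by (simp add: pair_lift_simps)
  qed
qed

lemma permutes_pos:
  assumes "\<sigma> permutes {1..t::nat}" "j > 0"
  shows "\<sigma> j > 0"
  using permutes_in_image[OF assms(1), of j] permutes_not_in[OF assms(1), of j] assms(2)
  by (cases "j \<in> {1..t}") auto

lemma pair_lift_wreath: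
  assumes \<sigma>: "\<sigma> permutes {1..t}"
  shows "pair_lift \<sigma> \<in> wreath t" and "pair_perm (pair_lift \<sigma>) = \<sigma>"
proof -
  have inv: "inv_into UNIV \<sigma> permutes {1..t}" by (rule permutes_inv[OF \<sigma>])
  have "pair_lift (inv_into UNIV \<sigma>) \<circ> pair_lift \<sigma> = id" "pair_lift \<sigma> \<circ> pair_lift (inv_into UNIV \<sigma>) = id"
    using pair_lift_comp[of \<sigma> "inv_into UNIV \<sigma>"] pair_lift_comp[of "inv_into UNIV \<sigma>" \<sigma>]
      permutes_pos[OF \<sigma>] permutes_pos[OF inv] permutes_inv_o[OF \<sigma>] pair_lift_id by auto
  then have bij: "bij (pair_lift \<sigma>)" by (rule o_bij)
  have "pair_lift \<sigma> permutes {1..2 * t}"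
    unfolding permutes_def
  proof (intro conjI allI impI)
    fix n assume n: "n \<notin> {1..2 * t}"
    then have "\<sigma> ((n + 1) div 2) = (n + 1) div 2" by (intro permutes_not_in[OF \<sigma>]) auto
    then have "pair_lift \<sigma> n = pair_lift id n" by (simp add: pair_lift_def)
    then show "pair_lift \<sigma> n = n" unfolding pair_lift_id id_apply .
  next
    fix y show "\<exists>!x. pair_lift \<sigma> x = y" using bij unfolding bij_iff by (rule spec)
  qed
  then show "pair_lift \<sigma> \<in> wreath t"
    by (rule wreathI) (use permutes_in_image[OF \<sigma>] in \<open>auto simp: pair_lift_simps\<close>)
  show "pair_perm (pair_lift \<sigma>) = \<sigma>"
    by (rule ext) (simp add: pair_perm_def pair_lift_simps)
qed

lemma pair_lift_adjacent:
  assumes "j > 0"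
  shows "pair_lift (transpose j (Suc j)) = transpose (2 * j - 1) (2 * j + 1) \<circ> transpose (2 * j) (2 * j + 2)"
proof
  fix n
  show "pair_lift (transpose j (Suc j)) n = (transpose (2 * j - 1) (2 * j + 1) \<circ> transpose (2 * j) (2 * j + 2)) n"
  proof (cases "even n")
    case True
    then obtain i where n: "n = 2 * i" by (rule evenE)
    have "2 * i \<noteq> 2 * j - 1" "2 * i \<noteq> 2 * j + 1" "2 * j \<noteq> 2 * j - 1" "2 * j + 2 \<noteq> 2 * j - 1"
      using assms by presburger+
    then show ?thesis by (auto simp: n pair_lift_simps transpose_def)
  next
    case False
    then obtain i where n: "n = Suc (2 * i)" by (auto elim: oddE)
    have "Suc (2 * i) \<noteq> 2 * j" "Suc (2 * i) \<noteq> 2 * j + 2" by presburger+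
    then show ?thesis using assms by (auto simp: n pair_lift_simps transpose_def)
  qed
qed

lemma flip_wreath:
  assumes j: "j \<in> {1..t}"
  shows "transpose (2 * j - 1) (2 * j) \<in> wreath t" and "pair_perm (transpose (2 * j - 1) (2 * j)) = id"
proof -
  show "transpose (2 * j - 1) (2 * j) \<in> wreath t"
  proof (rule wreathI)
    show "transpose (2 * j - 1) (2 * j) permutes {1..2 * t}" using j by (intro permutes_swap_id) auto
    fix i assume i: "i \<in> {1..t}"
    have "{transpose (2 * j - 1) (2 * j) (2 * i - 1), transpose (2 * j - 1) (2 * j) (2 * i)} = {2 * i - 1, 2 * i}"
    proof (cases "i = j")
      case False
      then have "2 * i \<noteq> 2 * j - 1" "2 * i - 1 \<noteq> 2 * j" "2 * i - 1 \<noteq> 2 * j - 1" using i j by auto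
      then show ?thesis using False by (simp add: transpose_apply_other)
    qed auto
    then show "\<exists>k\<in>{1..t}. {transpose (2 * j - 1) (2 * j) (2 * i - 1), transpose (2 * j - 1) (2 * j) (2 * i)} = {2 * k - 1, 2 * k}"
      using i by blast
  qed
  show "pair_perm (transpose (2 * j - 1) (2 * j)) = id"
    using j by (intro ext) (auto simp: pair_perm_def transpose_def)
qed

text \<open>
  The wreath product is generated by the swaps within a pair and the exchanges of two adjacent
  pairs.
\<close>

lemma wreath_induct [consumes 1, case_names id flip swap comp]:
  assumes p: "p \<in> wreath t"
    and id: "P id"
    and flip: "\<And>j. j \<in> {1..t} \<Longrightarrow> P (transpose (2 * j - 1) (2 * j))"
    and swap: "\<And>j. 0 < j \<Longrightarrow> j < t \<Longrightarrow> P (pair_lift (transpose j (Suc j)))"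
    and comp: "\<And>p q. p \<in> wreath t \<Longrightarrow> q \<in> wreath t \<Longrightarrow> P p \<Longrightarrow> P q \<Longrightarrow> P (p \<circ> q)"
  shows "P p"
proof -
  have lift_comp: "P (pair_lift (\<sigma> \<circ> \<tau>))"
    if "\<sigma> permutes {1..t}" "\<tau> permutes {1..t}" "P (pair_lift \<sigma>)" "P (pair_lift \<tau>)" for \<sigma> \<tau>
    using pair_lift_comp[of \<tau> \<sigma>, OF permutes_pos[OF that(2)]]
      comp[OF pair_lift_wreath(1)[OF that(1)] pair_lift_wreath(1)[OF that(2)] that(3,4)] by simp
  have tr: "P (pair_lift (transpose a (a + Suc d)))" if "0 < a" "a + Suc d \<le> t" for a d
    using that
  proof (induction d)
    case 0
    then show ?case using swap[of a] by simp
  next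
    case (Suc d)
    let ?b = "a + Suc d"
    have perm: "transpose ?b (Suc ?b) permutes {1..t}" "transpose a ?b permutes {1..t}"
      using Suc.prems by (auto intro!: permutes_swap_id)
    have "transpose ?b (Suc ?b) \<circ> transpose a ?b \<circ> transpose ?b (Suc ?b) = transpose a (Suc ?b)"
      using transpose_comp_triple[of "Suc ?b" a ?b] by (simp add: transpose_commute)
    moreover have "P (pair_lift (transpose ?b (Suc ?b) \<circ> transpose a ?b \<circ> transpose ?b (Suc ?b)))"
      using Suc swap[of ?b] by (intro lift_comp permutes_compose perm) auto
    ultimately show ?case by simp
  qed
  have tr': "P (pair_lift (transpose a b))" if "a \<in> {1..t}" "b \<in> {1..t}" "a \<noteq> b" for a b
  proof -
    have less: "P (pair_lift (transpose a b))" if "a < b" "a \<in> {1..t}" "b \<in> {1..t}" for a b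
      using tr[of a "b - Suc a"] that by simp
    show ?thesis
    proof (cases "a < b")
      case False
      then have "P (pair_lift (transpose b a))" using that by (intro less) auto
      then show ?thesis by (simp only: transpose_commute)
    qed (use less that in blast)
  qed
  have lift: "P (pair_lift \<sigma>)" if \<sigma>: "\<sigma> permutes {1..t}" for \<sigma>
    using finite_atLeastAtMost \<sigma>
  proof (induction rule: permutes_rev_induct)
    case id
    show ?case using \<open>P id\<close> by (simp only: pair_lift_id)
  next
    case (swap a b \<sigma>)
    then show ?case by (intro lift_comp tr' permutes_swap_id) auto
  qed
  \<comment> \<open>an element that maps every pair to itself is a product of swaps, one for each pair that it reverses\<close>
  have kernel: "P p" if "p \<in> wreath t" "pair_perm p = id" for p
    using that
  proof (induction "card {j \<in> {1..t}. p (2 * j) \<noteq> 2 * j}" arbitrary: p)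
    case 0
    then have even: "p (2 * j) = 2 * j" if "j \<in> {1..t}" for j using that by auto
    have perm: "p permutes {1..2 * t}" using 0 by (simp add: wreath_def)
    have "p n = n" for n
    proof (cases "n \<in> {1..2 * t}")
      case True
      show ?thesis
      proof (cases "even n")
        case True
        then show ?thesis using even[of "n div 2"] \<open>n \<in> _\<close> by fastforce
      next
        case False
        define j where "j = (n + 1) div 2"
        have j: "j \<in> {1..t}" "n = 2 * j - 1"
          using False \<open>n \<in> _\<close> unfolding j_def atLeastAtMost_iff by presburger+
        have "p (2 * j - 1) \<noteq> p (2 * j)"
          unfolding inj_eq[OF permutes_inj[OF perm]] using j(1) unfolding atLeastAtMost_iff by presburger
        then have "p (2 * j - 1) \<noteq> 2 * j" using even[OF j(1)] by simp
        then show ?thesis using pairs_image(2)[OF 0(2) j(1)] 0(3) j(2) by auto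
      qed
    qed (use permutes_not_in[OF perm] in simp)
    then have "p = id" by auto
    then show ?case using \<open>P id\<close> by (simp only:)
  next
    case (Suc n)
    have "{j \<in> {1..t}. p (2 * j) \<noteq> 2 * j} \<noteq> {}"
    proof
      assume "{j \<in> {1..t}. p (2 * j) \<noteq> 2 * j} = {}"
      then have "Suc n = card ({} :: nat set)" using Suc(2) by (simp only:)
      then show False by simp
    qed
    then obtain j where j: "j \<in> {1..t}" "p (2 * j) \<noteq> 2 * j" by blast
    let ?f = "transpose (2 * j - 1) (2 * j)"
    define q where "q = ?f \<circ> p"
    have pj: "p (2 * j) = 2 * j - 1" using pairs_image(2)[OF Suc(3) j(1)] Suc(4) j(2) by auto
    have q: "q \<in> wreath t" "pair_perm q = id"
      using wreath_comp[OF flip_wreath(1)[OF j(1)] Suc(3)] flip_wreath(2)[OF j(1)] Suc(4) by (simp_all add: q_def)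
    have pq: "p = ?f \<circ> q" by (simp add: q_def o_assoc)
    have "q (2 * i) = p (2 * i)" if i: "i \<in> {1..t}" "i \<noteq> j" for i
    proof -
      have "p (2 * i) = 2 * i - 1 \<or> p (2 * i) = 2 * i"
        using pairs_image(2)[OF Suc(3) i(1)] Suc(4) by auto
      moreover have "1 \<le> i" "1 \<le> j" using i(1) j(1) by auto
      ultimately have "p (2 * i) \<noteq> 2 * j - 1" "p (2 * i) \<noteq> 2 * j" using i(2) by presburger+
      then show ?thesis by (simp add: q_def transpose_apply_other)
    qed
    moreover have "q (2 * j) = 2 * j" using pj by (simp add: q_def)
    ultimately have "i \<in> {1..t} \<and> q (2 * i) \<noteq> 2 * i \<longleftrightarrow> i \<in> {1..t} \<and> p (2 * i) \<noteq> 2 * i \<and> i \<noteq> j" for i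
      by (cases "i = j") auto
    then have "{i \<in> {1..t}. q (2 * i) \<noteq> 2 * i} = {i \<in> {1..t}. p (2 * i) \<noteq> 2 * i} - {j}" by blast
    then have "n = card {i \<in> {1..t}. q (2 * i) \<noteq> 2 * i}" using Suc(2) j by (simp add: card_Diff_singleton)
    from comp[OF flip_wreath(1)[OF j(1)] q(1) flip[OF j(1)] Suc(1)[OF this q]] show ?case
      using pq by simp
  qed
  let ?\<sigma> = "pair_perm p"
  have \<sigma>: "?\<sigma> permutes {1..t}" by (rule pair_perm_permutes[OF p])
  have inv: "inv_into UNIV ?\<sigma> permutes {1..t}" by (rule permutes_inv[OF \<sigma>])
  define q where "q = pair_lift (inv_into UNIV ?\<sigma>) \<circ> p"
  have q: "q \<in> wreath t" "pair_perm q = id"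
    using wreath_comp[OF pair_lift_wreath(1)[OF inv] p] pair_lift_wreath(2)[OF inv] permutes_inv_o(2)[OF \<sigma>]
    by (simp_all add: q_def)
  have "pair_lift ?\<sigma> \<circ> pair_lift (inv_into UNIV ?\<sigma>) = id"
    using pair_lift_comp[of "inv_into UNIV ?\<sigma>" ?\<sigma>, OF permutes_pos[OF inv]] permutes_inv_o(1)[OF \<sigma>] pair_lift_id by simp
  then have "p = pair_lift ?\<sigma> \<circ> q" by (simp add: q_def o_assoc)
  then show ?thesis
    using comp[OF pair_lift_wreath(1)[OF \<sigma>] q(1) lift[OF \<sigma>] kernel[OF q]] by simp
qed

context scalars begin

lemma wreath_char_closed [simp]: "wreath_char K \<epsilon> \<delta> p \<in> carrier K"
  by (simp add: wreath_char_def)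

lemma wreath_char_id: "wreath_char K \<epsilon> \<delta> id = \<one>\<^bsub>K\<^esub>"
proof -
  have "pair_perm id = id" by (auto simp: pair_perm_def fun_eq_iff)
  then show ?thesis by (simp add: wreath_char_def sgn_char_psign evenperm_id)
qed

lemma wreath_char_comp:
  assumes "p \<in> wreath t" "q \<in> wreath t"
  shows "wreath_char K \<epsilon> \<delta> (p \<circ> q) = wreath_char K \<epsilon> \<delta> p \<otimes>\<^bsub>K\<^esub> wreath_char K \<epsilon> \<delta> q"
proof -
  have "permutation p" "permutation q" "permutation (pair_perm p)" "permutation (pair_perm q)"
    using assms pair_perm_permutes[OF assms(1)] pair_perm_permutes[OF assms(2)]
    by (auto simp: wreath_def permutation_permutes)
  then show ?thesis
    by (simp add: wreath_char_def wreath_comp(2)[OF assms] sgn_char_comp m_ac)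
qed

lemma wreath_char_flip:
  assumes "j \<in> {1..t}"
  shows "wreath_char K \<epsilon> \<delta> (transpose (2 * j - 1) (2 * j)) = psign \<epsilon>"
proof -
  have "2 * j - 1 \<noteq> 2 * j" using assms by auto
  then show ?thesis
    unfolding wreath_char_def flip_wreath(2)[OF assms] by (simp add: sgn_char_psign evenperm_swap evenperm_id)
qed

lemma wreath_char_swap:
  assumes "j > 0"
  shows "wreath_char K \<epsilon> \<delta> (pair_lift (transpose j (Suc j))) = psign \<delta>"
proof -
  have "transpose j (Suc j) permutes {1..Suc j}" using assms by (intro permutes_swap_id) auto
  then have "pair_perm (pair_lift (transpose j (Suc j))) = transpose j (Suc j)" by (rule pair_lift_wreath)
  moreover have "evenperm (pair_lift (transpose j (Suc j)))"
    unfolding pair_lift_adjacent[OF assms] using assms by (simp add: evenperm_comp permutation_swap_id evenperm_swap)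
  ultimately show ?thesis by (simp add: wreath_char_def sgn_char_psign evenperm_swap)
qed

end

section \<open>From contractions to modules over the Brauer category\<close>

text \<open>
  Label sets \<open>X\<close> with vector spaces \<open>P X\<close>, on which \<open>rl X f\<close> changes the labels along \<open>f\<close> and
  \<open>ct X u v\<close> removes the labels \<open>u\<close> and \<open>v\<close>. The last three axioms are the relations between
  the morphisms \<open>g\<^sub>u\<^sub>,\<^sub>v\<close> in the category with the twist \<open>(\<epsilon>; \<delta>)\<close>, together with
  naturality in the labels.
\<close>

locale contraction_system = scalars K for K :: "'k ring" +
  fixes \<epsilon> \<delta> :: parity
    and P :: "'a set \<Rightarrow> ('k, 'p) module"
    and rl :: "'a set \<Rightarrow> ('a \<Rightarrow> 'a) \<Rightarrow> 'p \<Rightarrow> 'p"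
    and ct :: "'a set \<Rightarrow> 'a \<Rightarrow> 'a \<Rightarrow> 'p \<Rightarrow> 'p"
  assumes vspace_P: "finite X \<Longrightarrow> Module.module K (P X)"
    and rl_lin: "\<lbrakk>finite X; inj_on f X\<rbrakk> \<Longrightarrow> rl X f \<in> lin_maps K (P X) (P (f ` X))"
    and rl_cong: "\<lbrakk>finite X; inj_on f X; \<And>y. y \<in> X \<Longrightarrow> f y = g y; x \<in> carrier (P X)\<rbrakk> \<Longrightarrow> rl X f x = rl X g x"
    and rl_ident: "\<lbrakk>finite X; \<And>y. y \<in> X \<Longrightarrow> f y = y; x \<in> carrier (P X)\<rbrakk> \<Longrightarrow> rl X f x = x"
    and rl_comp: "\<lbrakk>finite X; inj_on f X; inj_on g (f ` X); x \<in> carrier (P X)\<rbrakk>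
      \<Longrightarrow> rl (f ` X) g (rl X f x) = rl X (\<lambda>y. g (f y)) x"
    and ct_lin: "\<lbrakk>finite X; u \<in> X; v \<in> X; u \<noteq> v\<rbrakk> \<Longrightarrow> ct X u v \<in> lin_maps K (P X) (P (X - {u, v}))"
    and ct_flip: "\<lbrakk>finite X; u \<in> X; v \<in> X; u \<noteq> v; x \<in> carrier (P X)\<rbrakk>
      \<Longrightarrow> ct X v u x = psign \<epsilon> \<odot>\<^bsub>P (X - {u, v})\<^esub> ct X u v x"
    and ct_commute: "\<lbrakk>finite X; {u, v, w, z} \<subseteq> X; distinct [u, v, w, z]; x \<in> carrier (P X)\<rbrakk>
      \<Longrightarrow> ct (X - {u, v}) w z (ct X u v x) =
          psign \<delta> \<odot>\<^bsub>P (X - {u, v} - {w, z})\<^esub> ct (X - {w, z}) u v (ct X w z x)"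
    and ct_equivariant: "\<lbrakk>finite X; u \<in> X; v \<in> X; u \<noteq> v; inj_on f X; x \<in> carrier (P X)\<rbrakk>
      \<Longrightarrow> rl (X - {u, v}) f (ct X u v x) = ct (f ` X) (f u) (f v) (rl X f x)"
begin

primrec ct_pairs :: "nat \<Rightarrow> 'a set \<Rightarrow> (nat \<Rightarrow> 'a) \<Rightarrow> 'p \<Rightarrow> 'p" where
  "ct_pairs 0 X h x = x"
| "ct_pairs (Suc t) X h x =
    ct_pairs t (X - {h (2 * t + 1), h (2 * t + 2)}) h (ct X (h (2 * t + 1)) (h (2 * t + 2)) x)"

definition pairs_in :: "nat \<Rightarrow> 'a set \<Rightarrow> (nat \<Rightarrow> 'a) \<Rightarrow> bool" where
  "pairs_in t X h \<longleftrightarrow> finite X \<and> inj_on h {1..2 * t} \<and> h ` {1..2 * t} \<subseteq> X"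

lemma pairs_Suc: "{1..2 * Suc t} = insert (2 * t + 1) (insert (2 * t + 2) {1..2 * t})"
  by auto

lemma pairs_in_Suc:
  assumes "pairs_in (Suc t) X h"
  shows "finite X" "h (2 * t + 1) \<in> X" "h (2 * t + 2) \<in> X" "h (2 * t + 1) \<noteq> h (2 * t + 2)"
    "pairs_in t (X - {h (2 * t + 1), h (2 * t + 2)}) h"
    "X - h ` {1..2 * Suc t} = X - {h (2 * t + 1), h (2 * t + 2)} - h ` {1..2 * t}"
proof -
  have n: "insert (2 * t + 1) (insert (2 * t + 2) {1..2 * t}) - {2 * t + 1} = insert (2 * t + 2) {1..2 * t}"
    "insert (2 * t + 2) {1..2 * t} - {2 * t + 2} = {1..2 * t}" by auto
  have h: "finite X" "inj_on h {1..2 * t}" "h (2 * t + 1) \<notin> h ` insert (2 * t + 2) {1..2 * t}"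
    "h (2 * t + 2) \<notin> h ` {1..2 * t}" "h (2 * t + 1) \<in> X" "h (2 * t + 2) \<in> X" "h ` {1..2 * t} \<subseteq> X"
    using assms unfolding pairs_in_def pairs_Suc inj_on_insert n by auto
  show "finite X" "h (2 * t + 1) \<in> X" "h (2 * t + 2) \<in> X" "h (2 * t + 1) \<noteq> h (2 * t + 2)"
    "pairs_in t (X - {h (2 * t + 1), h (2 * t + 2)}) h"
    using h unfolding pairs_in_def by blast+
  show "X - h ` {1..2 * Suc t} = X - {h (2 * t + 1), h (2 * t + 2)} - h ` {1..2 * t}"
    unfolding pairs_Suc by blast
qed

lemma ct_pairs_lin:
  assumes "pairs_in t X h"
  shows "ct_pairs t X h \<in> lin_maps K (P X) (P (X - h ` {1..2 * t}))"
  using assms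
proof (induction t arbitrary: X)
  case 0
  have "ct_pairs 0 X h = (\<lambda>x. x)" by (rule ext) simp
  then show ?case by (simp add: lin_ident)
next
  case (Suc t)
  note e = pairs_in_Suc[OF Suc.prems]
  have "ct_pairs (Suc t) X h = (\<lambda>x. ct_pairs t (X - {h (2 * t + 1), h (2 * t + 2)}) h (ct X (h (2 * t + 1)) (h (2 * t + 2)) x))"
    by (rule ext) simp
  then show ?case unfolding e(6) using lin_comp[OF ct_lin[OF e(1-4)] Suc.IH[OF e(5)]] by simp
qed

lemma ct_pairs_cong:
  assumes "\<And>i. i \<in> {1..2 * t} \<Longrightarrow> h i = h' i"
  shows "ct_pairs t X h x = ct_pairs t X h' x"
  using assms by (induction t arbitrary: X x) auto

lemma ct_pairs_rl:
  assumes "pairs_in t X h" "inj_on f X" "x \<in> carrier (P X)"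
  shows "rl (X - h ` {1..2 * t}) f (ct_pairs t X h x) = ct_pairs t (f ` X) (\<lambda>i. f (h i)) (rl X f x)"
  using assms
proof (induction t arbitrary: X x)
  case 0
  then show ?case by simp
next
  case (Suc t)
  note e = pairs_in_Suc[OF Suc.prems(1)]
  let ?u = "h (2 * t + 1)" and ?v = "h (2 * t + 2)"
  have f': "inj_on f (X - {?u, ?v})" using Suc.prems(2) by (rule inj_on_subset) auto
  have im: "f ` (X - {?u, ?v}) = f ` X - {f ?u, f ?v}"
    using inj_on_image_set_diff[OF Suc.prems(2), of X "{?u, ?v}"] e(2,3) by simp
  have "ct X ?u ?v x \<in> carrier (P (X - {?u, ?v}))"
    by (rule lin_closed[OF ct_lin[OF e(1-4)] Suc.prems(3)])
  note IH = Suc.IH[OF e(5) f' this]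
  show ?case
    unfolding e(6) using IH ct_equivariant[OF e(1-4) Suc.prems(2,3)] im by simp
qed

lemma ct_pairs_add:
  "ct_pairs (r + s) X h x = ct_pairs r (X - h ` {2 * r + 1..2 * r + 2 * s}) h (ct_pairs s X (\<lambda>i. h (i + 2 * r)) x)"
proof (induction s arbitrary: X x)
  case 0
  then show ?case by simp
next
  case (Suc s)
  have set: "{2 * r + 1..2 * r + 2 * Suc s} =
      insert (2 * (r + s) + 1) (insert (2 * (r + s) + 2) {2 * r + 1..2 * r + 2 * s})" by auto
  have idx: "2 * s + 1 + 2 * r = 2 * (r + s) + 1" "2 * s + 2 + 2 * r = 2 * (r + s) + 2" by auto
  have "X - h ` {2 * r + 1..2 * r + 2 * Suc s} =
      X - {h (2 * (r + s) + 1), h (2 * (r + s) + 2)} - h ` {2 * r + 1..2 * r + 2 * s}"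
    unfolding set by auto
  then show ?case
    using Suc.IH[of "X - {h (2 * (r + s) + 1), h (2 * (r + s) + 2)}"]
    by (simp only: add_Suc_right ct_pairs.simps idx)
qed

lemma ct_pairs_closed: "pairs_in t X h \<Longrightarrow> x \<in> carrier (P X) \<Longrightarrow> ct_pairs t X h x \<in> carrier (P (X - h ` {1..2 * t}))"
  by (rule lin_closed[OF ct_pairs_lin])

lemma ct_pairs_flip:
  assumes "j \<in> {1..t}" "pairs_in t X h" "x \<in> carrier (P X)"
  shows "ct_pairs t X (h \<circ> transpose (2 * j - 1) (2 * j)) x =
    psign \<epsilon> \<odot>\<^bsub>P (X - h ` {1..2 * t})\<^esub> ct_pairs t X h x"
  using assms
proof (induction t arbitrary: X x)
  case 0
  then show ?case by simp
next
  case (Suc t)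
  note e = pairs_in_Suc[OF Suc.prems(2)]
  let ?u = "h (2 * t + 1)" and ?v = "h (2 * t + 2)" and ?p = "transpose (2 * j - 1) (2 * j)"
  have cl: "ct X ?u ?v x \<in> carrier (P (X - {?u, ?v}))"
    by (rule lin_closed[OF ct_lin[OF e(1-4)] Suc.prems(3)])
  show ?case
  proof (cases "j = Suc t")
    case True
    have p: "(h \<circ> ?p) (2 * t + 1) = ?v" "(h \<circ> ?p) (2 * t + 2) = ?u"
      by (simp_all add: True)
    have cong: "ct_pairs t Y (h \<circ> ?p) y = ct_pairs t Y h y" for Y y
      by (rule ct_pairs_cong) (simp add: True transpose_apply_other)
    have com: "X - {?v, ?u} = X - {?u, ?v}" by auto
    show ?thesis
      unfolding e(6) ct_pairs.simps cong p com ct_flip[OF e(1-4) Suc.prems(3)]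
      by (rule lin_smult[OF ct_pairs_lin[OF e(5)] psign_simps(1) cl])
  next
    case False
    then have j: "j \<in> {1..t}" using Suc.prems(1) by auto
    then have "2 * t + 1 \<noteq> 2 * j - 1" "2 * t + 1 \<noteq> 2 * j" "2 * t + 2 \<noteq> 2 * j - 1" "2 * t + 2 \<noteq> 2 * j"
      by auto
    then have p: "(h \<circ> ?p) (2 * t + 1) = ?u" "(h \<circ> ?p) (2 * t + 2) = ?v"
      by (simp_all add: transpose_apply_other)
    show ?thesis
      unfolding e(6) ct_pairs.simps p by (rule Suc.IH[OF j e(5) cl])
  qed
qed

lemma ct_pairs_swap:
  assumes "0 < j" "j < t" "pairs_in t X h" "x \<in> carrier (P X)"
  shows "ct_pairs t X (h \<circ> pair_lift (transpose j (Suc j))) x =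
    psign \<delta> \<odot>\<^bsub>P (X - h ` {1..2 * t})\<^esub> ct_pairs t X h x"
  using assms
proof (induction t arbitrary: X x)
  case 0
  then show ?case by simp
next
  case (Suc t)
  note e = pairs_in_Suc[OF Suc.prems(3)]
  let ?u = "h (2 * t + 1)" and ?v = "h (2 * t + 2)" and ?p = "pair_lift (transpose j (Suc j))"
  have cl: "ct X ?u ?v x \<in> carrier (P (X - {?u, ?v}))"
    by (rule lin_closed[OF ct_lin[OF e(1-4)] Suc.prems(4)])
  have p_gen: "?p (2 * i + 1) = 2 * transpose j (Suc j) (Suc i) - 1" "?p (2 * i + 2) = 2 * transpose j (Suc j) (Suc i)" for i
    using pair_lift_simps(3)[of "transpose j (Suc j)" i] pair_lift_simps(2)[of "transpose j (Suc j)" "Suc i"] by simp_all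
  show ?case
  proof (cases "j = t")
    case True
    then obtain s where t: "t = Suc s" using Suc.prems(1) by (cases t) auto
    note e' = pairs_in_Suc[OF e(5)[unfolded t], folded t]
    let ?w = "h (2 * s + 1)" and ?z = "h (2 * s + 2)"
    have p: "(h \<circ> ?p) (2 * t + 1) = ?w" "(h \<circ> ?p) (2 * t + 2) = ?z"
      "(h \<circ> ?p) (2 * s + 1) = ?u" "(h \<circ> ?p) (2 * s + 2) = ?v"
      unfolding o_apply p_gen by (simp_all add: True t)
    have "?p i = i" if "i \<in> {1..2 * s}" for i
    proof -
      have "(i + 1) div 2 \<noteq> j" "(i + 1) div 2 \<noteq> Suc j" using that by (auto simp: True t)
      then have "?p i = pair_lift id i" by (simp add: pair_lift_def transpose_apply_other)
      then show ?thesis unfolding pair_lift_id id_apply .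
    qed
    then have cong: "ct_pairs s Y (h \<circ> ?p) y = ct_pairs s Y h y" for Y y
      by (intro ct_pairs_cong) simp
    have X: "{?w, ?z, ?u, ?v} \<subseteq> X" "distinct [?w, ?z, ?u, ?v]"
      using e(2-4) e'(2-4) by auto
    have com: "X - {?w, ?z} - {?u, ?v} = X - {?u, ?v} - {?w, ?z}" by auto
    have "ct_pairs (Suc t) X (h \<circ> ?p) x = ct_pairs s (X - {?u, ?v} - {?w, ?z}) h (ct (X - {?w, ?z}) ?u ?v (ct X ?w ?z x))"
      by (simp only: t ct_pairs.simps cong[unfolded t] p[unfolded t] com[unfolded t])
    also have "\<dots> = ct_pairs s (X - {?u, ?v} - {?w, ?z}) h
        (psign \<delta> \<odot>\<^bsub>P (X - {?u, ?v} - {?w, ?z})\<^esub> ct (X - {?u, ?v}) ?w ?z (ct X ?u ?v x))"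
      using ct_commute[OF e(1) X Suc.prems(4)] by (simp only: com)
    also have "\<dots> = psign \<delta> \<odot>\<^bsub>P (X - {?u, ?v} - {?w, ?z} - h ` {1..2 * s})\<^esub>
        ct_pairs s (X - {?u, ?v} - {?w, ?z}) h (ct (X - {?u, ?v}) ?w ?z (ct X ?u ?v x))"
      by (rule lin_smult[OF ct_pairs_lin[OF e'(5)] psign_simps(1) lin_closed[OF ct_lin[OF e'(1-4)] cl]])
    finally show ?thesis
      unfolding e(6) e'(6)[folded t] by (simp only: t ct_pairs.simps)
  next
    case False
    then have j: "j < t" using Suc.prems(2) by simp
    then have p: "(h \<circ> ?p) (2 * t + 1) = ?u" "(h \<circ> ?p) (2 * t + 2) = ?v"
      unfolding o_apply p_gen by (simp_all add: transpose_apply_other)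
    show ?thesis
      unfolding e(6) ct_pairs.simps p by (rule Suc.IH[OF Suc.prems(1) j e(5) cl])
  qed
qed

lemma pairs_in_permutes:
  assumes "p permutes {1..2 * t}" "pairs_in t X h"
  shows "pairs_in t X (h \<circ> p)" "(h \<circ> p) ` {1..2 * t} = h ` {1..2 * t}"
proof -
  show im: "(h \<circ> p) ` {1..2 * t} = h ` {1..2 * t}"
    unfolding image_comp[symmetric] permutes_image[OF assms(1)] ..
  have "inj_on (h \<circ> p) {1..2 * t}"
    using assms permutes_image[OF assms(1)] permutes_inj_on[OF assms(1)] by (intro comp_inj_on) (auto simp: pairs_in_def)
  then show "pairs_in t X (h \<circ> p)" using assms(2) im by (simp add: pairs_in_def)
qed

text \<open>
  This is the compatibility with the relations that define the twisted category. It holds for the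
  generators by \<open>ct_pairs_flip\<close> and \<open>ct_pairs_swap\<close>, and both sides are multiplicative in \<open>p\<close>.
\<close>

lemma ct_pairs_wreath:
  assumes "p \<in> wreath t" "pairs_in t X h" "x \<in> carrier (P X)"
  shows "ct_pairs t X (h \<circ> p) x = wreath_char K \<epsilon> \<delta> p \<odot>\<^bsub>P (X - h ` {1..2 * t})\<^esub> ct_pairs t X h x"
  using assms
proof (induction arbitrary: h rule: wreath_induct)
  case id
  have fin: "finite (X - h ` {1..2 * t})" using id by (simp add: pairs_in_def)
  show ?case
    unfolding wreath_char_id comp_id
    by (rule module.smult_one[OF vspace_P[OF fin] ct_pairs_closed[OF id], symmetric])
next
  case (flip j)
  show ?case unfolding wreath_char_flip[OF flip(1)] by (rule ct_pairs_flip[OF flip])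
next
  case (swap j)
  show ?case unfolding wreath_char_swap[OF swap(1)] by (rule ct_pairs_swap[OF swap])
next
  case (comp p q)
  define R where "R = X - h ` {1..2 * t}"
  have "finite R" using comp.prems by (simp add: pairs_in_def R_def)
  then interpret Q: Module.module K "P R" by (rule vspace_P)
  have p: "p permutes {1..2 * t}" using comp.hyps(1) by (simp add: wreath_def)
  note e = pairs_in_permutes[OF p comp.prems(1)]
  have "ct_pairs t X (h \<circ> (p \<circ> q)) x = wreath_char K \<epsilon> \<delta> q \<odot>\<^bsub>P R\<^esub> ct_pairs t X (h \<circ> p) x"
    using comp.IH(2)[OF e(1) comp.prems(2)] unfolding e(2) R_def o_assoc .
  also have "ct_pairs t X (h \<circ> p) x = wreath_char K \<epsilon> \<delta> p \<odot>\<^bsub>P R\<^esub> ct_pairs t X h x"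
    using comp.IH(1)[OF comp.prems] unfolding R_def .
  finally show ?case
    using ct_pairs_closed[OF comp.prems, folded R_def] unfolding R_def[symmetric] wreath_char_comp[OF comp.hyps]
    by (simp add: Q.smult_assoc1[symmetric] m_comm)
qed

end

lemma Plus_mem_iff: "Inl x \<in> A \<amalg> B \<longleftrightarrow> x \<in> A" "Inr y \<in> A \<amalg> B \<longleftrightarrow> y \<in> B"
  by auto

lemma brauer_simps:
  "ob brauer = {X. finite X}"
  "f \<in> arr brauer X Y \<longleftrightarrow> (\<exists>t. card Y = card X + 2 * t \<and>
     f \<in> extensional (X \<amalg> {1..2 * t}) \<and> bij_betw f (X \<amalg> {1..2 * t}) Y)"
  "ident brauer X = (\<lambda>z\<in>X \<amalg> {}. case z of Inl x \<Rightarrow> x | Inr i \<Rightarrow> undefined)"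
  by (simp_all add: brauer_def)

lemma brauer_arrD:
  assumes "f \<in> arr brauer X Y"
  shows "card Y = card X + 2 * half_diff X Y" "bij_betw f (X \<amalg> {1..2 * half_diff X Y}) Y"
    "f \<in> extensional (X \<amalg> {1..2 * half_diff X Y})"
  using assms by (auto simp: brauer_simps half_diff_def)

lemma brauer_arrI:
  assumes "card Y = card X + 2 * t" "f \<in> extensional (X \<amalg> {1..2 * t})" "bij_betw f (X \<amalg> {1..2 * t}) Y"
  shows "f \<in> arr brauer X Y"
  using assms by (auto simp: brauer_simps)

lemma half_diff_eq: "card Y = card X + 2 * t \<Longrightarrow> half_diff X Y = t"
  by (simp add: half_diff_def)

lemma wreath_act_apply:
  "y \<in> X \<Longrightarrow> wreath_act X Y f p (Inl y) = f (Inl y)"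
  "i \<in> {1..2 * half_diff X Y} \<Longrightarrow> wreath_act X Y f p (Inr i) = f (Inr (p i))"
  by (auto simp: wreath_act_def)

lemma wreath_act_arr:
  assumes f: "f \<in> arr brauer X Y" and p: "p permutes {1..2 * half_diff X Y}"
  shows "wreath_act X Y f p \<in> arr brauer X Y"
proof -
  let ?D = "X \<amalg> {1..2 * half_diff X Y}"
  have "bij_betw (map_sum id p) ?D ?D"
  proof (rule bij_betwI')
    fix x y :: "'a + nat"
    show "map_sum id p x = map_sum id p y \<longleftrightarrow> x = y"
      by (rule inj_eq[OF sum.inj_map[OF inj_on_id permutes_inj[OF p]]])
  next
    fix x assume "x \<in> ?D"
    then show "map_sum id p x \<in> ?D"
      using permutes_in_image[OF p] by (cases x) (simp_all add: Plus_def image_iff)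
  next
    fix y assume y: "y \<in> ?D"
    show "\<exists>x\<in>?D. y = map_sum id p x"
    proof (cases y)
      case (Inl a)
      then show ?thesis using y by (intro bexI[of _ "Inl a"]) auto
    next
      case (Inr i)
      then have "i \<in> {1..2 * half_diff X Y}" using y by auto
      then have "inv_into UNIV p i \<in> {1..2 * half_diff X Y}" "p (inv_into UNIV p i) = i"
        using permutes_in_image[OF permutes_inv[OF p]] permutes_inverses(1)[OF p] by auto
      then show ?thesis using Inr by (intro bexI[of _ "Inr (inv_into UNIV p i)"]) auto
    qed
  qed
  then have "bij_betw (f \<circ> map_sum id p) ?D Y" using brauer_arrD(2)[OF f] by (rule bij_betw_trans)
  then have "bij_betw (wreath_act X Y f p) ?D Y"
    by (rule bij_betw_cong[THEN iffD1, rotated]) (simp add: wreath_act_def)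
  moreover have "wreath_act X Y f p \<in> extensional ?D" by (simp add: wreath_act_def)
  ultimately show ?thesis using brauer_arrD(1)[OF f] by (intro brauer_arrI)
qed

lemma cmp_arr:
  assumes f: "f \<in> arr brauer Y X" and g: "g \<in> arr brauer Z Y"
  shows "cmp brauer Z Y X f g \<in> arr brauer Z X" and "half_diff Z X = half_diff Z Y + half_diff Y X"
    and "z \<in> Z \<Longrightarrow> cmp brauer Z Y X f g (Inl z) = f (Inl (g (Inl z)))"
    and "i \<in> {1..2 * half_diff Z Y} \<Longrightarrow> cmp brauer Z Y X f g (Inr i) = f (Inl (g (Inr i)))"
    and "i \<in> {1..2 * half_diff Y X} \<Longrightarrow> cmp brauer Z Y X f g (Inr (i + 2 * half_diff Z Y)) = f (Inr i)"
proof -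
  let ?c = "cmp brauer Z Y X f g" and ?r = "half_diff Z Y" and ?s = "half_diff Y X"
  have c: "?c = (\<lambda>z\<in>Z \<amalg> {1..2 * (?r + ?s)}. (case z of
             Inl x \<Rightarrow> f (Inl (g (Inl x)))
           | Inr i \<Rightarrow> if i \<le> 2 * ?r then f (Inl (g (Inr i))) else f (Inr (i - 2 * ?r))))"
    by (simp add: brauer_def Let_def)
  show l: "?c (Inl z) = f (Inl (g (Inl z)))" if "z \<in> Z" for z using that by (auto simp: c)
  show m: "?c (Inr i) = f (Inl (g (Inr i)))" if "i \<in> {1..2 * ?r}" for i using that by (auto simp: c)
  show r: "?c (Inr (i + 2 * ?r)) = f (Inr i)" if "i \<in> {1..2 * ?s}" for i using that by (auto simp: c)
  have card: "card X = card Z + 2 * (?r + ?s)" using brauer_arrD(1)[OF f] brauer_arrD(1)[OF g] by simp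
  then show "half_diff Z X = ?r + ?s" by (rule half_diff_eq)
  note bf = brauer_arrD(2)[OF f] and bg = brauer_arrD(2)[OF g]
  have "bij_betw ?c (Z \<amalg> {1..2 * (?r + ?s)}) X"
  proof -
    define h where "h = (\<lambda>z. case z of Inl x \<Rightarrow> Inl (g (Inl x))
      | Inr i \<Rightarrow> if i \<le> 2 * ?r then Inl (g (Inr i)) else Inr (i - 2 * ?r))"
    have gY: "g z \<in> Y" if "z \<in> Z \<amalg> {1..2 * ?r}" for z using bij_betwE[OF bg] that by blast
    have ginj: "g z = g z' \<longleftrightarrow> z = z'" if "z \<in> Z \<amalg> {1..2 * ?r}" "z' \<in> Z \<amalg> {1..2 * ?r}" for z z'
      using inj_on_eq_iff[OF bij_betw_imp_inj_on[OF bg] that] .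
    have "bij_betw h (Z \<amalg> {1..2 * (?r + ?s)}) (Y \<amalg> {1..2 * ?s})"
    proof (rule bij_betwI')
      fix a b assume "a \<in> Z \<amalg> {1..2 * (?r + ?s)}" "b \<in> Z \<amalg> {1..2 * (?r + ?s)}"
      then show "h a = h b \<longleftrightarrow> a = b"
        using ginj[of a b] by (cases a; cases b) (auto simp: h_def Plus_mem_iff)
    next
      fix a assume "a \<in> Z \<amalg> {1..2 * (?r + ?s)}"
      then show "h a \<in> Y \<amalg> {1..2 * ?s}" using gY[of a] by (cases a) (auto simp: h_def Plus_mem_iff)
    next
      fix b assume b: "b \<in> Y \<amalg> {1..2 * ?s}"
      show "\<exists>a\<in>Z \<amalg> {1..2 * (?r + ?s)}. b = h a"
      proof (cases b)
        case (Inl y)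
        then have "y \<in> g ` (Z \<amalg> {1..2 * ?r})" using b bij_betw_imp_surj_on[OF bg] by auto
        then obtain a where "a \<in> Z \<amalg> {1..2 * ?r}" "y = g a" by blast
        then show ?thesis using Inl by (intro bexI[of _ a]) (cases a; auto simp: h_def)+
      next
        case (Inr i)
        then show ?thesis using b by (intro bexI[of _ "Inr (i + 2 * ?r)"]) (auto simp: h_def)
      qed
    qed
    then have bij: "bij_betw (f \<circ> h) (Z \<amalg> {1..2 * (?r + ?s)}) X" using bf by (rule bij_betw_trans)
    have eq: "(f \<circ> h) z = ?c z" if "z \<in> Z \<amalg> {1..2 * (?r + ?s)}" for z
      using that by (cases z) (auto simp: h_def c)
    show ?thesis
      using bij by (rule bij_betw_cong[THEN iffD1, rotated]) (rule eq)
  qed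
  note bij = this
  have "?c \<in> extensional (Z \<amalg> {1..2 * (?r + ?s)})" unfolding c by (rule restrict_extensional)
  then show "?c \<in> arr brauer Z X" using bij by (rule brauer_arrI[OF card])
qed

context contraction_system begin

text \<open>
  The action of a bijection \<open>f : Y \<amalg> {1..2t} \<rightarrow> X\<close>: contract the pairs, last pair first, and carry
  the remaining labels back to \<open>Y\<close>. The order matches the composition, which places the pairs of
  the morphism that acts first behind the others.
\<close>

definition bact :: "'a set \<Rightarrow> 'a set \<Rightarrow> ('a + nat \<Rightarrow> 'a) \<Rightarrow> 'p \<Rightarrow> 'p" where
  "bact X Y f x = rl ((\<lambda>y. f (Inl y)) ` Y) (inv_into Y (\<lambda>y. f (Inl y)))
     (ct_pairs (half_diff Y X) X (\<lambda>i. f (Inr i)) x)"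

lemma arr_parts:
  assumes "finite X" "f \<in> arr brauer Y X"
  shows "pairs_in (half_diff Y X) X (\<lambda>i. f (Inr i))"
    and "inj_on (\<lambda>y. f (Inl y)) Y"
    and "X - (\<lambda>i. f (Inr i)) ` {1..2 * half_diff Y X} = (\<lambda>y. f (Inl y)) ` Y"
    and "(\<lambda>y. f (Inl y)) ` Y \<subseteq> X"
proof -
  let ?t = "half_diff Y X"
  have b: "inj_on f (Y \<amalg> {1..2 * ?t})" "f ` (Y \<amalg> {1..2 * ?t}) = X"
    using brauer_arrD(2)[OF assms(2)] by (auto simp: bij_betw_def)
  have D: "Y \<amalg> {1..2 * ?t} = Inl ` Y \<union> Inr ` {1..2 * ?t}" by (auto simp: Plus_def)
  have X: "X = (\<lambda>y. f (Inl y)) ` Y \<union> (\<lambda>i. f (Inr i)) ` {1..2 * ?t}"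
    using b(2) unfolding D image_Un image_image by simp
  have aux: "A - C = B" if "A = B \<union> C" "B \<inter> C = {}" for A B C :: "'a set" using that by blast
  have aux': "B \<subseteq> A" "C \<subseteq> A" if "A = B \<union> C" for A B C :: "'a set" using that by blast+
  have inj: "f a = f b \<longleftrightarrow> a = b" if "a \<in> Y \<amalg> {1..2 * ?t}" "b \<in> Y \<amalg> {1..2 * ?t}" for a b
    using inj_on_eq_iff[OF b(1) that] .
  have dis: "f (Inl y) \<noteq> f (Inr i)" if "y \<in> Y" "i \<in> {1..2 * ?t}" for y i
    using inj[OF InlI[OF that(1)] InrI[OF that(2)]] by simp
  have "inj_on (\<lambda>i. f (Inr i)) {1..2 * ?t}" by (rule inj_onI) (simp only: inj[OF InrI InrI] sum.inject)
  then show "pairs_in ?t X (\<lambda>i. f (Inr i))" using assms(1) aux'(2)[OF X] unfolding pairs_in_def by blast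
  show "inj_on (\<lambda>y. f (Inl y)) Y" by (rule inj_onI) (simp only: inj[OF InlI InlI] sum.inject)
  show "X - (\<lambda>i. f (Inr i)) ` {1..2 * ?t} = (\<lambda>y. f (Inl y)) ` Y"
    by (rule aux[OF X]) (use dis in blast)
  show "(\<lambda>y. f (Inl y)) ` Y \<subseteq> X" using aux'(1)[OF X] .
qed

lemma inv_into_image: "inj_on g Y \<Longrightarrow> inv_into Y g ` g ` Y = Y"
  by (force simp: image_image)

lemma bact_lin:
  assumes "finite X" "f \<in> arr brauer Y X"
  shows "bact X Y f \<in> lin_maps K (P X) (P Y)"
proof -
  note a = arr_parts[OF assms]
  have fin: "finite ((\<lambda>y. f (Inl y)) ` Y)" using a(4) assms(1) by (rule finite_subset)
  have "rl ((\<lambda>y. f (Inl y)) ` Y) (inv_into Y (\<lambda>y. f (Inl y))) \<in> lin_maps K (P ((\<lambda>y. f (Inl y)) ` Y)) (P Y)"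
    using rl_lin[OF fin inj_on_inv_into, of "\<lambda>y. f (Inl y)" Y] inv_into_image[OF a(2)] by simp
  from lin_comp[OF ct_pairs_lin[OF a(1), unfolded a(3)] this] show ?thesis
    unfolding bact_def[abs_def] .
qed

lemma bact_ident:
  assumes X: "finite X" and x: "x \<in> carrier (P X)"
  shows "bact X X (ident brauer X) x = x"
proof -
  let ?g = "\<lambda>y. ident brauer X (Inl y)"
  have g: "?g y = y" if "y \<in> X" for y using that by (auto simp: brauer_simps)
  then have im: "?g ` X = X" and inj: "inj_on ?g X" by (auto simp: inj_on_def)
  have "half_diff X X = 0" by (simp add: half_diff_def)
  moreover have "inv_into X ?g y = y" if "y \<in> X" for y
    using inv_into_f_f[OF inj that] g[OF that] by simp
  ultimately show ?thesis unfolding bact_def im using rl_ident[OF X _ x] by simp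
qed

lemma bact_wreath:
  assumes "finite X" "f \<in> arr brauer Y X" "p \<in> wreath (half_diff Y X)" "x \<in> carrier (P X)"
  shows "bact X Y (wreath_act Y X f p) x = wreath_char K \<epsilon> \<delta> p \<odot>\<^bsub>P Y\<^esub> bact X Y f x"
proof -
  note a = arr_parts[OF assms(1,2)]
  let ?F = "\<lambda>y. f (Inl y)" and ?t = "half_diff Y X" and ?g = "wreath_act Y X f p"
  have fin: "finite (?F ` Y)" using a(4) assms(1) by (rule finite_subset)
  have im: "(\<lambda>y. ?g (Inl y)) ` Y = ?F ` Y" by (simp add: wreath_act_apply cong: image_cong)
  have inv: "inv_into Y (\<lambda>y. ?g (Inl y)) = inv_into Y ?F"
    by (simp add: inv_into_def wreath_act_apply fun_eq_iff cong: conj_cong)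
  have "ct_pairs ?t X (\<lambda>i. ?g (Inr i)) x = ct_pairs ?t X ((\<lambda>i. f (Inr i)) \<circ> p) x"
    by (rule ct_pairs_cong) (simp add: wreath_act_apply)
  also have "\<dots> = wreath_char K \<epsilon> \<delta> p \<odot>\<^bsub>P (?F ` Y)\<^esub> ct_pairs ?t X (\<lambda>i. f (Inr i)) x"
    using ct_pairs_wreath[OF assms(3) a(1) assms(4)] by (simp only: a(3))
  finally show ?thesis
    unfolding bact_def im inv
    using lin_smult[OF rl_lin[OF fin inj_on_inv_into[of "?F ` Y" ?F Y]] wreath_char_closed]
      ct_pairs_closed[OF a(1) assms(4), unfolded a(3)] inv_into_image[OF a(2)] by simp
qed

text \<open>
  By equivariance the change of labels between the two groups of contractions can be moved to the
  end, where the two changes of labels combine.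
\<close>

lemma bact_comp:
  assumes X: "finite X" and f: "f \<in> arr brauer Y X" and g: "g \<in> arr brauer Z Y" and x: "x \<in> carrier (P X)"
  shows "bact X Z (cmp brauer Z Y X f g) x = bact Y Z g (bact X Y f x)"
proof -
  let ?c = "cmp brauer Z Y X f g" and ?r = "half_diff Z Y" and ?s = "half_diff Y X"
  let ?F = "\<lambda>y. f (Inl y)" and ?G = "\<lambda>z. g (Inl z)" and ?H = "\<lambda>z. ?c (Inl z)"
  let ?fi = "\<lambda>i. f (Inr i)" and ?gi = "\<lambda>i. g (Inr i)" and ?ci = "\<lambda>i. ?c (Inr i)"
  note c = cmp_arr[OF f g]
  note af = arr_parts[OF X f]
  have FY: "finite (?F ` Y)" using af(4) X by (rule finite_subset)
  then have Y: "finite Y" using af(2) by (rule finite_imageD)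
  note ag = arr_parts[OF Y g]
  note ac = arr_parts[OF X c(1)]
  let ?\<phi> = "inv_into Y ?F" and ?\<gamma> = "inv_into Z ?G"
  define y1 where "y1 = ct_pairs ?s X ?fi x"
  have y1: "y1 \<in> carrier (P (?F ` Y))" using ct_pairs_closed[OF af(1) x] unfolding af(3) y1_def .
  define y2 where "y2 = ct_pairs ?r (?F ` Y) (\<lambda>i. ?F (?gi i)) y1"
  have pairs_in: "pairs_in ?r (?F ` Y) (\<lambda>i. ?F (?gi i))"
    using ag(1) af(2) FY unfolding pairs_in_def
    by (auto intro!: comp_inj_on[of ?gi _ ?F, unfolded comp_def] intro: inj_on_subset)
  have gi: "?gi ` {1..2 * ?r} \<subseteq> Y" using ag(1) by (simp add: pairs_in_def)
  have "(\<lambda>i. ?F (?gi i)) ` {1..2 * ?r} = ?F ` ?gi ` {1..2 * ?r}" by (simp add: image_image)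
  then have "?F ` Y - (\<lambda>i. ?F (?gi i)) ` {1..2 * ?r} = ?F ` (Y - ?gi ` {1..2 * ?r})"
    using inj_on_image_set_diff[OF af(2) _ gi, of Y] by simp
  then have rest: "?F ` Y - (\<lambda>i. ?F (?gi i)) ` {1..2 * ?r} = ?F ` ?G ` Z" by (simp only: ag(3))
  have y2: "y2 \<in> carrier (P (?F ` ?G ` Z))" using ct_pairs_closed[OF pairs_in y1] unfolding rest y2_def .
  have H: "?H ` Z = ?F ` ?G ` Z" using c(3) by (auto simp: image_image)
  have \<phi>F: "?\<phi> (?F y) = y" if "y \<in> Y" for y by (rule inv_into_f_f[OF af(2) that])
  have inj\<phi>: "inj_on ?\<phi> (?F ` Y)" by (rule inj_on_inv_into) simp
  have \<phi>im: "?\<phi> ` ?F ` Y = Y" by (rule inv_into_image[OF af(2)])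
  have \<phi>im2: "?\<phi> ` ?F ` ?G ` Z = ?G ` Z" using \<phi>F ag(4) by (force simp: image_image)
  have "?ci ` {2 * ?r + 1..2 * ?r + 2 * ?s} = ?fi ` {1..2 * ?s}"
  proof -
    have shift: "{2 * ?r + 1..2 * ?r + 2 * ?s} = (\<lambda>i. i + 2 * ?r) ` {1..2 * ?s}" by (auto simp: image_add_atLeastAtMost')
    have "?ci ` {2 * ?r + 1..2 * ?r + 2 * ?s} = (\<lambda>i. ?ci (i + 2 * ?r)) ` {1..2 * ?s}"
      unfolding shift image_image ..
    also have "\<dots> = ?fi ` {1..2 * ?s}" by (rule image_cong[OF refl c(5)])
    finally show ?thesis .
  qed
  moreover have "ct_pairs ?s X (\<lambda>i. ?ci (i + 2 * ?r)) x = y1"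
    unfolding y1_def by (rule ct_pairs_cong) (rule c(5))
  ultimately have "ct_pairs (half_diff Z X) X ?ci x = ct_pairs ?r (?F ` Y) ?ci y1"
    unfolding c(2) ct_pairs_add by (simp only: af(3))
  also have "\<dots> = y2" unfolding y2_def by (rule ct_pairs_cong) (rule c(4))
  finally have L: "bact X Z ?c x = rl (?F ` ?G ` Z) (inv_into Z ?H) y2" unfolding bact_def H by simp
  have "ct_pairs ?r Y ?gi (rl (?F ` Y) ?\<phi> y1) = ct_pairs ?r (?\<phi> ` ?F ` Y) (\<lambda>i. ?\<phi> (?F (?gi i))) (rl (?F ` Y) ?\<phi> y1)"
    unfolding \<phi>im by (rule ct_pairs_cong[symmetric]) (use gi \<phi>F in blast)
  also have "\<dots> = rl (?F ` ?G ` Z) ?\<phi> y2"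
    using ct_pairs_rl[OF pairs_in inj\<phi> y1] unfolding rest y2_def by simp
  finally have "bact Y Z g (bact X Y f x) = rl (?G ` Z) ?\<gamma> (rl (?F ` ?G ` Z) ?\<phi> y2)"
    unfolding bact_def y1_def by simp
  also have "\<dots> = rl (?F ` ?G ` Z) (\<lambda>y. ?\<gamma> (?\<phi> y)) y2"
  proof -
    have FG: "?F ` ?G ` Z \<subseteq> ?F ` Y" using ag(4) by blast
    have fin: "finite (?F ` ?G ` Z)" using FG FY by (rule finite_subset)
    have i: "inj_on ?\<phi> (?F ` ?G ` Z)" using inj\<phi> FG by (rule inj_on_subset)
    have "inj_on ?\<gamma> (?\<phi> ` ?F ` ?G ` Z)" unfolding \<phi>im2 by (rule inj_on_inv_into) simp
    from rl_comp[OF fin i this y2] show ?thesis unfolding \<phi>im2 .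
  qed
  also have "\<dots> = rl (?F ` ?G ` Z) (inv_into Z ?H) y2"
  proof (rule rl_cong[OF _ _ _ y2, symmetric])
    show "finite (?F ` ?G ` Z)" using ag(4) FY by (meson finite_subset image_mono)
    show "inj_on (inv_into Z ?H) (?F ` ?G ` Z)" unfolding H[symmetric] by (rule inj_on_inv_into) simp
    fix y assume "y \<in> ?F ` ?G ` Z"
    then obtain z where z: "z \<in> Z" "y = ?F (?G z)" by blast
    have "inv_into Z ?H (?H z) = z" by (rule inv_into_f_f[OF ac(2) z(1)])
    moreover have "?\<gamma> (?\<phi> (?F (?G z))) = z"
      using \<phi>F[of "?G z"] ag(4) z(1) inv_into_f_f[OF ag(2) z(1)] by auto
    ultimately show "inv_into Z ?H y = ?\<gamma> (?\<phi> y)" using c(3)[OF z(1)] z(2) by simp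
  qed
  finally show ?thesis using L by simp
qed

end

context scalars begin

lemma kub_rels_subset: "kub_rels K \<epsilon> \<delta> Y X \<subseteq> carrier (free_space K (arr brauer Y X))"
proof -
  interpret F: Module.module K "free_space K (arr brauer Y X)" by (rule vspace_free)
  show ?thesis
    unfolding kub_rels_def Let_def
    by (auto simp: wreath_def intro!: F.minus_closed F.smult_closed free_gen_closed wreath_act_arr)
qed

lemma quotient_kub: "quotient K (free_space K (arr brauer Y X)) (kub_null K \<epsilon> \<delta> Y X)"
  unfolding kub_null_def by (intro quotient_span vspace_free kub_rels_subset)

lemma kdb_simps:
  "lob (kdb K \<epsilon> \<delta>) = {X. finite X}"
  "lhom (kdb K \<epsilon> \<delta>) X Y = quot_space (free_space K (arr brauer Y X)) (kub_null K \<epsilon> \<delta> Y X)"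
  "lident (kdb K \<epsilon> \<delta>) X = kub_class K \<epsilon> \<delta> X X (free_gen K (arr brauer X X) (ident brauer X))"
  "lcomp (kdb K \<epsilon> \<delta>) X Y Z g f =
    (\<Union>b\<in>f. \<Union>a\<in>g. kub_class K \<epsilon> \<delta> Z X (lcomp (linearization K brauer) Z Y X b a))"
  by (simp_all add: kdb_def kub_def opposite_def linearization_def Let_def brauer_simps)

lemma kdb_hom:
  "h \<in> carrier (lhom (kdb K \<epsilon> \<delta>) X Y) \<longleftrightarrow>
     (\<exists>r\<in>carrier (free_space K (arr brauer Y X)). h = kub_class K \<epsilon> \<delta> Y X r)"
proof -
  interpret Q: quotient K "free_space K (arr brauer Y X)" "kub_null K \<epsilon> \<delta> Y X" by (rule quotient_kub)
  show ?thesis by (auto simp: kdb_simps Q.quot_carrier kub_class_def)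
qed

lemma ident_arr: "ident brauer X \<in> arr brauer X X"
proof (rule brauer_arrI[where t = 0])
  have "bij_betw (\<lambda>z. case z of Inl x \<Rightarrow> x | Inr i \<Rightarrow> undefined) (X \<amalg> ({} :: nat set)) X"
    by (rule bij_betwI[where g = Inl]) auto
  then have "bij_betw (ident brauer X) (X \<amalg> {}) X"
    by (rule bij_betw_cong[THEN iffD1, rotated]) (simp add: brauer_simps)
  then show "bij_betw (ident brauer X) (X \<amalg> {1..2 * 0}) X" by simp
qed (simp_all add: brauer_simps)

end

context contraction_system begin

definition ext_act :: "'a set \<Rightarrow> 'a set \<Rightarrow> (('a + nat \<Rightarrow> 'a) \<Rightarrow> 'k) \<Rightarrow> 'p \<Rightarrow> 'p" where
  "ext_act X Y r x = free_ext (P Y) (arr brauer Y X) (\<lambda>f. bact X Y f x) r"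

text \<open>
  The choice of a representative does not matter by \<open>ext_act_coset\<close>.
\<close>

definition kdb_act :: "'a set \<Rightarrow> 'a set \<Rightarrow> (('a + nat \<Rightarrow> 'a) \<Rightarrow> 'k) set \<Rightarrow> 'p \<Rightarrow> 'p" where
  "kdb_act X Y H x = ext_act X Y (SOME r. r \<in> H) x"

context
  fixes X Y :: "'a set"
  assumes X: "finite X" and Y: "finite Y"
begin

lemma bact_closed: "f \<in> arr brauer Y X \<Longrightarrow> x \<in> carrier (P X) \<Longrightarrow> bact X Y f x \<in> carrier (P Y)"
  by (rule lin_closed[OF bact_lin[OF X]])

lemma ext_act_lin:
  assumes "x \<in> carrier (P X)"
  shows "(\<lambda>r. ext_act X Y r x) \<in> lin_maps K (free_space K (arr brauer Y X)) (P Y)"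
  unfolding ext_act_def by (intro free_ext_lin vspace_P Y bact_closed assms)

lemma ext_act_gen:
  assumes "f \<in> arr brauer Y X" "x \<in> carrier (P X)"
  shows "ext_act X Y (free_gen K (arr brauer Y X) f) x = bact X Y f x"
  unfolding ext_act_def using assms by (intro free_ext_gen vspace_P Y bact_closed)

lemma ext_act_lin_right:
  assumes "r \<in> carrier (free_space K (arr brauer Y X))"
  shows "ext_act X Y r \<in> lin_maps K (P X) (P Y)"
  using assms
proof (induction rule: free_induct)
  case zero
  interpret PY: Module.module K "P Y" by (rule vspace_P[OF Y])
  have "(\<lambda>x. \<zero>\<^bsub>P Y\<^esub>) \<in> lin_maps K (P X) (P Y)" by (intro lin_mapsI) auto
  then show ?case
    by (rule lin_maps_cong[OF vspace_P[OF X]]) (rule lin_zero[OF vspace_free vspace_P[OF Y] ext_act_lin])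
next
  case (gen f)
  then show ?case
    by (intro lin_maps_cong[OF vspace_P[OF X] bact_lin[OF X gen]] ext_act_gen)
next
  case (add r s)
  interpret PX: Module.module K "P X" by (rule vspace_P[OF X])
  interpret PY: Module.module K "P Y" by (rule vspace_P[OF Y])
  have "(\<lambda>x. ext_act X Y r x \<oplus>\<^bsub>P Y\<^esub> ext_act X Y s x) \<in> lin_maps K (P X) (P Y)"
    using lin_mapsD[OF add(3)] lin_mapsD[OF add(4)]
    by (intro lin_mapsI) (auto simp: PY.a_ac PY.smult_r_distr)
  then show ?case
    by (rule lin_maps_cong[OF vspace_P[OF X]]) (rule lin_add[OF ext_act_lin add(1,2)])
next
  case (smult a r)
  from lin_smult_map[OF vspace_P[OF Y] smult(3,1)] show ?case
    by (rule lin_maps_cong[OF vspace_P[OF X]]) (rule lin_smult[OF ext_act_lin smult(1,2)])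
qed

lemma ext_act_null:
  assumes r: "r \<in> kub_null K \<epsilon> \<delta> Y X" and x: "x \<in> carrier (P X)"
  shows "ext_act X Y r x = \<zero>\<^bsub>P Y\<^esub>"
proof (rule lin_span_kernel[OF vspace_free vspace_P[OF Y] ext_act_lin[OF x] kub_rels_subset _ r[unfolded kub_null_def]])
  fix q assume "q \<in> kub_rels K \<epsilon> \<delta> Y X"
  then obtain f p where f: "f \<in> arr brauer Y X" and p: "p \<in> wreath (half_diff Y X)"
    and q: "q = free_gen K (arr brauer Y X) (wreath_act Y X f p) \<ominus>\<^bsub>free_space K (arr brauer Y X)\<^esub>
      wreath_char K \<epsilon> \<delta> p \<odot>\<^bsub>free_space K (arr brauer Y X)\<^esub> free_gen K (arr brauer Y X) f"
    unfolding kub_rels_def Let_def by blast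
  interpret F: Module.module K "free_space K (arr brauer Y X)" by (rule vspace_free)
  interpret PY: Module.module K "P Y" by (rule vspace_P[OF Y])
  have g: "wreath_act Y X f p \<in> arr brauer Y X" using p by (intro wreath_act_arr[OF f]) (simp add: wreath_def)
  show "ext_act X Y q x = \<zero>\<^bsub>P Y\<^esub>"
    unfolding q
    using bact_closed[OF f x]
    by (simp add: lin_diff[OF vspace_free vspace_P[OF Y] ext_act_lin[OF x]] free_gen_closed f g
        lin_smult[OF ext_act_lin[OF x]] ext_act_gen[OF f x] ext_act_gen[OF g x] bact_wreath[OF X f p x]
        vspace_diff_eq_zero[OF vspace_P[OF Y]])
qed

lemma ext_act_coset:
  assumes r: "r \<in> carrier (free_space K (arr brauer Y X))" and s: "s \<in> kub_class K \<epsilon> \<delta> Y X r"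
    and x: "x \<in> carrier (P X)"
  shows "ext_act X Y s x = ext_act X Y r x"
proof -
  interpret Q: quotient K "free_space K (arr brauer Y X)" "kub_null K \<epsilon> \<delta> Y X" by (rule quotient_kub)
  interpret PY: Module.module K "P Y" by (rule vspace_P[OF Y])
  obtain n where n: "n \<in> kub_null K \<epsilon> \<delta> Y X" "s = n \<oplus>\<^bsub>free_space K (arr brauer Y X)\<^esub> r"
    using s by (auto simp: kub_class_def a_r_coset_def')
  then show ?thesis
    using Q.sub_G r lin_closed[OF ext_act_lin[OF x] r]
    by (auto simp: lin_add[OF ext_act_lin[OF x]] ext_act_null[OF n(1) x])
qed

lemma kdb_act_class:
  assumes r: "r \<in> carrier (free_space K (arr brauer Y X))" and x: "x \<in> carrier (P X)"
  shows "kdb_act X Y (kub_class K \<epsilon> \<delta> Y X r) x = ext_act X Y r x"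
proof -
  interpret Q: quotient K "free_space K (arr brauer Y X)" "kub_null K \<epsilon> \<delta> Y X" by (rule quotient_kub)
  have "r \<in> kub_class K \<epsilon> \<delta> Y X r" using Q.Q.a_rcos_self r unfolding kub_class_def by blast
  then have "(SOME s. s \<in> kub_class K \<epsilon> \<delta> Y X r) \<in> kub_class K \<epsilon> \<delta> Y X r"
    unfolding some_in_eq by blast
  then show ?thesis unfolding kdb_act_def by (rule ext_act_coset[OF r _ x])
qed

end

lemma ext_act_comp:
  assumes fin: "finite X" "finite Y" "finite Z" and b: "b \<in> carrier (free_space K (arr brauer Y X))"
    and a: "a \<in> carrier (free_space K (arr brauer Z Y))" and x: "x \<in> carrier (P X)"
  shows "lcomp (linearization K brauer) Z Y X b a \<in> carrier (free_space K (arr brauer Z X))"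
    and "ext_act X Z (lcomp (linearization K brauer) Z Y X b a) x = ext_act Y Z a (ext_act X Y b x)"
proof -
  let ?F = "free_space K (arr brauer Z X)"
  interpret F: Module.module K ?F by (rule vspace_free)
  interpret PZ: Module.module K "P Z" by (rule vspace_P[OF fin(3)])
  interpret PY: Module.module K "P Y" by (rule vspace_P[OF fin(2)])
  let ?B = "free_supp K (arr brauer Y X) b" and ?A = "free_supp K (arr brauer Z Y) a"
  have B: "finite ?B" "\<And>g. g \<in> ?B \<Longrightarrow> g \<in> arr brauer Y X" "\<And>g. g \<in> ?B \<Longrightarrow> b g \<in> carrier K"
    using free_carrierD[OF b] by (auto simp: free_supp_def)
  have A: "finite ?A" "\<And>f. f \<in> ?A \<Longrightarrow> f \<in> arr brauer Z Y" "\<And>f. f \<in> ?A \<Longrightarrow> a f \<in> carrier K"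
    using free_carrierD[OF a] by (auto simp: free_supp_def)
  let ?gen = "\<lambda>g f. free_gen K (arr brauer Z X) (cmp brauer Z Y X g f)"
  have gen: "?gen g f \<in> carrier ?F" if "g \<in> ?B" "f \<in> ?A" for g f
    by (intro free_gen_closed cmp_arr(1) A(2) B(2) that)
  have eq: "lcomp (linearization K brauer) Z Y X b a =
      (\<Oplus>\<^bsub>?F\<^esub>g\<in>?B. \<Oplus>\<^bsub>?F\<^esub>f\<in>?A. (b g \<otimes>\<^bsub>K\<^esub> a f) \<odot>\<^bsub>?F\<^esub> ?gen g f)"
    by (simp add: linearization_def Let_def)
  have cl: "(b g \<otimes>\<^bsub>K\<^esub> a f) \<odot>\<^bsub>?F\<^esub> ?gen g f \<in> carrier ?F" if "g \<in> ?B" "f \<in> ?A" for g f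
    using A(3) B(3) gen that by simp
  have cl': "(\<Oplus>\<^bsub>?F\<^esub>f\<in>?A. (b g \<otimes>\<^bsub>K\<^esub> a f) \<odot>\<^bsub>?F\<^esub> ?gen g f) \<in> carrier ?F" if "g \<in> ?B" for g
    using cl[OF that] by (intro F.finsum_closed) auto
  show "lcomp (linearization K brauer) Z Y X b a \<in> carrier ?F"
    unfolding eq using cl' by (intro F.finsum_closed) auto
  have bx: "bact X Y g x \<in> carrier (P Y)" if "g \<in> ?B" for g by (rule bact_closed[OF fin(1,2) B(2)[OF that] x])
  have fbx: "bact Y Z f (bact X Y g x) \<in> carrier (P Z)" if "g \<in> ?B" "f \<in> ?A" for f g
    by (rule bact_closed[OF fin(2,3) A(2)[OF that(2)] bx[OF that(1)]])
  note L = ext_act_lin[OF fin(1,3) x]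
  have inner: "ext_act X Z (\<Oplus>\<^bsub>?F\<^esub>f\<in>?A. (b g \<otimes>\<^bsub>K\<^esub> a f) \<odot>\<^bsub>?F\<^esub> ?gen g f) x =
      b g \<odot>\<^bsub>P Z\<^esub> ext_act Y Z a (bact X Y g x)" if g: "g \<in> ?B" for g
  proof -
    have "ext_act X Z (\<Oplus>\<^bsub>?F\<^esub>f\<in>?A. (b g \<otimes>\<^bsub>K\<^esub> a f) \<odot>\<^bsub>?F\<^esub> ?gen g f) x =
        (\<Oplus>\<^bsub>P Z\<^esub>f\<in>?A. ext_act X Z ((b g \<otimes>\<^bsub>K\<^esub> a f) \<odot>\<^bsub>?F\<^esub> ?gen g f) x)"
      by (rule lin_finsum[OF vspace_free vspace_P[OF fin(3)] L A(1) cl[OF g]])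
    also have "\<dots> = (\<Oplus>\<^bsub>P Z\<^esub>f\<in>?A. b g \<odot>\<^bsub>P Z\<^esub> (a f \<odot>\<^bsub>P Z\<^esub> bact Y Z f (bact X Y g x)))"
    proof (rule PZ.finsum_cong')
      fix f assume f: "f \<in> ?A"
      have "ext_act X Z (?gen g f) x = bact Y Z f (bact X Y g x)"
        using ext_act_gen[OF fin(1,3) cmp_arr(1)[OF B(2)[OF g] A(2)[OF f]] x]
          bact_comp[OF fin(1) B(2)[OF g] A(2)[OF f] x] by simp
      then show "ext_act X Z ((b g \<otimes>\<^bsub>K\<^esub> a f) \<odot>\<^bsub>?F\<^esub> ?gen g f) x =
          b g \<odot>\<^bsub>P Z\<^esub> (a f \<odot>\<^bsub>P Z\<^esub> bact Y Z f (bact X Y g x))"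
        using lin_smult[OF L _ gen[OF g f]] A(3)[OF f] B(3)[OF g] fbx[OF g f] by (simp add: PZ.smult_assoc1)
    qed (use A(3) B(3) g fbx in auto)
    also have "\<dots> = b g \<odot>\<^bsub>P Z\<^esub> (\<Oplus>\<^bsub>P Z\<^esub>f\<in>?A. a f \<odot>\<^bsub>P Z\<^esub> bact Y Z f (bact X Y g x))"
      using A(1,3) B(3)[OF g] fbx[OF g] by (intro PZ.finsum_smult_ldistr[symmetric]) auto
    finally show ?thesis by (simp add: ext_act_def free_ext_def)
  qed
  note R = ext_act_lin_right[OF fin(2,3) a]
  have "ext_act X Z (lcomp (linearization K brauer) Z Y X b a) x =
      (\<Oplus>\<^bsub>P Z\<^esub>g\<in>?B. ext_act X Z (\<Oplus>\<^bsub>?F\<^esub>f\<in>?A. (b g \<otimes>\<^bsub>K\<^esub> a f) \<odot>\<^bsub>?F\<^esub> ?gen g f) x)"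
    unfolding eq by (rule lin_finsum[OF vspace_free vspace_P[OF fin(3)] L B(1) cl'])
  also have "\<dots> = (\<Oplus>\<^bsub>P Z\<^esub>g\<in>?B. ext_act Y Z a (b g \<odot>\<^bsub>P Y\<^esub> bact X Y g x))"
    using lin_smult[OF R B(3) bx] lin_closed[OF R] B(3) bx
    by (intro PZ.finsum_cong') (auto simp: inner)
  also have "\<dots> = ext_act Y Z a (\<Oplus>\<^bsub>P Y\<^esub>g\<in>?B. b g \<odot>\<^bsub>P Y\<^esub> bact X Y g x)"
    using B(3) bx by (intro lin_finsum[OF vspace_P[OF fin(2)] vspace_P[OF fin(3)] R B(1), symmetric]) auto
  finally show "ext_act X Z (lcomp (linearization K brauer) Z Y X b a) x = ext_act Y Z a (ext_act X Y b x)"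
    by (simp add: ext_act_def[of X Y] free_ext_def)
qed

definition kdb_module :: "('a set, (('a + nat \<Rightarrow> 'a) \<Rightarrow> 'k) set, 'k, 'p) functor_data" where
  "kdb_module = \<lparr>space = P, act = kdb_act\<rparr>"

lemma cat_module_kdb: "cat_module K (kdb K \<epsilon> \<delta>) kdb_module"
proof (rule cat_module.intro)
  fix X :: "'a set" assume "X \<in> lob (kdb K \<epsilon> \<delta>)"
  then show "Module.module K (space kdb_module X)" by (simp add: kdb_simps kdb_module_def vspace_P)
next
  fix X Y :: "'a set" and h assume *: "X \<in> lob (kdb K \<epsilon> \<delta>)" "Y \<in> lob (kdb K \<epsilon> \<delta>)" "h \<in> carrier (lhom (kdb K \<epsilon> \<delta>) X Y)"
  then have fin: "finite X" "finite Y" by (simp_all add: kdb_simps)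
  obtain r where r: "r \<in> carrier (free_space K (arr brauer Y X))" "h = kub_class K \<epsilon> \<delta> Y X r"
    using *(3) by (auto simp: kdb_hom)
  have "kdb_act X Y h \<in> lin_maps K (P X) (P Y)"
    unfolding r(2)
    by (rule lin_maps_cong[OF vspace_P[OF fin(1)] ext_act_lin_right[OF fin r(1)] kdb_act_class[OF fin r(1)]])
  then show "act kdb_module X Y h \<in> lin_maps K (space kdb_module X) (space kdb_module Y)"
    by (simp add: kdb_module_def)
next
  fix X Y :: "'a set" and h h' x
  assume *: "X \<in> lob (kdb K \<epsilon> \<delta>)" "Y \<in> lob (kdb K \<epsilon> \<delta>)" "h \<in> carrier (lhom (kdb K \<epsilon> \<delta>) X Y)"
    "h' \<in> carrier (lhom (kdb K \<epsilon> \<delta>) X Y)" "x \<in> carrier (space kdb_module X)"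
  then have fin: "finite X" "finite Y" and x: "x \<in> carrier (P X)" by (simp_all add: kdb_simps kdb_module_def)
  obtain r where r: "r \<in> carrier (free_space K (arr brauer Y X))" "h = kub_class K \<epsilon> \<delta> Y X r"
    using *(3) by (auto simp: kdb_hom)
  obtain r' where r': "r' \<in> carrier (free_space K (arr brauer Y X))" "h' = kub_class K \<epsilon> \<delta> Y X r'"
    using *(4) by (auto simp: kdb_hom)
  interpret Q: quotient K "free_space K (arr brauer Y X)" "kub_null K \<epsilon> \<delta> Y X" by (rule quotient_kub)
  have "h \<oplus>\<^bsub>lhom (kdb K \<epsilon> \<delta>) X Y\<^esub> h' = kub_class K \<epsilon> \<delta> Y X (r \<oplus>\<^bsub>free_space K (arr brauer Y X)\<^esub> r')"
    using Q.quot_add[OF r(1) r'(1)] by (simp add: kdb_simps r(2) r'(2) kub_class_def)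
  then show "act kdb_module X Y (h \<oplus>\<^bsub>lhom (kdb K \<epsilon> \<delta>) X Y\<^esub> h') x =
      act kdb_module X Y h x \<oplus>\<^bsub>space kdb_module Y\<^esub> act kdb_module X Y h' x"
    using r r' by (simp add: kdb_module_def kdb_act_class[OF fin _ x] lin_add[OF ext_act_lin[OF fin x]])
next
  fix X Y :: "'a set" and a h x
  assume *: "X \<in> lob (kdb K \<epsilon> \<delta>)" "Y \<in> lob (kdb K \<epsilon> \<delta>)" "a \<in> carrier K"
    "h \<in> carrier (lhom (kdb K \<epsilon> \<delta>) X Y)" "x \<in> carrier (space kdb_module X)"
  then have fin: "finite X" "finite Y" and x: "x \<in> carrier (P X)" by (simp_all add: kdb_simps kdb_module_def)
  obtain r where r: "r \<in> carrier (free_space K (arr brauer Y X))" "h = kub_class K \<epsilon> \<delta> Y X r"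
    using *(4) by (auto simp: kdb_hom)
  interpret Q: quotient K "free_space K (arr brauer Y X)" "kub_null K \<epsilon> \<delta> Y X" by (rule quotient_kub)
  have "a \<odot>\<^bsub>lhom (kdb K \<epsilon> \<delta>) X Y\<^esub> h = kub_class K \<epsilon> \<delta> Y X (a \<odot>\<^bsub>free_space K (arr brauer Y X)\<^esub> r)"
    using Q.quot_smult[OF *(3) r(1)] by (simp add: kdb_simps r(2) kub_class_def)
  then show "act kdb_module X Y (a \<odot>\<^bsub>lhom (kdb K \<epsilon> \<delta>) X Y\<^esub> h) x =
      a \<odot>\<^bsub>space kdb_module Y\<^esub> act kdb_module X Y h x"
    using r *(3) by (simp add: kdb_module_def kdb_act_class[OF fin _ x] lin_smult[OF ext_act_lin[OF fin x]])
next
  fix X :: "'a set" and x assume *: "X \<in> lob (kdb K \<epsilon> \<delta>)" "x \<in> carrier (space kdb_module X)"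
  then have fin: "finite X" and x: "x \<in> carrier (P X)" by (simp_all add: kdb_simps kdb_module_def)
  show "act kdb_module X X (lident (kdb K \<epsilon> \<delta>) X) x = x"
    using kdb_act_class[OF fin fin free_gen_closed[OF ident_arr] x] ext_act_gen[OF fin fin ident_arr x] bact_ident[OF fin x]
    by (simp add: kdb_module_def kdb_simps(3))
next
  fix X Y Z :: "'a set" and f g x
  assume *: "X \<in> lob (kdb K \<epsilon> \<delta>)" "Y \<in> lob (kdb K \<epsilon> \<delta>)" "Z \<in> lob (kdb K \<epsilon> \<delta>)"
    "f \<in> carrier (lhom (kdb K \<epsilon> \<delta>) X Y)" "g \<in> carrier (lhom (kdb K \<epsilon> \<delta>) Y Z)" "x \<in> carrier (space kdb_module X)"
  then have fin: "finite X" "finite Y" "finite Z" and x: "x \<in> carrier (P X)" by (simp_all add: kdb_simps kdb_module_def)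
  let ?h = "lcomp (kdb K \<epsilon> \<delta>) X Y Z g f"
  obtain b where b: "b \<in> carrier (free_space K (arr brauer Y X))" "f = kub_class K \<epsilon> \<delta> Y X b"
    using *(4) by (auto simp: kdb_hom)
  obtain a where a: "a \<in> carrier (free_space K (arr brauer Z Y))" "g = kub_class K \<epsilon> \<delta> Z Y a"
    using *(5) by (auto simp: kdb_hom)
  interpret Qb: quotient K "free_space K (arr brauer Y X)" "kub_null K \<epsilon> \<delta> Y X" by (rule quotient_kub)
  interpret Qa: quotient K "free_space K (arr brauer Z Y)" "kub_null K \<epsilon> \<delta> Z Y" by (rule quotient_kub)
  interpret Qc: quotient K "free_space K (arr brauer Z X)" "kub_null K \<epsilon> \<delta> Z X" by (rule quotient_kub)
  have sub: "f \<subseteq> carrier (free_space K (arr brauer Y X))" "g \<subseteq> carrier (free_space K (arr brauer Z Y))"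
    using Qb.V.a_r_coset_subset_G[OF Qb.sub_G b(1)] Qa.V.a_r_coset_subset_G[OF Qa.sub_G a(1)]
    by (simp_all add: b(2) a(2) kub_class_def)
  have self: "b \<in> f" "a \<in> g"
    using Qb.Q.a_rcos_self[OF b(1)] Qa.Q.a_rcos_self[OF a(1)] by (simp_all add: b(2) a(2) kub_class_def)
  have "lcomp (linearization K brauer) Z Y X b a \<in> kub_class K \<epsilon> \<delta> Z X (lcomp (linearization K brauer) Z Y X b a)"
    unfolding kub_class_def by (rule Qc.Q.a_rcos_self[OF ext_act_comp(1)[OF fin b(1) a(1) x]])
  then have "?h \<noteq> {}" unfolding kdb_simps(4) using self by blast
  then have "(SOME r. r \<in> ?h) \<in> ?h" unfolding some_in_eq .
  \<comment> \<open>the composite is a union of cosets, one for each choice of representatives \<open>b'\<close> and \<open>a'\<close>; every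
    element of it acts as the composite of the two actions, whichever coset it comes from\<close>
  then obtain b' a' where ba: "b' \<in> f" "a' \<in> g"
    "(SOME r. r \<in> ?h) \<in> kub_class K \<epsilon> \<delta> Z X (lcomp (linearization K brauer) Z Y X b' a')"
    unfolding kdb_simps(4) by blast
  have ba': "b' \<in> carrier (free_space K (arr brauer Y X))" "a' \<in> carrier (free_space K (arr brauer Z Y))"
    using ba sub by auto
  have "kdb_act X Z ?h x = ext_act X Z (lcomp (linearization K brauer) Z Y X b' a') x"
    unfolding kdb_act_def by (rule ext_act_coset[OF fin(1,3) ext_act_comp(1)[OF fin ba' x] ba(3) x])
  also have "\<dots> = ext_act Y Z a' (ext_act X Y b' x)" by (rule ext_act_comp(2)[OF fin ba' x])
  also have "ext_act X Y b' x = kdb_act X Y f x"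
    using ext_act_coset[OF fin(1,2) b(1) ba(1)[unfolded b(2)] x] kdb_act_class[OF fin(1,2) b(1) x] by (simp add: b(2))
  also have "ext_act Y Z a' (kdb_act X Y f x) = kdb_act Y Z g (kdb_act X Y f x)"
  proof -
    have y: "kdb_act X Y f x \<in> carrier (P Y)"
      using kdb_act_class[OF fin(1,2) b(1) x] lin_closed[OF ext_act_lin[OF fin(1,2) x] b(1)] by (simp add: b(2))
    show ?thesis
      using ext_act_coset[OF fin(2,3) a(1) ba(2)[unfolded a(2)] y] kdb_act_class[OF fin(2,3) a(1) y] by (simp add: a(2))
  qed
  finally show "act kdb_module X Z ?h x = act kdb_module Y Z g (act kdb_module X Y f x)"
    by (simp add: kdb_module_def)
qed

lemma kdb_act_gen:
  assumes "finite X" "finite Y" "f \<in> arr brauer Y X" "x \<in> carrier (P X)"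
  shows "kdb_act X Y (kdb_gen K \<epsilon> \<delta> X Y f) x = bact X Y f x"
  unfolding kdb_gen_def
  using kdb_act_class[OF assms(1,2) free_gen_closed[OF assms(3)] assms(4)] ext_act_gen[OF assms] by simp

lemma kdb_act_bij:
  assumes X: "finite X" and f: "bij_betw f X Y" and x: "x \<in> carrier (P X)"
  shows "kdb_act X Y (kdb_bij K \<epsilon> \<delta> X Y f) x = rl X f x"
proof -
  let ?g = "\<lambda>z\<in>Y \<amalg> ({} :: nat set). case z of Inl y \<Rightarrow> inv_into X f y | Inr i \<Rightarrow> undefined"
  have Y: "finite Y" using X bij_betw_finite[OF f] by simp
  have card: "card X = card Y" using bij_betw_same_card[OF f] .
  then have t: "half_diff Y X = 0" by (simp add: half_diff_def)
  have b: "bij_betw (inv_into X f) Y X" by (rule bij_betw_inv_into[OF f])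
  have gI: "?g (Inl y) = inv_into X f y" if "y \<in> Y" for y using that by auto
  have "bij_betw ?g (Y \<amalg> {}) X"
  proof (rule bij_betw_trans[of "\<lambda>z. case z of Inl y \<Rightarrow> y | Inr i \<Rightarrow> undefined" _ Y "inv_into X f", THEN bij_betw_cong[THEN iffD1, rotated]])
    show "bij_betw (\<lambda>z. case z of Inl y \<Rightarrow> y | Inr i \<Rightarrow> undefined) (Y \<amalg> ({} :: nat set)) Y"
      by (rule bij_betwI[where g = Inl]) auto
    show "bij_betw (inv_into X f) Y X" by (rule b)
  qed auto
  then have arr: "?g \<in> arr brauer Y X" using card by (intro brauer_arrI[where t = 0]) simp_all
  have im: "(\<lambda>y. ?g (Inl y)) ` Y = X"
    using bij_betw_imp_surj_on[OF b] gI by (simp cong: image_cong)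
  have inj: "inj_on (\<lambda>y. ?g (Inl y)) Y" using arr_parts(2)[OF X arr] .
  have "kdb_act X Y (kdb_bij K \<epsilon> \<delta> X Y f) x = bact X Y ?g x"
    unfolding kdb_bij_def by (rule kdb_act_gen[OF X Y arr x])
  also have "\<dots> = rl X (inv_into Y (\<lambda>y. ?g (Inl y))) x" unfolding bact_def im t by simp
  also have "\<dots> = rl X f x"
  proof (rule rl_cong[OF X _ _ x])
    show "inj_on (inv_into Y (\<lambda>y. ?g (Inl y))) X" using inj_on_inv_into[of X "\<lambda>y. ?g (Inl y)" Y] im by simp
    fix z assume z: "z \<in> X"
    have fz: "f z \<in> Y" using bij_betwE[OF f] z by blast
    have "?g (Inl (f z)) = z" using gI[OF fz] inv_into_f_f[OF bij_betw_imp_inj_on[OF f] z] by simp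
    then show "inv_into Y (\<lambda>y. ?g (Inl y)) z = f z" using inv_into_f_f[OF inj fz] by simp
  qed
  finally show ?thesis .
qed

lemma kdb_act_g:
  assumes X: "finite X" "u \<in> X" "v \<in> X" "u \<noteq> v" and x: "x \<in> carrier (P X)"
  shows "kdb_act X (X - {u, v}) (kdb_g K \<epsilon> \<delta> X u v) x = ct X u v x"
proof -
  let ?Y = "X - {u, v}"
  let ?g = "\<lambda>z\<in>?Y \<amalg> {1..2}. case z of Inl x \<Rightarrow> x | Inr i \<Rightarrow> if i = (1::nat) then u else v"
  have Y: "finite ?Y" using X by simp
  have card: "card X = card ?Y + 2 * 1"
  proof -
    have "card ?Y = card X - card {u, v}" using X by (intro card_Diff_subset) auto
    moreover have "card {u, v} \<le> card X" using X by (intro card_mono) auto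
    ultimately show ?thesis using X(4) by simp
  qed
  have t: "half_diff ?Y X = Suc 0" using half_diff_eq[OF card] by simp
  have "bij_betw ?g (?Y \<amalg> {1..2}) X"
    by (rule bij_betwI[where g = "\<lambda>x. if x = u then Inr 1 else if x = v then Inr 2 else Inl x"])
      (use X in \<open>auto split: if_splits\<close>)
  then have "bij_betw ?g (?Y \<amalg> {1..2 * 1}) X" unfolding mult_1_right .
  moreover have "?g \<in> extensional (?Y \<amalg> {1..2 * 1})" unfolding mult_1_right by (rule restrict_extensional)
  ultimately have arr: "?g \<in> arr brauer ?Y X" by (intro brauer_arrI[OF card])
  have gI: "?g (Inl y) = y" if "y \<in> ?Y" for y using that by auto
  have g: "?g (Inr 1) = u" "?g (Inr 2) = v" by auto
  have "(\<lambda>y. ?g (Inl y)) ` ?Y = (\<lambda>y. y) ` ?Y" by (rule image_cong[OF refl gI])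
  then have im: "(\<lambda>y. ?g (Inl y)) ` ?Y = ?Y" by (simp only: image_ident)
  have inj: "inj_on (\<lambda>y. ?g (Inl y)) ?Y" using arr_parts(2)[OF X(1) arr] .
  have c: "ct X u v x \<in> carrier (P ?Y)" by (rule lin_closed[OF ct_lin[OF X] x])
  have ct_pairs: "ct_pairs (half_diff ?Y X) X (\<lambda>i. ?g (Inr i)) x = ct X u v x"
    unfolding t ct_pairs.simps mult_0_right add_0 g ..
  have "kdb_act X ?Y (kdb_g K \<epsilon> \<delta> X u v) x = bact X ?Y ?g x"
    unfolding kdb_g_def by (rule kdb_act_gen[OF X(1) Y arr x])
  also have "\<dots> = rl ?Y (inv_into ?Y (\<lambda>y. ?g (Inl y))) (ct X u v x)"
    unfolding bact_def im ct_pairs ..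
  also have "\<dots> = ct X u v x"
  proof (rule rl_ident[OF Y _ c])
    fix y assume y: "y \<in> ?Y"
    show "inv_into ?Y (\<lambda>y. ?g (Inl y)) y = y" using inv_into_f_f[OF inj y] unfolding gI[OF y] .
  qed
  finally show ?thesis .
qed

end

locale contraction_system_hom = A: contraction_system K \<epsilon> \<delta> P rl ct + B: contraction_system K \<epsilon> \<delta> P' rl' ct'
  for K :: "'k ring" and \<epsilon> \<delta> :: parity and P :: "'a set \<Rightarrow> ('k, 'p) module" and rl ct
    and P' :: "'a set \<Rightarrow> ('k, 'q) module" and rl' ct' +
  fixes T :: "'a set \<Rightarrow> 'p \<Rightarrow> 'q"
  assumes T_lin: "finite X \<Longrightarrow> T X \<in> lin_maps K (P X) (P' X)"
    and T_rl: "\<lbrakk>finite X; inj_on f X; x \<in> carrier (P X)\<rbrakk> \<Longrightarrow> T (f ` X) (rl X f x) = rl' X f (T X x)"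
    and T_ct: "\<lbrakk>finite X; u \<in> X; v \<in> X; u \<noteq> v; x \<in> carrier (P X)\<rbrakk>
      \<Longrightarrow> T (X - {u, v}) (ct X u v x) = ct' X u v (T X x)"
begin

lemma T_ct_pairs:
  assumes "A.pairs_in t X h" "x \<in> carrier (P X)"
  shows "T (X - h ` {1..2 * t}) (A.ct_pairs t X h x) = B.ct_pairs t X h (T X x)"
  using assms
proof (induction t arbitrary: X x)
  case 0
  then show ?case by simp
next
  case (Suc t)
  note e = A.pairs_in_Suc[OF Suc.prems(1)]
  show ?case
    unfolding e(6) A.ct_pairs.simps B.ct_pairs.simps
    using Suc.IH[OF e(5) A.lin_closed[OF A.ct_lin[OF e(1-4)] Suc.prems(2)]] T_ct[OF e(1-4) Suc.prems(2)] by simp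
qed

lemma T_bact:
  assumes X: "finite X" and f: "f \<in> arr brauer Y X" and x: "x \<in> carrier (P X)"
  shows "T Y (A.bact X Y f x) = B.bact X Y f (T X x)"
proof -
  note a = A.arr_parts[OF X f]
  let ?F = "\<lambda>y. f (Inl y)"
  have fin: "finite (?F ` Y)" using a(4) X by (rule finite_subset)
  have inj: "inj_on (inv_into Y ?F) (?F ` Y)" by (rule inj_on_inv_into) simp
  have im: "inv_into Y ?F ` ?F ` Y = Y" by (rule A.inv_into_image[OF a(2)])
  show ?thesis
    unfolding A.bact_def B.bact_def
    using T_rl[OF fin inj A.ct_pairs_closed[OF a(1) x, unfolded a(3)]] T_ct_pairs[OF a(1) x] unfolding im a(3) by simp
qed

lemma T_kdb_module: "cat_module_hom K (kdb K \<epsilon> \<delta>) A.kdb_module B.kdb_module T"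
  unfolding cat_module_hom_def
proof (intro conjI ballI)
  fix X :: "'a set" assume "X \<in> lob (kdb K \<epsilon> \<delta>)"
  then show "T X \<in> lin_maps K (space A.kdb_module X) (space B.kdb_module X)"
    by (simp add: A.kdb_simps A.kdb_module_def B.kdb_module_def T_lin)
next
  fix X Y :: "'a set" and h x
  assume *: "X \<in> lob (kdb K \<epsilon> \<delta>)" "Y \<in> lob (kdb K \<epsilon> \<delta>)" "h \<in> carrier (lhom (kdb K \<epsilon> \<delta>) X Y)"
    "x \<in> carrier (space A.kdb_module X)"
  then have fin: "finite X" "finite Y" and x: "x \<in> carrier (P X)" by (simp_all add: A.kdb_simps A.kdb_module_def)
  obtain r where r: "r \<in> carrier (free_space K (arr brauer Y X))" "h = kub_class K \<epsilon> \<delta> Y X r"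
    using *(3) by (auto simp: A.kdb_hom)
  note Tx = A.lin_closed[OF T_lin[OF fin(1)] x]
  have "T Y (A.ext_act X Y r x) = B.ext_act X Y r (T X x)"
  proof (rule A.free_lin_eqI[OF B.vspace_P[OF fin(2)] A.lin_comp[OF A.ext_act_lin[OF fin x] T_lin[OF fin(2)]]
        B.ext_act_lin[OF fin Tx] _ r(1)])
    fix f assume f: "f \<in> arr brauer Y X"
    show "T Y (A.ext_act X Y (free_gen K (arr brauer Y X) f) x) = B.ext_act X Y (free_gen K (arr brauer Y X) f) (T X x)"
      unfolding A.ext_act_gen[OF fin f x] B.ext_act_gen[OF fin f Tx] by (rule T_bact[OF fin(1) f x])
  qed
  then show "T Y (act A.kdb_module X Y h x) = act B.kdb_module X Y h (T X x)"
    by (simp add: A.kdb_module_def B.kdb_module_def r(2) A.kdb_act_class[OF fin r(1) x] B.kdb_act_class[OF fin r(1) Tx])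
qed

end

section \<open>The module structures on the powers of a cyclic operad\<close>

lemma permute_to_end_nths:
  assumes "i < n" "j < n" "i \<noteq> j"
  obtains q where "q permutes {..<n}" "permute_list q [0..<n] = nths [0..<n] (- {i, j}) @ [i, j]"
proof -
  let ?N = "nths [0..<n] (- {i, j}) @ [i, j]"
  have S: "set (nths [0..<n] (- {i, j})) = {..<n} - {i, j}"
  proof (rule Set.set_eqI)
    fix x
    have "x \<in> set (nths [0..<n] (- {i, j})) \<longleftrightarrow> (\<exists>k. x = [0..<n] ! k \<and> k < n \<and> k \<in> - {i, j})"
      unfolding set_nths by simp
    also have "\<dots> \<longleftrightarrow> (\<exists>k. x = k \<and> k < n \<and> k \<in> - {i, j})" by (rule iff_exI) auto
    finally show "x \<in> set (nths [0..<n] (- {i, j})) \<longleftrightarrow> x \<in> {..<n} - {i, j}" by auto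
  qed
  have d: "distinct ?N" unfolding distinct_append S using assms(3) by simp
  have "set ?N = ({..<n} - {i, j}) \<union> {i, j}" unfolding set_append S by simp
  also have "\<dots> = set [0..<n]" using assms by auto
  finally have "mset ?N = mset [0..<n]"
    by (rule set_eq_iff_mset_eq_distinct[THEN iffD1, OF d distinct_upt])
  then obtain q where "q permutes {..<length [0..<n]}" "permute_list q [0..<n] = ?N"
    by (rule mset_eq_permutation)
  then show ?thesis using that by simp
qed

lemma permute_list_nths:
  assumes q: "q permutes {..<n}" and N: "permute_list q [0..<n] = nths [0..<n] I @ is" and len: "length xs = n"
  shows "permute_list q xs = nths xs I @ map ((!) xs) is"
proof -
  have xs: "map ((!) xs) [0..<n] = xs" using len map_nth[of xs] by simp
  have "q permutes {..<length [0..<n]}" using q by simp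
  from permute_list_map[OF this, of "(!) xs"]
  have "permute_list q (map ((!) xs) [0..<n]) = nths (map ((!) xs) [0..<n]) I @ map ((!) xs) is"
    unfolding N by (simp add: nths_map)
  then show ?thesis unfolding xs .
qed

context operad begin

lemma FB_map_cong:
  assumes X: "finite X" and f: "inj_on f X" and eq: "\<And>y. y \<in> X \<Longrightarrow> f y = g y"
    and x: "x \<in> carrier (powers_space K \<epsilon> C X)"
  shows "FB_map \<epsilon> X f x = FB_map \<epsilon> X g x"
proof -
  have g: "inj_on g X" using f eq by (simp add: inj_on_def)
  have im: "g ` X = f ` X" using eq by (simp cong: image_cong)
  have fX: "finite (f ` X)" using X by simp
  show ?thesis
    unfolding im
  proof (rule powers_lin_eqI[OF X vspace_powers[OF fX] FB_map_lin[OF X f] FB_map_lin[OF X g, unfolded im] _ x])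
    fix Us cs assume idx: "(Us, cs) \<in> powers_index C X"
    then have sub: "U \<subseteq> X" if "U \<in> set Us" for U using that by (auto simp: powers_index_iff)
    have "g y = f y" if "U \<in> set Us" "y \<in> U" for U y
      using sub[OF that(1)] that(2) eq by auto
    then have "map (image g) Us = map (image f) Us"
      by (intro map_cong[OF refl image_cong[OF refl]])
    moreover have "map2 (relabel g) Us cs = map2 (relabel f) Us cs"
    proof (rule nth_equalityI)
      fix i assume "i < length (map2 (relabel g) Us cs)"
      then have i: "i < length Us" "i < length cs" by auto
      then have "Us ! i \<subseteq> X" using sub by simp
      then have "relabel g (Us ! i) = relabel f (Us ! i)" using eq by (intro relabel_cong) auto
      then show "map2 (relabel g) Us cs ! i = map2 (relabel f) Us cs ! i" using i by simp
    qed simp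
    ultimately show "FB_map \<epsilon> X f (powers_class K \<epsilon> C X Us cs) =
        powers_FB_map K \<epsilon> C X (f ` X) g (powers_class K \<epsilon> C X Us cs)"
      unfolding FB_map_class[OF X f idx] FB_map_class[OF X g idx, unfolded im] by (simp only:)
  qed
qed

lemma contraction_system_powers:
  "contraction_system K \<epsilon> \<epsilon> (powers_space K \<epsilon> C) (\<lambda>X f. FB_map \<epsilon> X f) (contract \<epsilon>)"
proof (intro contraction_system.intro scalars_axioms contraction_system_axioms.intro, goal_cases)
  case 1
  then show ?case by (rule vspace_powers)
next
  case 2
  then show ?case by (rule FB_map_lin)
next
  case 3
  then show ?case by (rule FB_map_cong)
next
  case 4
  then show ?case by (rule FB_map_ident)
next
  case (5 X f g x)
  show ?case using FB_map_comp[OF 5] by (simp add: image_image)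
next
  case 6
  then show ?case by (rule contract_lin)
next
  case 7
  then show ?case by (rule contract_flip)
next
  case 8
  then show ?case by (rule contract_commute)
next
  case 9
  then show ?case by (rule contract_equivariant)
qed

end

definition powers_module ::
    "'k ring \<Rightarrow> parity \<Rightarrow> ('a, 'k, 'v) cyclic_operad \<Rightarrow>
     ('a set, (('a + nat \<Rightarrow> 'a) \<Rightarrow> 'k) set, 'k, ('a, 'k, 'v) powers) functor_data" where
  "powers_module K \<epsilon> C = contraction_system.kdb_module K (powers_space K \<epsilon> C)
     (\<lambda>X f. powers_FB_map K \<epsilon> C X (f ` X) f) (operad.contract K C \<epsilon>)"

context operad begin

lemma powers_module_cat: "cat_module K (kdb K \<epsilon> \<epsilon>) (powers_module K \<epsilon> C)"
  unfolding powers_module_def by (rule contraction_system.cat_module_kdb[OF contraction_system_powers])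

lemma powers_module_simps:
  "space (powers_module K \<epsilon> C) = powers_space K \<epsilon> C"
  "act (powers_module K \<epsilon> C) = contraction_system.kdb_act K (powers_space K \<epsilon> C) (\<lambda>X f. FB_map \<epsilon> X f) (contract \<epsilon>)"
  unfolding powers_module_def contraction_system.kdb_module_def[OF contraction_system_powers] by simp_all

lemma powers_module_extends: "extends_FB K \<epsilon> \<epsilon> (powers_module K \<epsilon> C) (powers K \<epsilon> C)"
  unfolding extends_FB_def
proof (intro conjI allI impI ballI)
  fix X :: "'a set" show "space (powers_module K \<epsilon> C) X = space (powers K \<epsilon> C) X"
    by (simp add: powers_module_simps powers_def)
next
  fix X Y :: "'a set" and f x
  assume fin: "finite X \<and> finite Y" and f: "f \<in> arr FB X Y" and "x \<in> carrier (space (powers K \<epsilon> C) X)"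
  then have x: "x \<in> carrier (powers_space K \<epsilon> C X)" by (simp add: powers_def)
  have bij: "bij_betw f X Y" using f by (simp add: FB_simps)
  then have Y: "f ` X = Y" and inj: "inj_on f X" by (auto simp: bij_betw_def)
  interpret PY: Module.module K "powers_space K \<epsilon> C Y" using fin by (intro vspace_powers) simp
  have "powers_FB_map K \<epsilon> C X Y f x \<in> carrier (powers_space K \<epsilon> C Y)"
    using lin_closed[OF FB_map_lin[OF _ inj, of \<epsilon>] x] fin unfolding Y by simp
  then have "act (powers K \<epsilon> C) X Y (kFB_gen K X Y f) x = powers_FB_map K \<epsilon> C X Y f x"
    by (simp add: powers_def free_supp_gen[OF f] free_gen_apply[OF f] f)
  then show "act (powers_module K \<epsilon> C) X Y (kdb_bij K \<epsilon> \<epsilon> X Y f) x = act (powers K \<epsilon> C) X Y (kFB_gen K X Y f) x"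
    using contraction_system.kdb_act_bij[OF contraction_system_powers _ bij x] fin
    by (simp add: powers_module_simps Y)
qed

lemma powers_module_g:
  assumes "finite X" "u \<in> X" "v \<in> X" "u \<noteq> v" "x \<in> carrier (powers_space K \<epsilon> C X)"
  shows "act (powers_module K \<epsilon> C) X (X - {u, v}) (kdb_g K \<epsilon> \<epsilon> X u v) x = contract \<epsilon> X u v x"
  unfolding powers_module_simps by (rule contraction_system.kdb_act_g[OF contraction_system_powers assms])

text \<open>
  Reordering is free for symmetric powers, so the factors that are composed can be taken out of any
  two positions while the others keep their order.
\<close>

lemma contract_Pos:
  assumes X: "finite X" "u \<in> X" "v \<in> X" "u \<noteq> v" and idx: "(Us, cs) \<in> powers_index C X"
    and ij: "i < length Us" "j < length Us" "i \<noteq> j" "u \<in> Us ! i" "v \<in> Us ! j"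
  shows "contract Pos X u v (powers_class K Pos C X Us cs) =
    powers_class K Pos C (X - {u, v}) (nths Us (- {i, j}) @ [(Us ! i - {u}) \<union> (Us ! j - {v})])
      (nths cs (- {i, j}) @ [comp (Us ! i) u (Us ! j) v (cs ! i) (cs ! j)])"
proof -
  interpret P: Module.module K "powers_space K Pos C X" by (rule vspace_powers[OF X(1)])
  have len: "length cs = length Us" by (rule powers_index_length[OF idx])
  obtain q where q0: "q permutes {..<length Us}"
    "permute_list q [0..<length Us] = nths [0..<length Us] (- {i, j}) @ [i, j]"
    by (rule permute_to_end_nths[OF ij(1-3)])
  have q: "q permutes {..<length Us}" "permute_list q Us = nths Us (- {i, j}) @ [Us ! i, Us ! j]"
    "permute_list q cs = nths cs (- {i, j}) @ [cs ! i, cs ! j]"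
    using q0(1) permute_list_nths[OF q0 refl] permute_list_nths[OF q0 len] by simp_all
  note idx' = powers_index_permute[OF idx q(1), unfolded q(2,3)]
  have "powers_class K Pos C X Us cs = powers_class K Pos C X (nths Us (- {i, j}) @ [Us ! i, Us ! j]) (nths cs (- {i, j}) @ [cs ! i, cs ! j])"
    using powers_class_permute[OF X(1) idx q(1), of Pos] powers_class_closed[OF X(1) idx]
    by (simp add: q sgn_char_def)
  then show ?thesis using contract_glue[OF X idx' ij(4,5)] by simp
qed

end

context operad_hom begin

lemma powers_module_hom:
  "cat_module_hom K (kdb K \<epsilon> \<epsilon>) (powers_module K \<epsilon> C) (powers_module K \<epsilon> C') (powers_map K \<epsilon> C C' \<phi>)"
  unfolding powers_module_def
  by (intro contraction_system_hom.T_kdb_module contraction_system_hom.intro contraction_system_hom_axioms.intro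
      S.contraction_system_powers T.contraction_system_powers ind_lin ind_FB_map ind_contract)

end

theorem theorem1:
  fixes K :: "'k ring"
  assumes "field K" and "char_zero K"
  shows
    "(\<exists>M :: ('a::infinite, 'k, 'v) cyclic_operad \<Rightarrow>
           ('a set, (('a + nat \<Rightarrow> 'a) \<Rightarrow> 'k) set, 'k, ('a, 'k, 'v) powers) functor_data.
      (\<forall>C. nonunital_cyclic_operad K C \<and> vanishes_on_empty C \<longrightarrow>
         cat_module K (kdb K Pos Pos) (M C) \<and>
         extends_FB K Pos Pos (M C) (S\<^sub>\<odot> K C) \<and>
         (\<forall>X u v Us cs i j.
            finite X \<and> u \<in> X \<and> v \<in> X \<and> u \<noteq> v \<and>
            Us \<in> decomps (length Us) X \<and> cs \<in> decorations C Us \<and>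
            i < length Us \<and> j < length Us \<and> u \<in> Us ! i \<and> v \<in> Us ! j \<longrightarrow>
            act (M C) X (X - {u, v}) (kdb_g K Pos Pos X u v) (powers_class K Pos C X Us cs) =
            (if i = j then \<zero>\<^bsub>space (S\<^sub>\<odot> K C) (X - {u, v})\<^esub>
             else powers_class K Pos C (X - {u, v})
                    (nths Us (- {i, j}) @ [(Us ! i - {u}) \<union> (Us ! j - {v})])
                    (nths cs (- {i, j}) @
                       [compo_pure K C (Us ! i) u (Us ! j) v (cs ! i) (cs ! j)])))) \<and>
      (\<forall>C C' \<phi>. nonunital_cyclic_operad K C \<and> vanishes_on_empty C \<and>
         nonunital_cyclic_operad K C' \<and> vanishes_on_empty C' \<and> cyclic_operad_hom K C C' \<phi> \<longrightarrow>
         cat_module_hom K (kdb K Pos Pos) (M C) (M C') (powers_map K Pos C C' \<phi>))) \<and>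
     (\<exists>M :: ('a::infinite, 'k, 'v) cyclic_operad \<Rightarrow>
           ('a set, (('a + nat \<Rightarrow> 'a) \<Rightarrow> 'k) set, 'k, ('a, 'k, 'v) powers) functor_data.
      (\<forall>C. nonunital_cyclic_operad K C \<and> vanishes_on_empty C \<longrightarrow>
         cat_module K (kdb K Neg Neg) (M C) \<and>
         extends_FB K Neg Neg (M C) (\<Lambda>\<^sub>\<odot> K C) \<and>
         (\<forall>X u v Us cs i.
            finite X \<and> u \<in> X \<and> v \<in> X \<and> u \<noteq> v \<and>
            Us \<in> decomps (length Us) X \<and> cs \<in> decorations C Us \<and>
            i < length Us \<and> u \<in> Us ! i \<and> v \<in> Us ! i \<longrightarrow>
            act (M C) X (X - {u, v}) (kdb_g K Neg Neg X u v) (powers_class K Neg C X Us cs) =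
            \<zero>\<^bsub>space (\<Lambda>\<^sub>\<odot> K C) (X - {u, v})\<^esub>) \<and>
         (\<forall>X u v Us U V cs a b.
            finite X \<and> u \<in> U \<and> v \<in> V \<and>
            Us @ [U, V] \<in> decomps (length Us + 2) X \<and>
            cs @ [a, b] \<in> decorations C (Us @ [U, V]) \<longrightarrow>
            act (M C) X (X - {u, v}) (kdb_g K Neg Neg X u v)
              (powers_class K Neg C X (Us @ [U, V]) (cs @ [a, b])) =
            powers_class K Neg C (X - {u, v})
              (Us @ [(U - {u}) \<union> (V - {v})]) (cs @ [compo_pure K C U u V v a b]))) \<and>
      (\<forall>C C' \<phi>. nonunital_cyclic_operad K C \<and> vanishes_on_empty C \<and>
         nonunital_cyclic_operad K C' \<and> vanishes_on_empty C' \<and> cyclic_operad_hom K C C' \<phi> \<longrightarrow>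
         cat_module_hom K (kdb K Neg Neg) (M C) (M C') (powers_map K Neg C C' \<phi>)))"
proof -
  have scalars: "scalars K" using assms(1) by (simp add: scalars_def)
  note operad = operad.intro[OF scalars]
  have g: "act (powers_module K \<epsilon> C) X (X - {u, v}) (kdb_g K \<epsilon> \<epsilon> X u v) (powers_class K \<epsilon> C X Us cs) =
      operad.contract K C \<epsilon> X u v (powers_class K \<epsilon> C X Us cs)"
    if C: "nonunital_cyclic_operad K C" and "finite X" "u \<in> X" "v \<in> X" "u \<noteq> v" "(Us, cs) \<in> powers_index C X"
    for C :: "('a, 'k, 'v) cyclic_operad" and \<epsilon> X u v Us cs
  proof -
    interpret operad K C by (rule operad[OF C])
    show ?thesis by (intro powers_module_g powers_class_closed that)
  qed
  have hom: "cat_module_hom K (kdb K \<epsilon> \<epsilon>) (powers_module K \<epsilon> C) (powers_module K \<epsilon> C') (powers_map K \<epsilon> C C' \<phi>)"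
    if "nonunital_cyclic_operad K C" "nonunital_cyclic_operad K C'" "cyclic_operad_hom K C C' \<phi>"
    for C C' :: "('a, 'k, 'v) cyclic_operad" and \<epsilon> \<phi>
    using that by (intro operad_hom.powers_module_hom operad_hom.intro operad operad_hom_axioms.intro)
  show ?thesis
  proof (rule conjI, goal_cases)
    case 1
    show ?case
    proof (rule exI[of _ "powers_module K Pos"], intro conjI allI impI)
      fix C :: "('a, 'k, 'v) cyclic_operad"
      assume "nonunital_cyclic_operad K C \<and> vanishes_on_empty C"
      then interpret operad K C by (intro operad) simp
      show "cat_module K (kdb K Pos Pos) (powers_module K Pos C)" by (rule powers_module_cat)
      show "extends_FB K Pos Pos (powers_module K Pos C) (S\<^sub>\<odot> K C)" by (rule powers_module_extends)
    next
      fix C :: "('a, 'k, 'v) cyclic_operad" and X u v Us cs i j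
      assume "nonunital_cyclic_operad K C \<and> vanishes_on_empty C"
      then have C: "nonunital_cyclic_operad K C" by simp
      interpret operad K C by (rule operad[OF C])
      assume *: "finite X \<and> u \<in> X \<and> v \<in> X \<and> u \<noteq> v \<and>
              Us \<in> decomps (length Us) X \<and> cs \<in> decorations C Us \<and>
              i < length Us \<and> j < length Us \<and> u \<in> Us ! i \<and> v \<in> Us ! j"
      then have X: "finite X" "u \<in> X" "v \<in> X" "u \<noteq> v" and idx: "(Us, cs) \<in> powers_index C X"
        by (simp_all add: powers_index_def)
      show "act (powers_module K Pos C) X (X - {u, v}) (kdb_g K Pos Pos X u v) (powers_class K Pos C X Us cs) =
              (if i = j then \<zero>\<^bsub>space (S\<^sub>\<odot> K C) (X - {u, v})\<^esub>
               else powers_class K Pos C (X - {u, v})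
                      (nths Us (- {i, j}) @ [(Us ! i - {u}) \<union> (Us ! j - {v})])
                      (nths cs (- {i, j}) @
                         [compo_pure K C (Us ! i) u (Us ! j) v (cs ! i) (cs ! j)]))"
      proof (cases "i = j")
        case True
        then show ?thesis
          using contract_same[OF X idx, of "Us ! i"] * by (simp add: g[OF C X idx] powers_def)
      next
        case False
        then show ?thesis
          using contract_Pos[OF X idx _ _ False] * by (simp add: g[OF C X idx])
      qed
    next
      fix C C' :: "('a, 'k, 'v) cyclic_operad" and \<phi> :: "'a set \<Rightarrow> 'v \<Rightarrow> 'v"
      assume "nonunital_cyclic_operad K C \<and> vanishes_on_empty C \<and>
           nonunital_cyclic_operad K C' \<and> vanishes_on_empty C' \<and> cyclic_operad_hom K C C' \<phi>"
      then show "cat_module_hom K (kdb K Pos Pos) (powers_module K Pos C) (powers_module K Pos C') (powers_map K Pos C C' \<phi>)"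
        by (intro hom) simp_all
    qed
  next
    case 2
    show ?case
    proof (rule exI[of _ "powers_module K Neg"], intro conjI allI impI)
      fix C :: "('a, 'k, 'v) cyclic_operad"
      assume "nonunital_cyclic_operad K C \<and> vanishes_on_empty C"
      then interpret operad K C by (intro operad) simp
      show "cat_module K (kdb K Neg Neg) (powers_module K Neg C)" by (rule powers_module_cat)
      show "extends_FB K Neg Neg (powers_module K Neg C) (\<Lambda>\<^sub>\<odot> K C)" by (rule powers_module_extends)
    next
      fix C :: "('a, 'k, 'v) cyclic_operad" and X u v Us cs i
      assume "nonunital_cyclic_operad K C \<and> vanishes_on_empty C"
      then have C: "nonunital_cyclic_operad K C" by simp
      interpret operad K C by (rule operad[OF C])
      assume *: "finite X \<and> u \<in> X \<and> v \<in> X \<and> u \<noteq> v \<and>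
              Us \<in> decomps (length Us) X \<and> cs \<in> decorations C Us \<and>
              i < length Us \<and> u \<in> Us ! i \<and> v \<in> Us ! i"
      then have X: "finite X" "u \<in> X" "v \<in> X" "u \<noteq> v" and idx: "(Us, cs) \<in> powers_index C X"
        by (simp_all add: powers_index_def)
      show "act (powers_module K Neg C) X (X - {u, v}) (kdb_g K Neg Neg X u v) (powers_class K Neg C X Us cs) =
              \<zero>\<^bsub>space (\<Lambda>\<^sub>\<odot> K C) (X - {u, v})\<^esub>"
        using contract_same[OF X idx, of "Us ! i"] * by (simp add: g[OF C X idx] powers_def)
    next
      fix C :: "('a, 'k, 'v) cyclic_operad" and X u v Us U V cs a b
      assume "nonunital_cyclic_operad K C \<and> vanishes_on_empty C"
      then have C: "nonunital_cyclic_operad K C" by simp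
      interpret operad K C by (rule operad[OF C])
      assume *: "finite X \<and> u \<in> U \<and> v \<in> V \<and>
              Us @ [U, V] \<in> decomps (length Us + 2) X \<and>
              cs @ [a, b] \<in> decorations C (Us @ [U, V])"
      then have idx: "(Us @ [U, V], cs @ [a, b]) \<in> powers_index C X"
        by (simp add: powers_index_def)
      then have "U \<inter> V = {}" "U \<subseteq> X" "V \<subseteq> X" by (auto simp: powers_index_iff sorted_wrt_append)
      then have X: "finite X" "u \<in> X" "v \<in> X" "u \<noteq> v" using * by auto
      show "act (powers_module K Neg C) X (X - {u, v}) (kdb_g K Neg Neg X u v)
                (powers_class K Neg C X (Us @ [U, V]) (cs @ [a, b])) =
              powers_class K Neg C (X - {u, v})
                (Us @ [(U - {u}) \<union> (V - {v})]) (cs @ [compo_pure K C U u V v a b])"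
        unfolding g[OF C X idx] using contract_glue[OF X idx] * by simp
    next
      fix C C' :: "('a, 'k, 'v) cyclic_operad" and \<phi> :: "'a set \<Rightarrow> 'v \<Rightarrow> 'v"
      assume "nonunital_cyclic_operad K C \<and> vanishes_on_empty C \<and>
           nonunital_cyclic_operad K C' \<and> vanishes_on_empty C' \<and> cyclic_operad_hom K C C' \<phi>"
      then show "cat_module_hom K (kdb K Neg Neg) (powers_module K Neg C) (powers_module K Neg C') (powers_map K Neg C C' \<phi>)"
        by (intro hom) simp_all
    qed
  qed
qed

end
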